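(* Let $P\subset\mathbb{R}^n$ be a Delzant polytope and let $u$ be a normalized symplectic potential on $P$ such that the Riemannian curvature of the corresponding toric Kähler metric is bounded by $1$, i.e. $|Rm|\le 1$, and such that $\int_{\partial P}u\,d\sigma<C_1$ for a constant $C_1$. Then there exists a constant $C=C(C_1,P)$ depending only on $C_1$ and $P$ such that $\max_P u<C$.
   Context: $P$ has facets $P_1,\dots,P_d$ with primitive inward normals $\vec n_i\in\mathbb Z^n$ and affine functions $l_i(x)=\langle x,\vec n_i\rangle+c_i$ vanishing on $P_i$ and positive in the interior. A symplectic potential is a function $u$ on $\bar P$, smooth and strictly convex in the interior, whose restriction to each face of $\partial P$ is smooth and strictly convex, and with $u=\frac12\sum_{i=1}^d l_i\ln l_i+f$, $f$ smooth on $\bar P$; it determines a toric invariant Kähler metric. Write $(u^{ij})$ for the inverse of the Hessian and $u^{ij}_{~kl}=\partial_k\partial_l u^{ij}$; the Riemannian curvature satisfies $|Rm|^2=\sum_{i,j,k,l}u^{ij}_{~kl}u^{kl}_{~ij}$. A point $x_0$ in the interior of $P$ is fixed, and $u$ is normalized if $u(x_0)=0$ and $Du(x_0)=0$. The measure $d\sigma$ on $\partial P$ is, on each facet $P_i$, Lebesgue measure divided by $|\vec n_i|$. *)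

theory Defs
  imports "HOL-Analysis.Analysis"
begin

definition aff_fun :: "(nat \<Rightarrow> real^'n) \<Rightarrow> (nat \<Rightarrow> real) \<Rightarrow> nat \<Rightarrow> real^'n \<Rightarrow> real" where
  "aff_fun nv c i x = nv i \<bullet> x + c i"

definition polytope_of :: "(nat \<Rightarrow> real^'n) \<Rightarrow> (nat \<Rightarrow> real) \<Rightarrow> nat \<Rightarrow> (real^'n) set" where
  "polytope_of nv c d = {x. \<forall>i<d. 0 \<le> aff_fun nv c i x}"

definition facet_of_index :: "(nat \<Rightarrow> real^'n) \<Rightarrow> (nat \<Rightarrow> real) \<Rightarrow> nat \<Rightarrow> nat \<Rightarrow> (real^'n) set" where
  "facet_of_index nv c d i = {x \<in> polytope_of nv c d. aff_fun nv c i x = 0}"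

definition int_vec :: "real^'n \<Rightarrow> bool" where
  "int_vec z \<longleftrightarrow> (\<forall>k. z $ k \<in> \<int>)"

definition primitive_int_vec :: "real^'n \<Rightarrow> bool" where
  "primitive_int_vec z \<longleftrightarrow> int_vec z \<and>
     (\<forall>w (m::int). int_vec w \<and> z = of_int m *\<^sub>R w \<longrightarrow> \<bar>m\<bar> = 1)"

definition delzant :: "(nat \<Rightarrow> real^'n) \<Rightarrow> (nat \<Rightarrow> real) \<Rightarrow> nat \<Rightarrow> bool" where
  "delzant nv c d \<longleftrightarrow>
     bounded (polytope_of nv c d) \<and> interior (polytope_of nv c d) \<noteq> {} \<and>
     (\<forall>i<d. aff_dim (facet_of_index nv c d i) = int CARD('n) - 1) \<and>
     (\<forall>i<d. \<forall>j<d. i \<noteq> j \<longrightarrow> facet_of_index nv c d i \<noteq> facet_of_index nv c d j) \<and>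
     (\<forall>i<d. primitive_int_vec (nv i)) \<and>
     (\<forall>v. v extreme_point_of (polytope_of nv c d) \<longrightarrow>
        (let I = {i. i < d \<and> aff_fun nv c i v = 0} in
          card I = CARD('n) \<and>
          (\<forall>z. int_vec z \<longrightarrow> (\<exists>k :: nat \<Rightarrow> int. z = (\<Sum>i\<in>I. of_int (k i) *\<^sub>R nv i)))))"

definition pdiff :: "'n \<Rightarrow> (real^'n \<Rightarrow> real) \<Rightarrow> real^'n \<Rightarrow> real" where
  "pdiff i f x = deriv (\<lambda>t. f (x + t *\<^sub>R axis i 1)) 0"

definition iter_pd :: "'n list \<Rightarrow> (real^'n \<Rightarrow> real) \<Rightarrow> real^'n \<Rightarrow> real" where
  "iter_pd js f = foldr pdiff js f"

definition smooth_on :: "(real^'n) set \<Rightarrow> (real^'n \<Rightarrow> real) \<Rightarrow> bool" where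
  "smooth_on S f \<longleftrightarrow> open S \<and>
     (\<forall>js. continuous_on S (iter_pd js f) \<and>
        (\<forall>i. \<forall>x\<in>S. (\<lambda>t. iter_pd js f (x + t *\<^sub>R axis i 1)) differentiable (at 0)))"

definition smooth_on_closed :: "(real^'n) set \<Rightarrow> (real^'n \<Rightarrow> real) \<Rightarrow> bool" where
  "smooth_on_closed K f \<longleftrightarrow> (\<exists>U g. K \<subseteq> U \<and> smooth_on U g \<and> (\<forall>x\<in>K. g x = f x))"

text \<open>Strict convexity (of u on the interior, resp. of its restriction to a face) is
  expressed as positivity of the second derivative along every nonzero direction
  tangent to the face, i.e. positive definiteness of the (restricted) Hessian.\<close>

definition symplectic_potential ::
  "(nat \<Rightarrow> real^'n) \<Rightarrow> (nat \<Rightarrow> real) \<Rightarrow> nat \<Rightarrow> (real^'n \<Rightarrow> real) \<Rightarrow> bool" where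
  "symplectic_potential nv c d u \<longleftrightarrow>
     smooth_on (interior (polytope_of nv c d)) u \<and>
     (\<exists>f. smooth_on_closed (polytope_of nv c d) f \<and>
        (\<forall>x\<in>polytope_of nv c d.
           u x = (1/2) * (\<Sum>i<d. aff_fun nv c i x * ln (aff_fun nv c i x)) + f x)) \<and>
     (\<forall>F. F face_of polytope_of nv c d \<longrightarrow>
        (\<forall>x\<in>rel_interior F. \<forall>v. v \<noteq> 0 \<and> v \<in> span ((\<lambda>y. y - x) ` F) \<longrightarrow>
           deriv (deriv (\<lambda>t. u (x + t *\<^sub>R v))) 0 > 0))"

definition normalized_at :: "real^'n \<Rightarrow> (real^'n \<Rightarrow> real) \<Rightarrow> bool" where
  "normalized_at x0 u \<longleftrightarrow> u x0 = 0 \<and> (\<forall>i. pdiff i u x0 = 0)"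

definition hess :: "(real^'n \<Rightarrow> real) \<Rightarrow> real^'n \<Rightarrow> real^'n^'n" where
  "hess u x = (\<chi> i j. iter_pd [i, j] u x)"

definition hess_inv_entry :: "(real^'n \<Rightarrow> real) \<Rightarrow> 'n \<Rightarrow> 'n \<Rightarrow> real^'n \<Rightarrow> real" where
  "hess_inv_entry u i j x = matrix_inv (hess u x) $ i $ j"

definition Rm_sq :: "(real^'n \<Rightarrow> real) \<Rightarrow> real^'n \<Rightarrow> real" where
  "Rm_sq u x = (\<Sum>i\<in>UNIV. \<Sum>j\<in>UNIV. \<Sum>k\<in>UNIV. \<Sum>l\<in>UNIV.
       iter_pd [k, l] (hess_inv_entry u i j) x * iter_pd [i, j] (hess_inv_entry u k l) x)"

text \<open>On the facet P_i (contained in the hyperplane nv i . x + c i = 0) the measure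
  Lebesgue/|nv i| equals dy'/|nv i $ j| where y' are the coordinates other than j
  (any j with nv i $ j \<noteq> 0), via the projection p along the j-th axis onto the hyperplane.
  We integrate over the slab 0 \<le> y$j \<le> 1, on which p does not depend on y$j.\<close>

definition facet_integral ::
  "(nat \<Rightarrow> real^'n) \<Rightarrow> (nat \<Rightarrow> real) \<Rightarrow> nat \<Rightarrow> nat \<Rightarrow> (real^'n \<Rightarrow> real) \<Rightarrow> real" where
  "facet_integral nv c d i g =
     (let j = (SOME j. nv i $ j \<noteq> 0);
          p = (\<lambda>y. y - ((nv i \<bullet> y + c i) / nv i $ j) *\<^sub>R axis j 1)
      in (1 / \<bar>nv i $ j\<bar>) *
         integral {y. 0 \<le> y $ j \<and> y $ j \<le> 1 \<and> p y \<in> facet_of_index nv c d i} (\<lambda>y. g (p y)))"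

definition boundary_integral ::
  "(nat \<Rightarrow> real^'n) \<Rightarrow> (nat \<Rightarrow> real) \<Rightarrow> nat \<Rightarrow> (real^'n \<Rightarrow> real) \<Rightarrow> real" where
  "boundary_integral nv c d g = (\<Sum>i<d. facet_integral nv c d i g)"

end

theory Submission
  imports Defs "HOL-Real_Asymp.Real_Asymp"
begin

text \<open>
  Let \<open>v\<close> be a vertex of the polytope, \<open>N\<close> the sum of the normals of the facets through \<open>v\<close>, and
  \<open>q\<close> an interior point close to \<open>v\<close>. Along the curve \<open>Du(\<gamma>(s)) = Du(q) - s N\<close>, which runs from \<open>q\<close>
  to \<open>v\<close>, the moment map \<open>y = \<langle>N, \<gamma> - v\<rangle>\<close> satisfies \<open>y' = -\<phi>\<close> with \<open>\<phi> = N\<^sup>T (D\<^sup>2u)\<^sup>-\<^sup>1 N\<close>. Geometrically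
  \<open>\<phi>\<close> is the area density of a holomorphic disc through the fixed point over \<open>v\<close>; holomorphic
  curvature decreases on complex submanifolds, so \<open>|Rm| \<le> 1\<close> gives \<open>(log \<phi>)'' \<ge> -\<phi>\<close>. Smoothness of
  the disc at its centre appears as the decay \<open>y = O(e\<^sup>-\<^sup>2\<^sup>s)\<close>, forced by the \<open>l ln l\<close> singularity of
  \<open>u\<close>. Together these give \<open>\<phi> \<ge> y\<close> once \<open>y(0)\<close> is small, and integrating the height of the tangent
  plane of \<open>u\<close> along the curve yields \<open>u(v) \<le> u(q) + \<langle>Du(q), v - q\<rangle> + 1/2\<close>.

  By convexity this is controlled by the value of \<open>u\<close> at an interior point. The boundary integral
  bounds \<open>u\<close> at relative interior points of facets (mean value inequality), hence on their
  convex hull, which contains the interior of the polytope; and \<open>u\<close> is largest at a vertex.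
\<close>

text \<open>The gradient at \<open>q\<close> has no a priori bound in terms of \<open>C1\<close> and
  the polytope. What saves the estimate is that only u(q) + <Du(q), v - q> enters, the height at
  \<open>v\<close> of the tangent plane at \<open>q\<close>. With z the midpoint of \<open>v\<close>
  and \<open>q\<close>, convexity bounds this height by 2 u(z) - u(q), and u(q) is nonnegative by
  the normalization, so a bound at the interior point z suffices.

  The estimates for the decay of y contain constants that depend on u, through its expansion at
  \<open>v\<close>. They are used only to identify limits as s tends to infinity, so they leave no
  trace in the result; only the rate 2 matters, and it comes from the factor 1/2 in front of the
  terms l ln l.

  The height of the tangent plane changes at rate y along the curve. From y \<le> \<phi> = -y' its
  total gain is at most y(0), and \<open>q\<close> is taken so close to \<open>v\<close> that y(0)
  \<le> 1/2. The same 1/2 keeps \<phi>'/\<phi> below -1, which is what the comparison of \<phi> with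
  y needs.\<close>

section \<open>Iterated partial derivatives\<close>

lemma pdiff_iter_pd: "pdiff i (iter_pd js f) = iter_pd (i # js) f"
  by (simp add: iter_pd_def)

lemma iter_pd_append: "iter_pd ks (iter_pd js f) = iter_pd (ks @ js) f"
  by (simp add: iter_pd_def)

lemma iter_pd_Nil [simp]: "iter_pd [] f = f"
  by (simp add: iter_pd_def)

lemma smooth_on_iter_pd: "smooth_on S f \<Longrightarrow> smooth_on S (iter_pd js f)"
  by (simp add: smooth_on_def iter_pd_append)

lemma smooth_on_pdiff: "smooth_on S f \<Longrightarrow> smooth_on S (pdiff i f)"
  using smooth_on_iter_pd[of S f "[i]"] by (simp add: iter_pd_def)

lemma smooth_on_imp_continuous_on: "smooth_on S f \<Longrightarrow> continuous_on S f"
  unfolding smooth_on_def by (metis iter_pd_Nil)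

lemma smooth_on_imp_open: "smooth_on S f \<Longrightarrow> open S"
  by (simp add: smooth_on_def)

lemma smooth_on_has_pdiff:
  assumes "smooth_on S f" "x \<in> S"
  shows "((\<lambda>t. f (x + t *\<^sub>R axis i 1)) has_real_derivative pdiff i f x) (at 0)"
proof -
  have "(\<lambda>t. iter_pd [] f (x + t *\<^sub>R axis i 1)) differentiable (at 0)"
    using assms unfolding smooth_on_def by blast
  then show ?thesis
    by (simp add: pdiff_def DERIV_deriv_iff_real_differentiable)
qed

lemma has_real_derivative_line_shift:
  fixes f :: "real^'n \<Rightarrow> real"
  assumes "((\<lambda>t. f ((x + s *\<^sub>R v) + t *\<^sub>R v)) has_real_derivative D) (at 0)"
  shows "((\<lambda>t. f (x + t *\<^sub>R v)) has_real_derivative D) (at s)"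
proof -
  have "((\<lambda>t. f (x + (s + t) *\<^sub>R v)) has_real_derivative D) (at 0)"
    using assms by (simp add: algebra_simps)
  then show ?thesis
    using DERIV_at_within_shift[of "\<lambda>t. f (x + t *\<^sub>R v)" D s 0 UNIV] by simp
qed

text \<open>\<open>smooth_on\<close> speaks only of derivatives along the axes, so total
  differentiability has to be derived. The increment is built up one coordinate at a time
  (\<open>hT T\<close> is the part already applied); each step is a one-variable mean value theorem,
  and continuity of the partials moves the intermediate point to \<open>x\<close>.\<close>

lemma has_derivative_continuous_partials:
  fixes f :: "real^'n \<Rightarrow> real"
  assumes "open S" "x \<in> S"
    and D: "\<And>i y. y \<in> S \<Longrightarrow>
      ((\<lambda>t. f (y + t *\<^sub>R axis i 1)) has_real_derivative D i y) (at 0)"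
    and cont: "\<And>i. continuous_on S (D i)"
  shows "(f has_derivative (\<lambda>h. \<Sum>i\<in>UNIV. h $ i * D i x)) (at x)"
  unfolding has_derivative_at_alt
proof (intro conjI allI impI)
  show "bounded_linear (\<lambda>h::real^'n. \<Sum>i\<in>UNIV. h $ i * D i x)"
  proof (intro bounded_linear_sum)
    fix i :: 'n
    show "bounded_linear (\<lambda>h::real^'n. h $ i * D i x)"
      by (rule bounded_linear_compose[OF bounded_linear_mult_left bounded_linear_vec_nth])
  qed
next
  fix e :: real assume "e > 0"
  define e' where "e' = e / CARD('n)"
  have "e' > 0" using \<open>e > 0\<close> by (simp add: e'_def)
  obtain d0 where d0: "d0 > 0" "ball x d0 \<subseteq> S"
    using assms(1,2) open_contains_ball by blast
  have "\<forall>i. \<exists>d>0. \<forall>y. dist y x < d \<longrightarrow> \<bar>D i y - D i x\<bar> < e'"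
  proof
    fix i
    have "isCont (D i) x"
      using cont assms(1,2) continuous_on_eq_continuous_at by blast
    then show "\<exists>d>0. \<forall>y. dist y x < d \<longrightarrow> \<bar>D i y - D i x\<bar> < e'"
      using \<open>e' > 0\<close> unfolding continuous_at_eps_delta by (simp add: dist_real_def)
  qed
  then obtain d1 where d1: "\<And>i. d1 i > 0"
    "\<And>i y. dist y x < d1 i \<Longrightarrow> \<bar>D i y - D i x\<bar> < e'"
    by metis
  define d where "d = min d0 (Min (range d1))"
  have "d > 0" using d0 d1 by (simp add: d_def)
  have dball: "y \<in> S" "\<bar>D i y - D i x\<bar> < e'" if "dist y x < d" for y i
  proof -
    show "y \<in> S" using that d0 by (auto simp: d_def dist_commute subset_iff)
    have "d \<le> d1 i" by (simp add: d_def min.coboundedI2)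
    then show "\<bar>D i y - D i x\<bar> < e'" using that d1(2) by fastforce
  qed
  show "\<exists>d>0. \<forall>y. norm (y - x) < d \<longrightarrow>
      norm (f y - f x - (\<Sum>i\<in>UNIV. (y - x) $ i * D i x)) \<le> e * norm (y - x)"
  proof (intro exI[of _ d] conjI allI impI)
    show "d > 0" by fact
    fix y assume y: "norm (y - x) < d"
    define h where "h = y - x"
    define hT where "hT T = (\<chi> i. if i \<in> T then h $ i else 0)" for T
    have "\<bar>f (x + hT T) - f x - (\<Sum>i\<in>T. h $ i * D i x)\<bar> \<le> card T * (e' * norm h)"
      if "finite T" for T
      using that
    proof (induction T)
      case empty
      have "hT {} = 0" by (simp add: hT_def vec_eq_iff)
      then show ?case by simp
    next
      case (insert k T)
      have upd: "hT (insert k T) = hT T + (h $ k) *\<^sub>R axis k 1"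
        using insert by (auto simp: hT_def vec_eq_iff axis_def)
      define z where "z = x + hT T"
      have near: "dist (z + t *\<^sub>R axis k 1) x < d" if "\<bar>t\<bar> \<le> \<bar>h $ k\<bar>" for t
      proof -
        have "norm (hT T + t *\<^sub>R axis k 1) \<le> norm h"
          using insert that by (intro norm_le_componentwise_cart) (auto simp: hT_def axis_def)
        then show ?thesis using y by (simp add: z_def dist_norm h_def algebra_simps)
      qed
      have der: "((\<lambda>t. f (z + t *\<^sub>R axis k 1)) has_real_derivative D k (z + t *\<^sub>R axis k 1)) (at t)"
        if "\<bar>t\<bar> \<le> \<bar>h $ k\<bar>" for t
        by (rule has_real_derivative_line_shift, rule D, rule dball, rule near, rule that)
      have "\<exists>t. \<bar>t\<bar> \<le> \<bar>h $ k\<bar> \<and> f (z + (h $ k) *\<^sub>R axis k 1) - f z = h $ k * D k (z + t *\<^sub>R axis k 1)"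
      proof (cases "h $ k" "0::real" rule: linorder_cases)
        case equal
        then show ?thesis by simp
      next
        case greater
        have "\<exists>t. 0 < t \<and> t < h $ k \<and> f (z + (h $ k) *\<^sub>R axis k 1) - f (z + 0 *\<^sub>R axis k 1) = (h $ k - 0) * D k (z + t *\<^sub>R axis k 1)"
          by (rule MVT2[OF greater]) (rule der, simp)
        then obtain t where "0 < t" "t < h $ k" "f (z + (h $ k) *\<^sub>R axis k 1) - f z = h $ k * D k (z + t *\<^sub>R axis k 1)"
          by auto
        then show ?thesis by (intro exI[of _ t]) auto
      next
        case less
        have "\<exists>t. h $ k < t \<and> t < 0 \<and> f (z + 0 *\<^sub>R axis k 1) - f (z + (h $ k) *\<^sub>R axis k 1) = (0 - h $ k) * D k (z + t *\<^sub>R axis k 1)"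
          by (rule MVT2[OF less]) (rule der, simp)
        then obtain t where "h $ k < t" "t < 0" "f z - f (z + (h $ k) *\<^sub>R axis k 1) = - (h $ k) * D k (z + t *\<^sub>R axis k 1)"
          by auto
        then show ?thesis by (intro exI[of _ t]) auto
      qed
      then obtain t where t: "\<bar>t\<bar> \<le> \<bar>h $ k\<bar>"
        "f (z + (h $ k) *\<^sub>R axis k 1) - f z = h $ k * D k (z + t *\<^sub>R axis k 1)" by blast
      have "\<bar>f (z + (h $ k) *\<^sub>R axis k 1) - f z - h $ k * D k x\<bar>
          = \<bar>h $ k\<bar> * \<bar>D k (z + t *\<^sub>R axis k 1) - D k x\<bar>"
        by (simp add: t(2) abs_mult[symmetric] algebra_simps)
      also have "\<dots> \<le> norm h * e'"
        using dball(2)[OF near[OF t(1)], of k]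
        by (intro mult_mono) (auto simp: component_le_norm_cart)
      finally have "\<bar>f (z + (h $ k) *\<^sub>R axis k 1) - f z - h $ k * D k x\<bar> \<le> e' * norm h"
        by (simp add: mult.commute)
      moreover have "x + hT (insert k T) = z + (h $ k) *\<^sub>R axis k 1"
        by (simp add: upd z_def)
      ultimately show ?case using insert
        by (simp add: z_def algebra_simps abs_le_iff)
    qed
    from this[of UNIV] have "\<bar>f (x + hT UNIV) - f x - (\<Sum>i\<in>UNIV. h $ i * D i x)\<bar> \<le> CARD('n) * (e' * norm h)"
      by simp
    moreover have "x + hT UNIV = y" by (simp add: hT_def h_def vec_eq_iff)
    moreover have "CARD('n) * (e' * norm h) = e * norm h" by (simp add: e'_def)
    ultimately show "norm (f y - f x - (\<Sum>i\<in>UNIV. (y - x) $ i * D i x)) \<le> e * norm (y - x)"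
      unfolding h_def[symmetric] real_norm_def by metis
  qed
qed

lemma smooth_on_has_derivative:
  fixes f :: "real^'n \<Rightarrow> real"
  assumes "smooth_on S f" "x \<in> S"
  shows "(f has_derivative (\<lambda>h. \<Sum>i\<in>UNIV. h $ i * pdiff i f x)) (at x)"
proof (rule has_derivative_continuous_partials[of S x f "\<lambda>i. pdiff i f"])
  show "open S" "x \<in> S" using assms smooth_on_imp_open by auto
  show "((\<lambda>t. f (y + t *\<^sub>R axis i 1)) has_real_derivative pdiff i f y) (at 0)" if "y \<in> S" for i y
    by (rule smooth_on_has_pdiff[OF assms(1) that])
  show "continuous_on S (pdiff i f)" for i
    by (rule smooth_on_imp_continuous_on[OF smooth_on_pdiff[OF assms(1)]])
qed

lemma has_derivative_imp_pdiff:
  fixes f :: "real^'n \<Rightarrow> real"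
  assumes "(f has_derivative f') (at x)"
  shows "pdiff i f x = f' (axis i 1)"
proof -
  interpret bounded_linear f' using assms by (rule has_derivative_bounded_linear)
  have "((\<lambda>t. f (x + t *\<^sub>R axis i 1)) has_derivative (\<lambda>t. f' (t *\<^sub>R axis i 1))) (at 0)"
    by (rule has_derivative_compose[where f = "\<lambda>t. x + t *\<^sub>R axis i 1" and g = f])
       (auto intro!: derivative_eq_intros assms)
  then have "((\<lambda>t. f (x + t *\<^sub>R axis i 1)) has_real_derivative f' (axis i 1)) (at 0)"
    by (simp add: has_field_derivative_def scaleR mult_commute_abs)
  then show ?thesis by (simp add: pdiff_def DERIV_imp_deriv)
qed

lemma smooth_on_pdiff_line:
  assumes "smooth_on S f" "x + t *\<^sub>R axis i 1 \<in> S"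
  shows "((\<lambda>t. f (x + t *\<^sub>R axis i 1)) has_real_derivative pdiff i f (x + t *\<^sub>R axis i 1)) (at t)"
  by (rule has_real_derivative_line_shift, rule smooth_on_has_pdiff) fact+

text \<open>The second difference is symmetric in \<open>i\<close> and \<open>j\<close>, whereas the
  derivative that represents it records an order of differentiation. \<open>pdiff_commute\<close>
  plays the two representations off against each other for small \<open>r\<close>.\<close>

lemma second_difference_mvt:
  assumes "smooth_on S f" "r > 0"
    and S: "\<And>s t. 0 \<le> s \<Longrightarrow> s \<le> r \<Longrightarrow> 0 \<le> t \<Longrightarrow> t \<le> r \<Longrightarrow> x + s *\<^sub>R axis i 1 + t *\<^sub>R axis j 1 \<in> S"
  shows "\<exists>s t. 0 \<le> s \<and> s \<le> r \<and> 0 \<le> t \<and> t \<le> r \<and>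
    f (x + r *\<^sub>R axis i 1 + r *\<^sub>R axis j 1) - f (x + r *\<^sub>R axis i 1) - f (x + r *\<^sub>R axis j 1) + f x
      = r\<^sup>2 * pdiff j (pdiff i f) (x + s *\<^sub>R axis i 1 + t *\<^sub>R axis j 1)"
proof -
  let ?a = "axis i (1::real)" and ?b = "axis j (1::real)"
  let ?g = "\<lambda>s. f ((x + r *\<^sub>R ?b) + s *\<^sub>R ?a) - f (x + s *\<^sub>R ?a)"
  have "\<exists>s. 0 < s \<and> s < r \<and> ?g r - ?g 0 =
      (r - 0) * (pdiff i f ((x + r *\<^sub>R ?b) + s *\<^sub>R ?a) - pdiff i f (x + s *\<^sub>R ?a))"
  proof (rule MVT2[OF assms(2)])
    fix s assume s: "0 \<le> s" "s \<le> r"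
    have "(x + r *\<^sub>R ?b) + s *\<^sub>R ?a \<in> S" "x + s *\<^sub>R ?a \<in> S"
      using S[of s r] S[of s 0] s assms(2) by (auto simp: algebra_simps)
    then show "DERIV ?g s :> pdiff i f ((x + r *\<^sub>R ?b) + s *\<^sub>R ?a) - pdiff i f (x + s *\<^sub>R ?a)"
      by (intro DERIV_diff smooth_on_pdiff_line[OF assms(1)])
  qed
  then obtain s where s: "0 < s" "s < r" "?g r - ?g 0 =
      r * (pdiff i f ((x + r *\<^sub>R ?b) + s *\<^sub>R ?a) - pdiff i f (x + s *\<^sub>R ?a))" by auto
  have "\<exists>t. 0 < t \<and> t < r \<and> pdiff i f ((x + s *\<^sub>R ?a) + r *\<^sub>R ?b) - pdiff i f ((x + s *\<^sub>R ?a) + 0 *\<^sub>R ?b) =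
      (r - 0) * pdiff j (pdiff i f) ((x + s *\<^sub>R ?a) + t *\<^sub>R ?b)"
    by (rule MVT2[OF assms(2)], rule smooth_on_pdiff_line[OF smooth_on_pdiff[OF assms(1)]])
       (use S s in auto)
  then obtain t where t: "0 < t" "t < r" "pdiff i f ((x + s *\<^sub>R ?a) + r *\<^sub>R ?b) - pdiff i f (x + s *\<^sub>R ?a) =
      r * pdiff j (pdiff i f) ((x + s *\<^sub>R ?a) + t *\<^sub>R ?b)" by auto
  have "pdiff i f ((x + r *\<^sub>R ?b) + s *\<^sub>R ?a) = pdiff i f ((x + s *\<^sub>R ?a) + r *\<^sub>R ?b)"
    by (simp add: algebra_simps)
  with s t show ?thesis
    by (intro exI[of _ s] exI[of _ t]) (simp add: algebra_simps power2_eq_square)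
qed

lemma pdiff_commute:
  fixes f :: "real^'n \<Rightarrow> real"
  assumes f: "smooth_on S f" and x: "x \<in> S"
  shows "pdiff i (pdiff j f) x = pdiff j (pdiff i f) x"
proof (rule ccontr)
  assume ne: "\<not> ?thesis"
  define e where "e = \<bar>pdiff i (pdiff j f) x - pdiff j (pdiff i f) x\<bar> / 2"
  have "e > 0" using ne by (simp add: e_def)
  have "isCont (pdiff i (pdiff j f)) x" "isCont (pdiff j (pdiff i f)) x"
    using smooth_on_imp_continuous_on[OF smooth_on_pdiff[OF smooth_on_pdiff[OF f]]]
      smooth_on_imp_open[OF f] x continuous_on_eq_continuous_at by blast+
  then obtain d1 d2 where d: "d1 > 0" "d2 > 0"
    "\<And>y. dist y x < d1 \<Longrightarrow> \<bar>pdiff i (pdiff j f) y - pdiff i (pdiff j f) x\<bar> < e"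
    "\<And>y. dist y x < d2 \<Longrightarrow> \<bar>pdiff j (pdiff i f) y - pdiff j (pdiff i f) x\<bar> < e"
    using \<open>e > 0\<close> unfolding continuous_at_eps_delta dist_real_def by metis
  obtain d0 where d0: "d0 > 0" "ball x d0 \<subseteq> S"
    using smooth_on_imp_open[OF f] x open_contains_ball by blast
  \<comment> \<open>Points of the square of side \<open>r\<close> at \<open>x\<close> lie within 2 r
    of \<open>x\<close>, hence strictly within 3 r.\<close>
  define r where "r = min d0 (min d1 d2) / 3"
  have r: "r > 0" using d d0 by (simp add: r_def)
  have near: "dist (x + s *\<^sub>R axis k 1 + t *\<^sub>R axis l 1) x < 3 * r"
    if "0 \<le> s" "s \<le> r" "0 \<le> t" "t \<le> r" for s t k l
  proof -
    have "norm (s *\<^sub>R axis k (1::real) + t *\<^sub>R axis l 1) \<le> s + t"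
      using that by (intro order_trans[OF norm_triangle_ineq]) simp
    then show ?thesis using that r by (simp add: dist_norm algebra_simps)
  qed
  have nearS: "x + s *\<^sub>R axis k 1 + t *\<^sub>R axis l 1 \<in> S"
    if "0 \<le> s" "s \<le> r" "0 \<le> t" "t \<le> r" for s t k l
    using near[OF that, of k l] d0 by (auto simp: r_def dist_commute subset_iff)
  obtain s t where 1: "0 \<le> s" "s \<le> r" "0 \<le> t" "t \<le> r"
    "f (x + r *\<^sub>R axis i 1 + r *\<^sub>R axis j 1) - f (x + r *\<^sub>R axis i 1) - f (x + r *\<^sub>R axis j 1) + f x
      = r\<^sup>2 * pdiff j (pdiff i f) (x + s *\<^sub>R axis i 1 + t *\<^sub>R axis j 1)"
    using second_difference_mvt[OF f r, of x i j] nearS by blast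
  obtain s' t' where 2: "0 \<le> s'" "s' \<le> r" "0 \<le> t'" "t' \<le> r"
    "f (x + r *\<^sub>R axis j 1 + r *\<^sub>R axis i 1) - f (x + r *\<^sub>R axis j 1) - f (x + r *\<^sub>R axis i 1) + f x
      = r\<^sup>2 * pdiff i (pdiff j f) (x + s' *\<^sub>R axis j 1 + t' *\<^sub>R axis i 1)"
    using second_difference_mvt[OF f r, of x j i] nearS by blast
  have "x + r *\<^sub>R axis j 1 + r *\<^sub>R axis i 1 = x + r *\<^sub>R axis i 1 + r *\<^sub>R axis j (1::real)"
    by simp
  note eq = this
  have "r\<^sup>2 * pdiff j (pdiff i f) (x + s *\<^sub>R axis i 1 + t *\<^sub>R axis j 1)
     = r\<^sup>2 * pdiff i (pdiff j f) (x + s' *\<^sub>R axis j 1 + t' *\<^sub>R axis i 1)"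
    using 1(5) 2(5)[unfolded eq] by linarith
  then have "pdiff j (pdiff i f) (x + s *\<^sub>R axis i 1 + t *\<^sub>R axis j 1)
     = pdiff i (pdiff j f) (x + s' *\<^sub>R axis j 1 + t' *\<^sub>R axis i 1)"
    using r by simp
  moreover have "3 * r \<le> d1" "3 * r \<le> d2" by (auto simp: r_def)
  ultimately show False
    using d(4)[of "x + s *\<^sub>R axis i 1 + t *\<^sub>R axis j 1"] near[OF 1(1-4), of i j]
      d(3)[of "x + s' *\<^sub>R axis j 1 + t' *\<^sub>R axis i 1"] near[OF 2(1-4), of j i]
    by (auto simp: e_def abs_if split: if_splits)
qed

lemma pdiff_cong_open:
  fixes f g :: "real^'n \<Rightarrow> real"
  assumes "open S" "x \<in> S" "\<And>y. y \<in> S \<Longrightarrow> f y = g y"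
  shows "pdiff i f x = pdiff i g x"
  unfolding pdiff_def
proof (rule deriv_cong_ev)
  have "((\<lambda>t. x + t *\<^sub>R axis i 1) \<longlongrightarrow> x + 0 *\<^sub>R axis i 1) (nhds (0::real))"
    by (intro tendsto_intros filterlim_ident)
  then have "((\<lambda>t. x + t *\<^sub>R axis i 1) \<longlongrightarrow> x) (nhds (0::real))" by simp
  then have "\<forall>\<^sub>F t in nhds (0::real). x + t *\<^sub>R axis i 1 \<in> S"
    using assms(1,2) topological_tendstoD by blast
  then show "\<forall>\<^sub>F t in nhds 0. f (x + t *\<^sub>R axis i 1) = g (x + t *\<^sub>R axis i 1)"
    by eventually_elim (use assms(3) in auto)
qed simp

lemma iter_pd_swap:
  fixes f :: "real^'n \<Rightarrow> real"
  assumes f: "smooth_on S f"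
  shows "x \<in> S \<Longrightarrow> iter_pd (ks @ i # j # js) f x = iter_pd (ks @ j # i # js) f x"
proof (induction ks arbitrary: x)
  case Nil
  then show ?case
    using pdiff_commute[OF smooth_on_iter_pd[OF f, of js]] by (simp add: iter_pd_def)
next
  case (Cons k ks)
  have "pdiff k (iter_pd (ks @ i # j # js) f) x = pdiff k (iter_pd (ks @ j # i # js) f) x"
    by (rule pdiff_cong_open[OF smooth_on_imp_open[OF f] Cons.prems]) (rule Cons.IH)
  then show ?case by (simp add: pdiff_iter_pd)
qed

section \<open>Contractions of the curvature tensor\<close>

text \<open>Cholesky factorization by induction on the index set: after pivoting on
  \<open>k\<close>, the Schur complement \<open>b\<close> is again positive definite. It provides
  the factor of the inverse Hessian that \<open>quadratic_form_sq_le_trace\<close> conjugates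
  with.\<close>

lemma gram_decomposition_on:
  fixes a :: "'i \<Rightarrow> 'i \<Rightarrow> real"
  assumes "finite S"
    and "\<And>i j. i \<in> S \<Longrightarrow> j \<in> S \<Longrightarrow> a i j = a j i"
    and "\<And>x. \<exists>i\<in>S. x i \<noteq> 0 \<Longrightarrow> (\<Sum>i\<in>S. \<Sum>j\<in>S. x i * a i j * x j) > 0"
  shows "\<exists>r. \<forall>i\<in>S. \<forall>j\<in>S. a i j = (\<Sum>m\<in>S. r m i * r m j)"
  using assms
proof (induction S arbitrary: a)
  case empty
  then show ?case by simp
next
  case (insert k S)
  have form: "(\<Sum>i\<in>insert k S. \<Sum>j\<in>insert k S. x i * a i j * x j)
      = x k * a k k * x k + 2 * x k * (\<Sum>j\<in>S. a k j * x j) + (\<Sum>i\<in>S. \<Sum>j\<in>S. x i * a i j * x j)" for x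
  proof -
    have "(\<Sum>i\<in>S. x i * a i k * x k) = x k * (\<Sum>j\<in>S. a k j * x j)"
      unfolding sum_distrib_left by (rule sum.cong) (auto simp: insert.prems(1)[of k])
    moreover have "(\<Sum>j\<in>S. x k * a k j * x j) = x k * (\<Sum>j\<in>S. a k j * x j)"
      unfolding sum_distrib_left by (rule sum.cong) auto
    ultimately show ?thesis using insert.hyps by (simp add: sum.distrib)
  qed
  have akk: "a k k > 0"
  proof -
    define x :: "'i \<Rightarrow> real" where "x i = (if i = k then 1 else 0)" for i
    have "x i = 0" if "i \<in> S" for i using that insert.hyps by (auto simp: x_def)
    then have "(\<Sum>i\<in>insert k S. \<Sum>j\<in>insert k S. x i * a i j * x j) = a k k"
      unfolding form by (simp add: x_def)
    moreover have "0 < (\<Sum>i\<in>insert k S. \<Sum>j\<in>insert k S. x i * a i j * x j)"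
      by (rule insert.prems(2)) (auto simp: x_def)
    ultimately show ?thesis by simp
  qed
  define b where "b i j = a i j - a i k * a k j / a k k" for i j
  have "\<exists>r. \<forall>i\<in>S. \<forall>j\<in>S. b i j = (\<Sum>m\<in>S. r m i * r m j)"
  proof (rule insert.IH)
    show "b i j = b j i" if "i \<in> S" "j \<in> S" for i j
      using that insert.prems(1)[of i j] insert.prems(1)[of i k] insert.prems(1)[of k j]
      by (simp add: b_def)
    fix x :: "'i \<Rightarrow> real" assume x: "\<exists>i\<in>S. x i \<noteq> 0"
    define cc where "cc = (\<Sum>j\<in>S. a k j * x j)"
    \<comment> \<open>The \<open>k\<close>-th entry minimizes the form of \<open>a\<close> over all
      extensions of \<open>x\<close>; the minimum is the form of \<open>b\<close> at
      \<open>x\<close>.\<close>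
    define z where "z i = (if i = k then - cc / a k k else x i)" for i
    have zS: "z i = x i" if "i \<in> S" for i using that insert.hyps by (auto simp: z_def)
    have "(\<Sum>i\<in>S. x i * a i k) = cc"
      unfolding cc_def by (rule sum.cong) (use insert.prems(1)[of k] in auto)
    moreover have "(\<Sum>i\<in>S. \<Sum>j\<in>S. x i * (a i k * a k j / a k k) * x j)
        = (\<Sum>i\<in>S. x i * a i k) * (\<Sum>j\<in>S. a k j * x j) / a k k"
      by (simp add: sum_product sum_divide_distrib mult_ac)
    ultimately have "(\<Sum>i\<in>S. \<Sum>j\<in>S. x i * (a i k * a k j / a k k) * x j) = cc * cc / a k k"
      by (simp add: cc_def)
    then have 1: "(\<Sum>i\<in>S. \<Sum>j\<in>S. x i * b i j * x j) = (\<Sum>i\<in>S. \<Sum>j\<in>S. x i * a i j * x j) - cc * cc / a k k"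
      by (simp add: b_def algebra_simps sum_subtractf)
    have "0 < (\<Sum>i\<in>insert k S. \<Sum>j\<in>insert k S. z i * a i j * z j)"
      using x zS by (intro insert.prems(2)) auto
    also have "\<dots> = z k * a k k * z k + 2 * z k * (\<Sum>j\<in>S. a k j * z j) + (\<Sum>i\<in>S. \<Sum>j\<in>S. z i * a i j * z j)"
      by (rule form)
    also have "(\<Sum>j\<in>S. a k j * z j) = cc" by (simp add: zS cc_def)
    also have "(\<Sum>i\<in>S. \<Sum>j\<in>S. z i * a i j * z j) = (\<Sum>i\<in>S. \<Sum>j\<in>S. x i * a i j * x j)"
      by (simp add: zS)
    also have "z k * a k k * z k + 2 * z k * cc = - (cc * cc / a k k)"
      using akk by (simp add: z_def field_simps)
    finally show "0 < (\<Sum>i\<in>S. \<Sum>j\<in>S. x i * b i j * x j)" using 1 by simp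
  qed
  then obtain r where r: "\<And>i j. i \<in> S \<Longrightarrow> j \<in> S \<Longrightarrow> b i j = (\<Sum>m\<in>S. r m i * r m j)" by blast
  define r' where "r' m i = (if m = k then a k i / sqrt (a k k) else if i = k then 0 else r m i)" for m i
  have "a i j = (\<Sum>m\<in>insert k S. r' m i * r' m j)" if ij: "i \<in> insert k S" "j \<in> insert k S" for i j
  proof -
    have "(\<Sum>m\<in>insert k S. r' m i * r' m j) = a k i * a k j / a k k + (\<Sum>m\<in>S. r' m i * r' m j)"
      using insert.hyps akk by (simp add: r'_def)
    also have "(\<Sum>m\<in>S. r' m i * r' m j) = (if i = k \<or> j = k then 0 else b i j)"
    proof (cases "i = k \<or> j = k")
      case True
      then show ?thesis using insert.hyps by (auto simp: r'_def intro!: sum.neutral)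
    next
      case False
      then have "(\<Sum>m\<in>S. r' m i * r' m j) = (\<Sum>m\<in>S. r m i * r m j)"
        using insert.hyps by (intro sum.cong) (auto simp: r'_def)
      then show ?thesis using False r[of i j] ij by simp
    qed
    also have "a k i * a k j / a k k + \<dots> = a i j"
      using akk insert.prems(1)[OF ij] insert.prems(1)[of i k] ij by (auto simp: b_def)
    finally show ?thesis by simp
  qed
  then show ?case by (intro exI[of _ r']) blast
qed

lemma norm_matrix_vector_sq_le:
  fixes A :: "real^'m^'n"
  shows "(norm (A *v x))\<^sup>2 \<le> (\<Sum>i\<in>UNIV. \<Sum>j\<in>UNIV. (A $ i $ j)\<^sup>2) * (norm x)\<^sup>2"
proof -
  have n: "(norm z)\<^sup>2 = (\<Sum>j\<in>UNIV. (z $ j)\<^sup>2)" for z :: "real^'k"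
    by (simp only: power2_norm_eq_inner inner_vec_def) (simp add: power2_eq_square)
  have "(A *v x) $ i = A $ i \<bullet> x" for i
    by (simp add: matrix_vector_mult_def inner_vec_def)
  then have "(norm (A *v x))\<^sup>2 = (\<Sum>i\<in>UNIV. (A $ i \<bullet> x)\<^sup>2)" by (simp add: n)
  also have "\<dots> \<le> (\<Sum>i\<in>UNIV. (norm (A $ i))\<^sup>2 * (norm x)\<^sup>2)"
    by (intro sum_mono) (metis Cauchy_Schwarz_ineq2 abs_ge_zero power2_abs power_mono power_mult_distrib)
  finally show ?thesis by (simp add: n sum_distrib_right)
qed

text \<open>\<open>G ** F\<close> need not be symmetric, but \<open>\<Phi>\<close>, the conjugate of
  \<open>F\<close> by \<open>R\<close>, is. By cyclicity the trace equals that of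
  \<open>\<Phi> ** \<Phi>\<close>, a sum of squares of entries, which dominates the action of
  \<open>\<Phi>\<close> on \<open>R *v \<nu>\<close>.\<close>

lemma quadratic_form_sq_le_trace:
  fixes F R :: "real^'p^'p" and \<nu> :: "real^'p"
  assumes F: "transpose F = F"
  defines "G \<equiv> transpose R ** R"
  defines "\<omega> \<equiv> G *v \<nu>"
  shows "(\<omega> \<bullet> (F *v \<omega>))\<^sup>2 \<le> (\<nu> \<bullet> \<omega>)\<^sup>2 * trace ((G ** F) ** (G ** F))"
proof -
  define \<Phi> where "\<Phi> = R ** F ** transpose R"
  define c where "c = R *v \<nu>"
  have \<Phi>: "transpose \<Phi> = \<Phi>"
    by (simp add: \<Phi>_def matrix_transpose_mul F matrix_mul_assoc)
  have \<omega>: "\<omega> = transpose R *v c"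
    by (simp add: \<omega>_def G_def c_def matrix_vector_mul_assoc)
  have "\<nu> \<bullet> \<omega> = c \<bullet> c"
    unfolding \<omega> c_def by (metis dot_lmul_matrix inner_commute transpose_matrix_vector)
  have "\<omega> \<bullet> (F *v \<omega>) = c \<bullet> (\<Phi> *v c)"
    unfolding \<omega> \<Phi>_def
    by (simp add: matrix_vector_mul_assoc [symmetric] dot_lmul_matrix [symmetric] vector_transpose_matrix)
  then have "(\<omega> \<bullet> (F *v \<omega>))\<^sup>2 \<le> (norm c)\<^sup>2 * (norm (\<Phi> *v c))\<^sup>2"
    by (metis Cauchy_Schwarz_ineq2 abs_ge_zero power2_abs power_mono power_mult_distrib)
  also have "\<dots> \<le> (norm c)\<^sup>2 * ((\<Sum>i\<in>UNIV. \<Sum>j\<in>UNIV. (\<Phi> $ i $ j)\<^sup>2) * (norm c)\<^sup>2)"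
    by (intro mult_left_mono norm_matrix_vector_sq_le) simp
  also have "\<dots> = (\<nu> \<bullet> \<omega>)\<^sup>2 * (\<Sum>i\<in>UNIV. \<Sum>j\<in>UNIV. (\<Phi> $ i $ j)\<^sup>2)"
    unfolding \<open>\<nu> \<bullet> \<omega> = c \<bullet> c\<close> power2_norm_eq_inner by (simp add: power2_eq_square)
  also have "(\<Sum>i\<in>UNIV. \<Sum>j\<in>UNIV. (\<Phi> $ i $ j)\<^sup>2) = trace (\<Phi> ** \<Phi>)"
  proof -
    have "\<Phi> $ i $ j = \<Phi> $ j $ i" for i j
      by (metis \<Phi> transpose_def vec_lambda_beta)
    then show ?thesis by (simp add: trace_def matrix_matrix_mult_def power2_eq_square)
  qed
  also have "\<dots> = trace (R ** (F ** transpose R ** \<Phi>))"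
    by (simp add: \<Phi>_def matrix_mul_assoc)
  also have "\<dots> = trace ((F ** transpose R ** \<Phi>) ** R)"
    by (rule trace_mul_sym)
  also have "\<dots> = trace (F ** (G ** F ** G))"
    by (simp add: \<Phi>_def G_def matrix_mul_assoc)
  also have "\<dots> = trace ((G ** F ** G) ** F)"
    by (rule trace_mul_sym)
  also have "\<dots> = trace ((G ** F) ** (G ** F))"
    by (simp add: matrix_mul_assoc)
  finally show ?thesis .
qed

text \<open>Four-index tensors are read as matrices indexed by pairs. With \<open>G\<close> the
  tensor square of \<open>B\<close> and \<open>\<nu>\<close> that of \<open>N\<close>, the product
  of \<open>G\<close> with the matrix of \<open>F\<close> is \<open>\<beta>\<close>, and the pair
  symmetry of \<open>F\<close> is symmetry of its matrix. For \<open>\<beta>\<close> the second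
  derivatives of the inverse Hessian, the last sum is the squared norm of the curvature.\<close>

lemma quadrilinear_form_bound:
  fixes B :: "'n::finite \<Rightarrow> 'n \<Rightarrow> real" and F :: "'n \<Rightarrow> 'n \<Rightarrow> 'n \<Rightarrow> 'n \<Rightarrow> real"
    and N w :: "'n \<Rightarrow> real"
  assumes B: "\<And>i j. B i j = B j i"
    and pos: "\<And>x. \<exists>i. x i \<noteq> 0 \<Longrightarrow> (\<Sum>i\<in>UNIV. \<Sum>j\<in>UNIV. x i * B i j * x j) > 0"
    and F: "\<And>a b k l. F a b k l = F k l a b"
    and w: "\<And>i. w i = (\<Sum>j\<in>UNIV. B i j * N j)"
    and \<beta>: "\<And>i j k l. \<beta> i j k l = (\<Sum>a\<in>UNIV. \<Sum>b\<in>UNIV. B i a * B j b * F a b k l)"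
  shows "(\<Sum>a\<in>UNIV. \<Sum>b\<in>UNIV. \<Sum>k\<in>UNIV. \<Sum>l\<in>UNIV. F a b k l * w a * w b * w k * w l)\<^sup>2
    \<le> (\<Sum>i\<in>UNIV. N i * w i)^4 * (\<Sum>i\<in>UNIV. \<Sum>j\<in>UNIV. \<Sum>k\<in>UNIV. \<Sum>l\<in>UNIV. \<beta> i j k l * \<beta> k l i j)"
proof -
  have "\<exists>r. \<forall>i\<in>UNIV. \<forall>j\<in>UNIV. B i j = (\<Sum>m\<in>(UNIV::'n set). r m i * r m j)"
    by (rule gram_decomposition_on) (use B pos in auto)
  then obtain r where r: "\<And>i j. B i j = (\<Sum>m\<in>(UNIV::'n set). r m i * r m j)" by blast
  have pairs: "(\<Sum>p\<in>UNIV. g p) = (\<Sum>i\<in>UNIV. \<Sum>j\<in>UNIV. g (i, j))" for g :: "'n \<times> 'n \<Rightarrow> real"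
    by (simp add: sum.cartesian_product UNIV_Times_UNIV[symmetric] del: UNIV_Times_UNIV)
  define FF :: "real^('n\<times>'n)^('n\<times>'n)" where "FF = (\<chi> p q. F (fst p) (snd p) (fst q) (snd q))"
  define R :: "real^('n\<times>'n)^('n\<times>'n)" where "R = (\<chi> M p. r (fst M) (fst p) * r (snd M) (snd p))"
  define \<nu> :: "real^('n\<times>'n)" where "\<nu> = (\<chi> p. N (fst p) * N (snd p))"
  define G where "G = transpose R ** R"
  have G: "G $ p $ q = B (fst p) (fst q) * B (snd p) (snd q)" for p q
    by (simp add: G_def matrix_matrix_mult_def transpose_def R_def pairs r sum_product mult_ac)
  have \<omega>: "(G *v \<nu>) $ p = w (fst p) * w (snd p)" for p
    by (simp add: matrix_vector_mult_def G \<nu>_def pairs w sum_product mult_ac)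
  have \<nu>: "\<nu> $ p = N (fst p) * N (snd p)" for p by (simp add: \<nu>_def)
  have "transpose FF = FF" using F by (auto simp: transpose_def FF_def vec_eq_iff)
  from quadratic_form_sq_le_trace[OF this, of R \<nu>]
  have "((G *v \<nu>) \<bullet> (FF *v (G *v \<nu>)))\<^sup>2 \<le> (\<nu> \<bullet> (G *v \<nu>))\<^sup>2 * trace ((G ** FF) ** (G ** FF))"
    by (simp add: G_def)
  moreover have "(FF *v z) $ p = (\<Sum>k\<in>UNIV. \<Sum>l\<in>UNIV. F (fst p) (snd p) k l * z $ (k, l))" for z p
    by (simp add: matrix_vector_mult_def FF_def pairs)
  then have "(G *v \<nu>) \<bullet> (FF *v (G *v \<nu>)) =
      (\<Sum>a\<in>UNIV. \<Sum>b\<in>UNIV. \<Sum>k\<in>UNIV. \<Sum>l\<in>UNIV. F a b k l * w a * w b * w k * w l)"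
    by (simp add: inner_vec_def \<omega> pairs sum_distrib_left mult_ac)
  moreover have "\<nu> \<bullet> (G *v \<nu>) = (\<Sum>i\<in>UNIV. N i * w i)\<^sup>2"
    by (simp add: inner_vec_def \<omega> \<nu> pairs power2_eq_square sum_product mult_ac)
  moreover have "(G ** FF) $ p $ q = \<beta> (fst p) (snd p) (fst q) (snd q)" for p q
    by (simp add: matrix_matrix_mult_def G FF_def pairs \<beta>)
  then have "trace ((G ** FF) ** (G ** FF)) =
      (\<Sum>i\<in>UNIV. \<Sum>j\<in>UNIV. \<Sum>k\<in>UNIV. \<Sum>l\<in>UNIV. \<beta> i j k l * \<beta> k l i j)"
    by (simp add: trace_def matrix_matrix_mult_def[of "G ** FF"] pairs)
  ultimately show ?thesis by simp
qed

section \<open>The closing end of a rotationally symmetric metric\<close>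

lemma nonincreasing_on_ray:
  fixes f f' :: "real \<Rightarrow> real"
  assumes "\<And>s. s \<ge> a \<Longrightarrow> (f has_real_derivative f' s) (at s)" "\<And>s. s \<ge> a \<Longrightarrow> f' s \<le> 0"
    and "a \<le> s" "s \<le> t"
  shows "f t \<le> f s"
proof (rule DERIV_nonpos_imp_nonincreasing[OF assms(4)])
  fix x assume "s \<le> x" "x \<le> t"
  then show "\<exists>y. DERIV f x :> y \<and> y \<le> 0" using assms(1,2)[of x] assms(3) by auto
qed

text \<open>The hypotheses say that the rotationally symmetric metric with area density \<open>\<phi>\<close> on
  a half-cylinder has curvature bounded above and closes up smoothly at the end of the
  cylinder, where \<open>y\<close> is its moment map.\<close>

lemma moment_le_density:
  fixes y \<phi> \<phi>' \<phi>'' :: "real \<Rightarrow> real"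
  assumes y': "\<And>s. s \<ge> 0 \<Longrightarrow> (y has_real_derivative - \<phi> s) (at s)"
    and \<phi>': "\<And>s. s \<ge> 0 \<Longrightarrow> (\<phi> has_real_derivative \<phi>' s) (at s)"
    and \<phi>'': "\<And>s. s \<ge> 0 \<Longrightarrow> (\<phi>' has_real_derivative \<phi>'' s) (at s)"
    and pos: "\<And>s. s \<ge> 0 \<Longrightarrow> \<phi> s > 0" "\<And>s. s \<ge> 0 \<Longrightarrow> y s \<ge> 0"
    and curv: "\<And>s. s \<ge> 0 \<Longrightarrow> (\<phi>' s)\<^sup>2 - \<phi> s ^ 3 \<le> \<phi>'' s * \<phi> s"
    and decay: "\<And>s. s \<ge> s0 \<Longrightarrow> y s \<le> C * exp (- 2 * s)"
    and y0: "y 0 \<le> 1 / 2" and "s \<ge> 0"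
  shows "y s \<le> \<phi> s"
proof -
  have decay0: "((\<lambda>s. C * exp (- 2 * s)) \<longlongrightarrow> 0) at_top"
    by real_asymp
  \<comment> \<open>The curvature hypothesis says \<open>(ln \<phi>)'' \<ge> - \<phi> = y'\<close>,
    so \<open>m\<close> is nondecreasing.\<close>
  define m where "m s = \<phi>' s / \<phi> s - y s" for s
  have m: "m s \<le> m t" if "0 \<le> s" "s \<le> t" for s t
  proof -
    have "- m t \<le> - m s"
    proof (rule nonincreasing_on_ray[where a = 0 and f = "\<lambda>s. - m s" and
          f' = "\<lambda>s. - ((\<phi>'' s * \<phi> s - \<phi>' s * \<phi>' s) / (\<phi> s * \<phi> s) + \<phi> s)"])
      fix s :: real assume s: "s \<ge> 0"
      show "((\<lambda>s. - m s) has_real_derivative - ((\<phi>'' s * \<phi> s - \<phi>' s * \<phi>' s) / (\<phi> s * \<phi> s) + \<phi> s)) (at s)"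
        unfolding m_def using pos(1)[OF s]
        by (auto intro!: derivative_eq_intros y'[OF s] \<phi>'[OF s] \<phi>''[OF s])
      have "0 \<le> ((\<phi>'' s * \<phi> s - (\<phi>' s)\<^sup>2) + \<phi> s ^ 3) / (\<phi> s * \<phi> s)"
        using curv[OF s] pos(1)[OF s] by (intro divide_nonneg_pos) auto
      also have "\<dots> = (\<phi>'' s * \<phi> s - \<phi>' s * \<phi>' s) / (\<phi> s * \<phi> s) + \<phi> s"
        using pos(1)[OF s] by (simp add: field_simps power2_eq_square power3_eq_cube)
      finally show "- ((\<phi>'' s * \<phi> s - \<phi>' s * \<phi>' s) / (\<phi> s * \<phi> s) + \<phi> s) \<le> 0" by simp
    qed (use that in auto)
    then show ?thesis by simp
  qed
  \<comment> \<open>If \<open>m\<close> exceeded -3/2 once, monotonicity and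
    \<open>y \<ge> 0\<close> would keep \<open>\<phi>' / \<phi>\<close> above -3/2 from then on, and
    \<open>y\<close> could not decay faster than \<open>exp (- (3 / 2) * s)\<close>, against the
    rate 2. The value -3/2 lies above -2 and, with \<open>y \<le> 1 / 2\<close>, still yields
    \<open>\<phi>' \<le> - \<phi>\<close> below.\<close>
  have m_le: "m s1 \<le> - 3 / 2" if s1: "s1 \<ge> 0" for s1
  proof (rule ccontr)
    assume m1: "\<not> m s1 \<le> - 3 / 2"
    have \<phi>1: "\<phi>' s \<ge> - (3 / 2) * \<phi> s" if s: "s \<ge> s1" for s
    proof -
      have "\<phi>' s / \<phi> s \<ge> - 3 / 2"
        using m[OF s1 s] m1 pos(2)[of s] s s1 by (simp add: m_def)
      then show ?thesis using pos(1)[of s] s s1 by (simp add: field_simps)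
    qed
    define K where "K = \<phi> s1 * exp (3 / 2 * s1)"
    have K: "K > 0" using pos(1)[OF s1] by (simp add: K_def)
    have \<phi>K: "\<phi> s \<ge> K * exp (- (3 / 2) * s)" if s: "s \<ge> s1" for s
    proof -
      have "- (\<phi> s * exp (3 / 2 * s)) \<le> - (\<phi> s1 * exp (3 / 2 * s1))"
      proof (rule nonincreasing_on_ray[where a = s1 and f = "\<lambda>s. - (\<phi> s * exp (3 / 2 * s))" and
            f' = "\<lambda>s. - ((\<phi>' s + 3 / 2 * \<phi> s) * exp (3 / 2 * s))"])
        fix s assume s: "s1 \<le> s"
        show "((\<lambda>s. - (\<phi> s * exp (3 / 2 * s))) has_real_derivative - ((\<phi>' s + 3 / 2 * \<phi> s) * exp (3 / 2 * s))) (at s)"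
          using s s1 by (auto intro!: derivative_eq_intros \<phi>' simp: algebra_simps)
        show "- ((\<phi>' s + 3 / 2 * \<phi> s) * exp (3 / 2 * s)) \<le> 0"
          using \<phi>1[OF s] by simp
      qed (use s in auto)
      then have "K * exp (- (3 / 2) * s) \<le> \<phi> s * exp (3 / 2 * s) * exp (- (3 / 2) * s)"
        unfolding K_def by (intro mult_right_mono) auto
      also have "\<dots> = \<phi> s" by (simp add: mult.assoc exp_add[symmetric])
      finally show ?thesis .
    qed
    \<comment> \<open>This arises from integrating the lower bound for \<open>\<phi>\<close> over
      \<open>[s, s + 1]\<close> and discarding \<open>y (s + 1) \<ge> 0\<close>.\<close>
    define K' where "K' = 2 / 3 * K * (1 - exp (- 3 / 2))"
    have K': "K' > 0" using K by (simp add: K'_def)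
    have yK: "y s \<ge> K' * exp (- (3 / 2) * s)" if s: "s \<ge> s1" for s
    proof -
      have "y (s + 1) - 2 / 3 * K * exp (- (3 / 2) * (s + 1)) \<le> y s - 2 / 3 * K * exp (- (3 / 2) * s)"
      proof (rule nonincreasing_on_ray[where a = s1 and f = "\<lambda>s. y s - 2 / 3 * K * exp (- (3 / 2) * s)"
            and f' = "\<lambda>s. - \<phi> s + K * exp (- (3 / 2) * s)"])
        fix s assume s: "s1 \<le> s"
        show "((\<lambda>s. y s - 2 / 3 * K * exp (- (3 / 2) * s)) has_real_derivative - \<phi> s + K * exp (- (3 / 2) * s)) (at s)"
          using s s1 by (auto intro!: derivative_eq_intros y')
        show "- \<phi> s + K * exp (- (3 / 2) * s) \<le> 0" using \<phi>K[OF s] by simp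
      qed (use s in auto)
      moreover have "exp (- (3 / 2) * (s + 1)) = exp (- (3 / 2) * s) * exp (- 3 / 2)"
        by (simp add: exp_add[symmetric] algebra_simps)
      moreover have "y (s + 1) \<ge> 0" using pos(2) s s1 by simp
      ultimately show ?thesis by (simp add: K'_def algebra_simps)
    qed
    have "K' \<le> C * exp (- s / 2)" if "s \<ge> s1" "s \<ge> s0" for s
    proof -
      have "K' * exp (- (3 / 2) * s) \<le> C * exp (- 2 * s)"
        using yK[OF that(1)] decay[OF that(2)] by simp
      then have "K' * exp (- (3 / 2) * s) * exp (3 / 2 * s) \<le> C * exp (- 2 * s) * exp (3 / 2 * s)"
        by (intro mult_right_mono) auto
      then show ?thesis by (simp add: mult.assoc exp_add[symmetric])
    qed
    then have "\<forall>\<^sub>F s in at_top. K' \<le> C * exp (- s / 2)"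
      using eventually_ge_at_top[of "max s1 s0"] by (elim eventually_mono) auto
    moreover have "((\<lambda>s. C * exp (- s / 2)) \<longlongrightarrow> 0) at_top" by real_asymp
    ultimately have "K' \<le> 0"
      using tendsto_lowerbound trivial_limit_at_top_linorder by blast
    then show False using K' by simp
  qed
  have yhalf: "y s \<le> 1 / 2" if "s \<ge> 0" for s
  proof -
    have "y s \<le> y 0"
      by (rule nonincreasing_on_ray[where a = 0 and f' = "\<lambda>s. - \<phi> s"]) (use y' pos(1) that less_imp_le in auto)
    then show ?thesis using y0 by simp
  qed
  \<comment> \<open>Since \<open>\<phi>' \<le> - \<phi> = y'\<close>, the difference
    \<open>\<phi> - y\<close> is nonincreasing; at a late time \<open>t\<close> it exceeds
    \<open>- y t\<close>, which tends to 0.\<close>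
  have "\<phi> s - y s \<ge> - (C * exp (- 2 * t))" if "t \<ge> s" "t \<ge> s0" for t
  proof -
    have "\<phi> t - y t \<le> \<phi> s - y s"
    proof (rule nonincreasing_on_ray[where a = 0 and f = "\<lambda>s. \<phi> s - y s" and f' = "\<lambda>s. \<phi>' s + \<phi> s"])
      fix s :: real assume s: "s \<ge> 0"
      show "((\<lambda>s. \<phi> s - y s) has_real_derivative \<phi>' s + \<phi> s) (at s)"
        using s by (auto intro!: derivative_eq_intros y' \<phi>')
      have "\<phi>' s / \<phi> s \<le> - 1" using m_le[OF s] yhalf[OF s] by (simp add: m_def)
      then show "\<phi>' s + \<phi> s \<le> 0" using pos(1)[OF s] by (simp add: field_simps)
    qed (use that \<open>s \<ge> 0\<close> in auto)
    moreover have "\<phi> t > 0" using pos that \<open>s \<ge> 0\<close> by simp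
    ultimately show ?thesis using decay[OF that(2)] by simp
  qed
  then have "\<forall>\<^sub>F t in at_top. - (C * exp (- 2 * t)) \<le> \<phi> s - y s"
    using eventually_ge_at_top[of "max s s0"] by (elim eventually_mono) auto
  moreover have "((\<lambda>t. - (C * exp (- 2 * t))) \<longlongrightarrow> - 0) at_top"
    by (intro tendsto_minus decay0)
  ultimately have "- 0 \<le> \<phi> s - y s"
    using tendsto_upperbound trivial_limit_at_top_linorder by blast
  then show ?thesis by simp
qed

section \<open>Functions with positive definite Hessian\<close>

lemma smooth_on_curve_derivative:
  fixes f :: "real^'n \<Rightarrow> real" and c :: "real \<Rightarrow> real^'n"
  assumes "(f has_derivative (\<lambda>h. \<Sum>i\<in>UNIV. h $ i * D i)) (at (c s))"
    and "(c has_vector_derivative v) (at s)"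
  shows "((\<lambda>s. f (c s)) has_real_derivative (\<Sum>i\<in>UNIV. v $ i * D i)) (at s)"
proof -
  have "((\<lambda>s. f (c s)) has_derivative (\<lambda>t. \<Sum>i\<in>UNIV. (t *\<^sub>R v) $ i * D i)) (at s)"
    using has_derivative_compose[OF assms(2)[unfolded has_vector_derivative_def] assms(1)] .
  moreover have "(\<lambda>t. \<Sum>i\<in>UNIV. (t *\<^sub>R v) $ i * D i) = (*) (\<Sum>i\<in>UNIV. v $ i * D i)"
    by (rule ext) (simp add: sum_distrib_left mult_ac)
  ultimately show ?thesis by (simp add: has_field_derivative_def)
qed

text \<open>Because the second factor vanishes at \<open>x\<close>, any variation of
  \<open>c\<close> is multiplied by something small, so continuity of \<open>c\<close> suffices for
  the product rule. This lets \<open>B_has_derivative\<close> differentiate an inverse known only to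
  be continuous.\<close>

lemma has_derivative_mult_vanishing:
  fixes c a :: "'a::real_normed_vector \<Rightarrow> real"
  assumes c: "isCont c x" and a: "(a has_derivative a') (at x)"
  shows "((\<lambda>y. c y * (a y - a x)) has_derivative (\<lambda>h. c x * a' h)) (at x)"
proof -
  interpret a': bounded_linear a' using a by (rule has_derivative_bounded_linear)
  obtain K where K: "K > 0" "\<And>h. norm (a' h) \<le> norm h * K" using a'.pos_bounded by blast
  let ?q = "\<lambda>y. norm (a y - a x - a' (y - x)) / norm (y - x)"
  have q: "(?q \<longlongrightarrow> 0) (at x)" using a unfolding has_derivative_iff_norm by blast
  have c0: "((\<lambda>y. \<bar>c y - c x\<bar> * K) \<longlongrightarrow> 0) (at x)"
    using c unfolding isCont_def by (auto intro!: tendsto_eq_intros)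
  have c1: "((\<lambda>y. \<bar>c y\<bar>) \<longlongrightarrow> \<bar>c x\<bar>) (at x)"
    using c unfolding isCont_def by (rule tendsto_rabs)
  have lim: "((\<lambda>y. \<bar>c y\<bar> * ?q y + \<bar>c y - c x\<bar> * K) \<longlongrightarrow> 0) (at x)"
    using tendsto_add[OF tendsto_mult[OF c1 q] c0] by simp
  have "((\<lambda>y. norm (c y * (a y - a x) - c x * (a x - a x) - c x * a' (y - x)) / norm (y - x)) \<longlongrightarrow> 0) (at x)"
  proof (rule tendsto_sandwich[OF _ _ tendsto_const lim])
    show "\<forall>\<^sub>F y in at x. 0 \<le> norm (c y * (a y - a x) - c x * (a x - a x) - c x * a' (y - x)) / norm (y - x)"
      by simp
    show "\<forall>\<^sub>F y in at x. norm (c y * (a y - a x) - c x * (a x - a x) - c x * a' (y - x)) / norm (y - x)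
        \<le> \<bar>c y\<bar> * ?q y + \<bar>c y - c x\<bar> * K"
    proof (rule eventually_at_topological[THEN iffD2], intro exI[of _ UNIV] conjI ballI impI)
      fix y assume "y \<noteq> x"
      have "c y * (a y - a x) - c x * (a x - a x) - c x * a' (y - x)
          = c y * (a y - a x - a' (y - x)) + (c y - c x) * a' (y - x)" by (simp add: algebra_simps)
      then have "norm (c y * (a y - a x) - c x * (a x - a x) - c x * a' (y - x))
          \<le> \<bar>c y\<bar> * norm (a y - a x - a' (y - x)) + \<bar>c y - c x\<bar> * norm (a' (y - x))"
        by (metis abs_mult norm_triangle_ineq real_norm_def)
      also have "\<dots> \<le> \<bar>c y\<bar> * norm (a y - a x - a' (y - x)) + \<bar>c y - c x\<bar> * (norm (y - x) * K)"
        by (intro add_left_mono mult_left_mono K(2)) auto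
      finally show "norm (c y * (a y - a x) - c x * (a x - a x) - c x * a' (y - x)) / norm (y - x)
        \<le> \<bar>c y\<bar> * ?q y + \<bar>c y - c x\<bar> * K"
        using \<open>y \<noteq> x\<close> by (simp add: divide_simps algebra_simps)
    qed auto
  qed
  then show ?thesis
    unfolding has_derivative_iff_norm
    using bounded_linear_compose[OF bounded_linear_mult_right a'.bounded_linear_axioms] by simp
qed

lemma continuous_det:
  fixes A :: "'a::t2_space \<Rightarrow> real^'n^'n"
  assumes "\<And>i j. continuous F (\<lambda>x. A x $ i $ j)"
  shows "continuous F (\<lambda>x. det (A x))"
  unfolding det_def by (intro continuous_sum continuous_mult continuous_const continuous_prod assms)

lemma posdef_cauchy_schwarz:
  fixes B :: "real^'n^'n"
  assumes sym: "\<And>x y. x \<bullet> (B *v y) = y \<bullet> (B *v x)"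
    and nonneg: "\<And>x. 0 \<le> x \<bullet> (B *v x)" and pos: "0 < y \<bullet> (B *v y)"
  shows "(x \<bullet> (B *v y))\<^sup>2 \<le> (x \<bullet> (B *v x)) * (y \<bullet> (B *v y))"
proof -
  define p q r where "p = x \<bullet> (B *v x)" and "q = x \<bullet> (B *v y)" and "r = y \<bullet> (B *v y)"
  have "y \<bullet> (B *v x) = q" using sym by (simp add: q_def)
  then have "(r *\<^sub>R x - q *\<^sub>R y) \<bullet> (B *v (r *\<^sub>R x - q *\<^sub>R y)) = r * (r * p - q * q)"
    by (simp add: matrix_vector_mult_diff_distrib matrix_vector_mult_scaleR inner_diff
        p_def[symmetric] q_def[symmetric] r_def[symmetric] algebra_simps)
  then have "0 \<le> r * (r * p - q * q)" using nonneg by metis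
  then show ?thesis using pos unfolding p_def[symmetric] q_def[symmetric] r_def[symmetric]
    by (simp add: zero_le_mult_iff power2_eq_square mult.commute)
qed

definition gradient :: "(real^'n \<Rightarrow> real) \<Rightarrow> real^'n \<Rightarrow> real^'n" where
  "gradient f x = (\<chi> i. pdiff i f x)"

lemma gradient_nth [simp]: "gradient f x $ i = pdiff i f x"
  by (simp add: gradient_def)

lemma smooth_on_has_derivative_gradient:
  fixes f :: "real^'n \<Rightarrow> real"
  assumes "smooth_on S f" "x \<in> S"
  shows "(f has_derivative (\<lambda>h. gradient f x \<bullet> h)) (at x)"
proof -
  have "(\<lambda>h. gradient f x \<bullet> h) = (\<lambda>h. \<Sum>i\<in>UNIV. h $ i * pdiff i f x)"
    by (auto simp: inner_vec_def mult.commute)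
  then show ?thesis using smooth_on_has_derivative[OF assms] by simp
qed

lemma has_derivative_vecI:
  fixes f :: "'a::real_normed_vector \<Rightarrow> real^'n"
  assumes "\<And>i. ((\<lambda>x. f x $ i) has_derivative (\<lambda>h. f' h $ i)) (at x)"
  shows "(f has_derivative f') (at x)"
proof -
  have "((\<lambda>x. f x \<bullet> b) has_derivative (\<lambda>h. f' h \<bullet> b)) (at x)" if b: "b \<in> Basis" for b
  proof -
    obtain i where "b = axis i 1" using b by (auto simp: Basis_vec_def)
    then show ?thesis using assms[of i] by (simp add: inner_axis)
  qed
  then show ?thesis using has_derivative_componentwise_within[of f f' x UNIV] by blast
qed

lemma smooth_on_gradient_has_derivative:
  fixes f :: "real^'n \<Rightarrow> real"
  assumes f: "smooth_on S f" and x: "x \<in> S"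
  shows "(gradient f has_derivative (*v) (hess f x)) (at x)"
proof (rule has_derivative_vecI)
  fix k
  have eq: "(hess f x *v h) $ k = (\<Sum>i\<in>UNIV. h $ i * pdiff i (pdiff k f) x)" for h
    unfolding matrix_vector_mult_def hess_def
    by (simp add: iter_pd_def pdiff_commute[OF f x, of k] mult.commute)
  have "(pdiff k f has_derivative (\<lambda>h. \<Sum>i\<in>UNIV. h $ i * pdiff i (pdiff k f) x)) (at x)"
    by (rule smooth_on_has_derivative[OF smooth_on_pdiff[OF f] x])
  then show "((\<lambda>x. gradient f x $ k) has_derivative (\<lambda>h. (hess f x *v h) $ k)) (at x)"
    by (simp add: eq)
qed

lemma matrix_mult3_nth:
  fixes A C D :: "real^'n^'n"
  shows "(A ** C ** D) $ i $ j = (\<Sum>p\<in>UNIV. \<Sum>q\<in>UNIV. A $ i $ p * C $ p $ q * D $ q $ j)"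
proof -
  have "(A ** C ** D) $ i $ j = (\<Sum>q\<in>UNIV. \<Sum>p\<in>UNIV. A $ i $ p * C $ p $ q * D $ q $ j)"
    by (simp add: matrix_matrix_mult_def sum_distrib_right)
  also have "\<dots> = (\<Sum>p\<in>UNIV. \<Sum>q\<in>UNIV. A $ i $ p * C $ p $ q * D $ q $ j)" by (rule sum.swap)
  finally show ?thesis .
qed

lemma matrix_add_rdistrib:
  fixes A B :: "real^'n^'m" and C :: "real^'k^'n"
  shows "(A + B) ** C = A ** C + B ** C"
  by (simp add: matrix_matrix_mult_def vec_eq_iff distrib_right sum.distrib)

locale pos_def_hessian =
  fixes S :: "(real^'n) set" and u :: "real^'n \<Rightarrow> real"
  assumes smooth: "smooth_on S u"
    and pos_def: "x \<in> S \<Longrightarrow> v \<noteq> 0 \<Longrightarrow> 0 < v \<bullet> (hess u x *v v)"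
begin

abbreviation T :: "'n \<Rightarrow> 'n \<Rightarrow> 'n \<Rightarrow> real^'n \<Rightarrow> real" where
  "T i j k x \<equiv> iter_pd [i, j, k] u x"

abbreviation Q :: "'n \<Rightarrow> 'n \<Rightarrow> 'n \<Rightarrow> 'n \<Rightarrow> real^'n \<Rightarrow> real" where
  "Q i j k l x \<equiv> iter_pd [i, j, k, l] u x"

abbreviation B :: "'n \<Rightarrow> 'n \<Rightarrow> real^'n \<Rightarrow> real" where
  "B i j x \<equiv> hess_inv_entry u i j x"

section \<open>Symmetries of the derivatives, and the inverse Hessian\<close>

lemma open_S: "open S"
  using smooth by (rule smooth_on_imp_open)

lemma iter_pd_has_derivative:
  "x \<in> S \<Longrightarrow> (iter_pd js u has_derivative (\<lambda>h. \<Sum>i\<in>UNIV. h $ i * iter_pd (i # js) u x)) (at x)"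
  using smooth_on_has_derivative[OF smooth_on_iter_pd[OF smooth], of x js]
  by (simp add: pdiff_iter_pd)

lemma isCont_iter_pd: "x \<in> S \<Longrightarrow> isCont (iter_pd js u) x"
  by (meson has_derivative_continuous iter_pd_has_derivative)

lemma hess_commute: "x \<in> S \<Longrightarrow> iter_pd [i, j] u x = iter_pd [j, i] u x"
  using iter_pd_swap[OF smooth, of x "[]" i j "[]"] by simp

lemma T_swap:
  assumes "x \<in> S"
  shows "T i j k x = T j i k x" "T i j k x = T i k j x"
  using iter_pd_swap[OF smooth assms, of "[]" i j "[k]"] iter_pd_swap[OF smooth assms, of "[i]" j k "[]"]
  by simp_all

lemma Q_pair_swap: 
  assumes "x \<in> S"
  shows "Q i j k l x = Q k l i j x"
proof -
  have s1: "Q i j k l x = Q j i k l x" for i j k l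
    using iter_pd_swap[OF smooth assms, of "[]" i j "[k,l]"] by simp
  have s2: "Q i j k l x = Q i k j l x" for i j k l
    using iter_pd_swap[OF smooth assms, of "[i]" j k "[l]"] by simp
  have s3: "Q i j k l x = Q i j l k x" for i j k l
    using iter_pd_swap[OF smooth assms, of "[i,j]" k l "[]"] by simp
  have "Q i j k l x = Q i k j l x" by (rule s2)
  also have "\<dots> = Q k i j l x" by (rule s1)
  also have "\<dots> = Q k i l j x" by (rule s3)
  also have "\<dots> = Q k l i j x" by (rule s2)
  finally show ?thesis .
qed

lemma hess_invertible:
  assumes "x \<in> S"
  shows "hess u x ** matrix_inv (hess u x) = mat 1" "matrix_inv (hess u x) ** hess u x = mat 1"
proof -
  have "inj ((*v) (hess u x))"
  proof (rule injI)
    fix v w assume eq: "hess u x *v v = hess u x *v w"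
    have "(v - w) \<bullet> (hess u x *v (v - w)) = 0"
      using eq by (simp add: matrix_vector_mult_diff_distrib)
    then show "v = w" using pos_def[OF assms, of "v - w"] by force
  qed
  then have "invertible (hess u x)"
    by (simp add: invertible_left_inverse matrix_left_invertible_injective)
  then have "\<exists>A'. hess u x ** A' = mat 1 \<and> A' ** hess u x = mat 1"
    by (simp add: invertible_def)
  then have "hess u x ** matrix_inv (hess u x) = mat 1 \<and> matrix_inv (hess u x) ** hess u x = mat 1"
    unfolding matrix_inv_def by (rule someI_ex)
  then show "hess u x ** matrix_inv (hess u x) = mat 1" "matrix_inv (hess u x) ** hess u x = mat 1"
    by auto
qed

lemma hess_B:
  assumes "x \<in> S"
  shows "(\<Sum>j\<in>UNIV. iter_pd [i, j] u x * B j k x) = (if i = k then 1 else 0)"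
    and "(\<Sum>j\<in>UNIV. B i j x * iter_pd [j, k] u x) = (if i = k then 1 else 0)"
proof -
  have "(hess u x ** matrix_inv (hess u x)) $ i $ k = (mat 1 :: real^'n^'n) $ i $ k"
    "(matrix_inv (hess u x) ** hess u x) $ i $ k = (mat 1 :: real^'n^'n) $ i $ k"
    by (simp_all add: hess_invertible assms)
  then show "(\<Sum>j\<in>UNIV. iter_pd [i, j] u x * B j k x) = (if i = k then 1 else 0)"
    and "(\<Sum>j\<in>UNIV. B i j x * iter_pd [j, k] u x) = (if i = k then 1 else 0)"
    by (simp_all add: matrix_matrix_mult_def hess_def hess_inv_entry_def mat_def)
qed

lemma transpose_hess: "x \<in> S \<Longrightarrow> transpose (hess u x) = hess u x"
  by (simp add: vec_eq_iff transpose_def hess_def hess_commute)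

lemma transpose_hess_inv:
  assumes "x \<in> S"
  shows "transpose (matrix_inv (hess u x)) = matrix_inv (hess u x)"
proof -
  let ?A = "hess u x" and ?B = "matrix_inv (hess u x)"
  have "transpose (?A ** ?B) = transpose (mat 1)" using hess_invertible[OF assms] by simp
  then have "transpose ?B ** ?A = mat 1"
    by (simp add: matrix_transpose_mul transpose_hess assms transpose_mat)
  then have "transpose ?B ** ?A ** ?B = ?B" by simp
  then show ?thesis by (simp add: matrix_mul_assoc[symmetric] hess_invertible assms)
qed

lemma B_commute:
  assumes "x \<in> S"
  shows "B i j x = B j i x"
proof -
  have "matrix_inv (hess u x) $ i $ j = transpose (matrix_inv (hess u x)) $ i $ j"
    by (simp only: transpose_hess_inv[OF assms])
  also have "\<dots> = matrix_inv (hess u x) $ j $ i" by (simp add: transpose_def)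
  finally show ?thesis by (simp only: hess_inv_entry_def)
qed

lemma B_pos_def:
  assumes "x \<in> S" "v \<noteq> 0"
  shows "0 < v \<bullet> (matrix_inv (hess u x) *v v)"
proof -
  let ?w = "matrix_inv (hess u x) *v v"
  have v: "hess u x *v ?w = v" by (simp add: matrix_vector_mul_assoc hess_invertible assms)
  then have "?w \<noteq> 0" using assms(2) by force
  then have "0 < ?w \<bullet> (hess u x *v ?w)" by (rule pos_def[OF assms(1)])
  then show ?thesis by (simp add: v inner_commute)
qed

text \<open>By Cramer's rule the entry is a quotient of determinants with continuous entries;
  \<open>E\<close> is the Hessian with column \<open>i\<close> replaced by the \<open>j\<close>-th
  unit vector.\<close>

lemma isCont_B:
  assumes x: "x \<in> S"
  shows "isCont (\<lambda>x. B i j x) x"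
proof -
  define E where "E x = (\<chi> a b. if b = i then axis j (1::real) $ a else hess u x $ a $ b)" for x
  have det: "det (hess u y) \<noteq> 0" if "y \<in> S" for y
    using hess_invertible[OF that] invertible_det_nz unfolding invertible_def by blast
  have eq: "B i j y = det (E y) / det (hess u y)" if "y \<in> S" for y
  proof -
    have "hess u y *v (matrix_inv (hess u y) *v axis j 1) = axis j 1"
      by (simp add: matrix_vector_mul_assoc hess_invertible that)
    then have "matrix_inv (hess u y) *v axis j 1 =
        (\<chi> k. det (\<chi> a b. if b = k then axis j 1 $ a else hess u y $ a $ b) / det (hess u y))"
      using cramer[OF det[OF that]] by blast
    then have "(matrix_inv (hess u y) *v axis j 1) $ i = det (E y) / det (hess u y)"
      by (simp add: E_def)
    moreover have "(matrix_inv (hess u y) *v axis j 1) $ i = B i j y"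
      by (simp add: matrix_vector_mul_component inner_axis hess_inv_entry_def)
    ultimately show ?thesis by simp
  qed
  have h: "isCont (\<lambda>x. hess u x $ a $ b) x" for a b
    using isCont_iter_pd[OF x, of "[a, b]"] by (simp add: hess_def)
  have "isCont (\<lambda>x. E x $ a $ b) x" for a b
    by (cases "b = i") (simp_all add: E_def h)
  then have "isCont (\<lambda>x. det (E x) / det (hess u x)) x"
    using det[OF x] h by (intro continuous_divide continuous_det) auto
  moreover have "\<forall>\<^sub>F y in nhds x. B i j y = det (E y) / det (hess u y)"
    using eventually_nhds_in_open[OF open_S x] by eventually_elim (rule eq)
  ultimately show ?thesis using isCont_cong by fast
qed

text \<open>The classical formula d(A^-1) = - A^-1 (dA) A^-1 in coordinates; \<open>m\<close> is the
  direction of differentiation.\<close>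

definition DB :: "'n \<Rightarrow> 'n \<Rightarrow> 'n \<Rightarrow> real^'n \<Rightarrow> real" where
  "DB m i j x = - (\<Sum>k\<in>UNIV. \<Sum>l\<in>UNIV. B i k x * T m k l x * B l j x)"

text \<open>The identity A(y)^-1 = A(x)^-1 - A(y)^-1 (A(y) - A(x)) A(x)^-1 exhibits the unknown
  A(y)^-1 only as a coefficient of a factor that vanishes at \<open>x\<close>, which is the
  situation of \<open>has_derivative_mult_vanishing\<close>.\<close>

lemma B_has_derivative:
  assumes x: "x \<in> S"
  shows "((\<lambda>x. B i j x) has_derivative (\<lambda>h. \<Sum>m\<in>UNIV. h $ m * DB m i j x)) (at x)"
proof -
  let ?A = "\<lambda>k l. iter_pd [k, l] u"
  have eq: "B i j y = B i j x + (\<Sum>k\<in>UNIV. \<Sum>l\<in>UNIV. (- B i k y) * (?A k l y - ?A k l x) * B l j x)" if y: "y \<in> S" for y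
  proof -
    have "(\<Sum>k\<in>UNIV. \<Sum>l\<in>UNIV. B i k y * ?A k l y * B l j x) = (\<Sum>l\<in>UNIV. (\<Sum>k\<in>UNIV. B i k y * ?A k l y) * B l j x)"
      by (subst sum.swap) (simp add: sum_distrib_right)
    also have "\<dots> = B i j x" by (simp add: hess_B y if_distrib[of "\<lambda>a. a * _"] cong: if_cong)
    finally have 1: "(\<Sum>k\<in>UNIV. \<Sum>l\<in>UNIV. B i k y * ?A k l y * B l j x) = B i j x" .
    have "(\<Sum>k\<in>UNIV. \<Sum>l\<in>UNIV. B i k y * ?A k l x * B l j x) = (\<Sum>k\<in>UNIV. B i k y * (\<Sum>l\<in>UNIV. ?A k l x * B l j x))"
      by (simp add: sum_distrib_left mult.assoc)
    also have "\<dots> = B i j y" by (simp add: hess_B x if_distrib cong: if_cong)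
    finally have 2: "(\<Sum>k\<in>UNIV. \<Sum>l\<in>UNIV. B i k y * ?A k l x * B l j x) = B i j y" .
    show ?thesis using 1 2 by (simp add: algebra_simps sum_subtractf)
  qed
  have "((\<lambda>y. (- B i k y) * (?A k l y - ?A k l x)) has_derivative
      (\<lambda>h. (- B i k x) * (\<Sum>m\<in>UNIV. h $ m * T m k l x))) (at x)" for k l
    by (rule has_derivative_mult_vanishing[OF continuous_minus[OF isCont_B[OF x]] iter_pd_has_derivative[OF x]])
  then have "((\<lambda>y. B i j x + (\<Sum>k\<in>UNIV. \<Sum>l\<in>UNIV. (- B i k y) * (?A k l y - ?A k l x) * B l j x)) has_derivative
      (\<lambda>h. 0 + (\<Sum>k\<in>UNIV. \<Sum>l\<in>UNIV. (- B i k x) * (\<Sum>m\<in>UNIV. h $ m * T m k l x) * B l j x))) (at x)"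
    by (intro has_derivative_add has_derivative_const has_derivative_sum has_derivative_mult_left)
  moreover have "(\<lambda>h. 0 + (\<Sum>k\<in>UNIV. \<Sum>l\<in>UNIV. (- B i k x) * (\<Sum>m\<in>UNIV. h $ m * T m k l x) * B l j x))
      = (\<lambda>h. \<Sum>m\<in>UNIV. h $ m * DB m i j x)"
  proof (rule ext)
    fix h :: "real^'n"
    have "(\<Sum>m\<in>UNIV. h $ m * DB m i j x) = - (\<Sum>m\<in>UNIV. \<Sum>k\<in>UNIV. \<Sum>l\<in>UNIV. h $ m * (B i k x * T m k l x * B l j x))"
      by (simp add: DB_def sum_distrib_left sum_negf)
    also have "(\<Sum>m\<in>UNIV. \<Sum>k\<in>UNIV. \<Sum>l\<in>UNIV. h $ m * (B i k x * T m k l x * B l j x))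
        = (\<Sum>k\<in>UNIV. \<Sum>l\<in>UNIV. \<Sum>m\<in>UNIV. h $ m * (B i k x * T m k l x * B l j x))"
      by (subst sum.swap, rule sum.cong[OF refl], rule sum.swap)
    finally show "0 + (\<Sum>k\<in>UNIV. \<Sum>l\<in>UNIV. (- B i k x) * (\<Sum>m\<in>UNIV. h $ m * T m k l x) * B l j x)
        = (\<Sum>m\<in>UNIV. h $ m * DB m i j x)"
      by (simp add: sum_distrib_left sum_distrib_right sum_negf mult_ac)
  qed
  ultimately have "((\<lambda>y. B i j x + (\<Sum>k\<in>UNIV. \<Sum>l\<in>UNIV. (- B i k y) * (?A k l y - ?A k l x) * B l j x)) has_derivative
      (\<lambda>h. \<Sum>m\<in>UNIV. h $ m * DB m i j x)) (at x)" by simp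
  then show ?thesis
    by (rule has_derivative_transform_within_open[OF _ open_S x]) (rule eq[symmetric])
qed

lemma B_curve_derivative:
  assumes "(c has_vector_derivative v) (at s)" "c s \<in> S"
  shows "((\<lambda>s. B i j (c s)) has_real_derivative (\<Sum>m\<in>UNIV. v $ m * DB m i j (c s))) (at s)"
  by (rule smooth_on_curve_derivative[of "B i j" "\<lambda>m. DB m i j (c s)" c s v,
        OF B_has_derivative[OF assms(2)] assms(1)])

lemma iter_pd_curve_derivative:
  assumes "(c has_vector_derivative v) (at s)" "c s \<in> S"
  shows "((\<lambda>s. iter_pd js u (c s)) has_real_derivative (\<Sum>m\<in>UNIV. v $ m * iter_pd (m # js) u (c s))) (at s)"
  by (rule smooth_on_curve_derivative[of "iter_pd js u" "\<lambda>m. iter_pd (m # js) u (c s)" c s v,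
        OF iter_pd_has_derivative[OF assms(2)] assms(1)])

text \<open>The tensor \<open>u\<^sup>i\<^sup>j\<^sub>k\<^sub>l\<close> with its upper indices lowered by the Hessian, which makes the pair symmetry visible.\<close>

definition RF :: "'n \<Rightarrow> 'n \<Rightarrow> 'n \<Rightarrow> 'n \<Rightarrow> real^'n \<Rightarrow> real" where
  "RF a b k l x = (\<Sum>p\<in>UNIV. \<Sum>q\<in>UNIV. T k a p x * B p q x * T l q b x)
    + (\<Sum>p\<in>UNIV. \<Sum>q\<in>UNIV. T l a p x * B p q x * T k q b x) - Q k l a b x"

lemma pdiff_B: "x \<in> S \<Longrightarrow> pdiff m (\<lambda>x. B i j x) x = DB m i j x"
  by (subst has_derivative_imp_pdiff[OF B_has_derivative])
     (simp_all add: axis_def if_distrib[of "\<lambda>a. a * _"] cong: if_cong)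

lemma pdiff_DB:
  assumes x: "x \<in> S"
  shows "pdiff k (\<lambda>x. DB l i j x) x = - (\<Sum>p\<in>UNIV. \<Sum>q\<in>UNIV. (DB k i p x * T l p q x + Q k l p q x * B i p x) * B q j x
      + DB k q j x * (B i p x * T l p q x))"
proof -
  define c where "c t = x + t *\<^sub>R axis k 1" for t :: real
  have c: "(c has_vector_derivative axis k 1) (at 0)"
    unfolding c_def by (auto intro!: derivative_eq_intros)
  have c0: "c 0 = x" by (simp add: c_def)
  have ax: "(\<Sum>m\<in>UNIV. axis k 1 $ m * g m) = g k" for g :: "'n \<Rightarrow> real"
    by (simp add: axis_def if_distrib[of "\<lambda>a. a * _"] cong: if_cong)
  have bd: "((\<lambda>t. B i j (c t)) has_real_derivative DB k i j (c 0)) (at 0)" for i j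
    using B_curve_derivative[OF c] x by (simp add: ax c0)
  have td: "((\<lambda>t. iter_pd js u (c t)) has_real_derivative iter_pd (k # js) u (c 0)) (at 0)" for js
    using iter_pd_curve_derivative[OF c] x by (simp add: ax c0)
  have "((\<lambda>t. - (\<Sum>p\<in>UNIV. \<Sum>q\<in>UNIV. B i p (c t) * T l p q (c t) * B q j (c t))) has_real_derivative
     - (\<Sum>p\<in>UNIV. \<Sum>q\<in>UNIV. (DB k i p (c 0) * T l p q (c 0) + Q k l p q (c 0) * B i p (c 0)) * B q j (c 0)
      + DB k q j (c 0) * (B i p (c 0) * T l p q (c 0)))) (at 0)"
    by (intro DERIV_minus DERIV_sum DERIV_mult bd td)
  then have "((\<lambda>t. DB l i j (c t)) has_real_derivative
     - (\<Sum>p\<in>UNIV. \<Sum>q\<in>UNIV. (DB k i p (c 0) * T l p q (c 0) + Q k l p q (c 0) * B i p (c 0)) * B q j (c 0)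
      + DB k q j (c 0) * (B i p (c 0) * T l p q (c 0)))) (at 0)"
    unfolding DB_def[where m = l] .
  then have "deriv (\<lambda>t. DB l i j (c t)) 0 = - (\<Sum>p\<in>UNIV. \<Sum>q\<in>UNIV. (DB k i p x * T l p q x + Q k l p q x * B i p x) * B q j x
      + DB k q j x * (B i p x * T l p q x))"
    unfolding c0 by (rule DERIV_imp_deriv)
  then show ?thesis unfolding pdiff_def c_def .
qed

text \<open>With A the Hessian and subscripts for its derivatives, the second derivative of A^-1 is
  A^-1 (A_k A^-1 A_l + A_l A^-1 A_k - A_kl) A^-1, and the bracket is \<open>RF\<close>. Working with
  matrix products avoids rearranging the nested sums by hand.\<close>

lemma iter_pd2_B:
  assumes x: "x \<in> S"
  shows "iter_pd [k, l] (hess_inv_entry u i j) x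
    = (\<Sum>a\<in>UNIV. \<Sum>b\<in>UNIV. B i a x * B j b x * RF a b k l x)"
proof -
  define Bm where "Bm = matrix_inv (hess u x)"
  define Tm where "Tm k = (\<chi> a b. T k a b x)" for k
  define Qm where "Qm = (\<chi> a b. Q k l a b x)"
  define Fm where "Fm = (\<chi> a b. RF a b k l x)"
  have Bn: "B i j x = Bm $ i $ j" for i j by (simp add: Bm_def hess_inv_entry_def)
  have Tn: "T k a b x = Tm k $ a $ b" for k a b by (simp add: Tm_def)
  have Qn: "Q k l a b x = Qm $ a $ b" for a b by (simp add: Qm_def)
  have Fn: "RF a b k l x = Fm $ a $ b" for a b by (simp add: Fm_def)
  have DBn: "DB m i j x = - (Bm ** Tm m ** Bm) $ i $ j" for m i j
    unfolding matrix_mult3_nth DB_def Bn Tn ..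
  have F: "Tm k ** Bm ** Tm l + Tm l ** Bm ** Tm k = Fm + Qm"
    by (simp add: vec_eq_iff matrix_mult3_nth Fm_def Qm_def RF_def Tn[symmetric] Bn[symmetric])
  have "iter_pd [k, l] (hess_inv_entry u i j) x = pdiff k (pdiff l (hess_inv_entry u i j)) x"
    by (simp add: iter_pd_def)
  also have "\<dots> = pdiff k (\<lambda>x. DB l i j x) x"
    by (rule pdiff_cong_open[OF open_S x]) (rule pdiff_B)
  also have "\<dots> = (\<Sum>p\<in>UNIV. \<Sum>q\<in>UNIV. (Bm ** Tm k ** Bm) $ i $ p * Tm l $ p $ q * Bm $ q $ j)
     + (\<Sum>p\<in>UNIV. \<Sum>q\<in>UNIV. Bm $ i $ p * Tm l $ p $ q * (Bm ** Tm k ** Bm) $ q $ j)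
     - (\<Sum>p\<in>UNIV. \<Sum>q\<in>UNIV. Bm $ i $ p * Qm $ p $ q * Bm $ q $ j)"
    unfolding pdiff_DB[OF x] DBn Bn Tn Qn
    by (simp add: sum.distrib sum_subtractf sum_negf algebra_simps)
  also have "\<dots> = (Bm ** Tm k ** Bm ** Tm l ** Bm) $ i $ j + (Bm ** Tm l ** (Bm ** Tm k ** Bm)) $ i $ j
     - (Bm ** Qm ** Bm) $ i $ j"
    unfolding matrix_mult3_nth[symmetric] ..
  also have "Bm ** Tm k ** Bm ** Tm l ** Bm = Bm ** (Tm k ** Bm ** Tm l) ** Bm"
    by (simp add: matrix_mul_assoc)
  also have "Bm ** Tm l ** (Bm ** Tm k ** Bm) = Bm ** (Tm l ** Bm ** Tm k) ** Bm"
    by (simp add: matrix_mul_assoc)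
  also have "(Bm ** (Tm k ** Bm ** Tm l) ** Bm) $ i $ j + (Bm ** (Tm l ** Bm ** Tm k) ** Bm) $ i $ j
     = (Bm ** (Fm + Qm) ** Bm) $ i $ j"
    unfolding F[symmetric] by (simp add: matrix_add_ldistrib matrix_add_rdistrib)
  also have "\<dots> - (Bm ** Qm ** Bm) $ i $ j = (Bm ** Fm ** Bm) $ i $ j"
    by (simp add: matrix_add_ldistrib matrix_add_rdistrib)
  also have "\<dots> = (\<Sum>a\<in>UNIV. \<Sum>b\<in>UNIV. B i a x * B j b x * RF a b k l x)"
    unfolding matrix_mult3_nth Fn[symmetric] Bn[symmetric] B_commute[OF x, of _ j]
    by (simp add: mult_ac)
  finally show ?thesis .
qed

text \<open>The third and fourth derivatives of \<open>u\<close> are totally symmetric. In the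
  second sum of \<open>RF\<close> the exchange of the pairs also interchanges the two summation
  indices, which the symmetry of \<open>B\<close> absorbs.\<close>

lemma RF_pair_swap:
  assumes x: "x \<in> S"
  shows "RF a b k l x = RF k l a b x"
proof -
  have "T k a p x = T a k p x" "T l q b x = T b q l x" for p q
    using T_swap[OF x] by metis+
  moreover have "(\<Sum>p\<in>UNIV. \<Sum>q\<in>UNIV. T l a p x * B p q x * T k q b x)
      = (\<Sum>p\<in>UNIV. \<Sum>q\<in>UNIV. T b k p x * B p q x * T a q l x)"
  proof (subst sum.swap, intro sum.cong refl)
    fix p q
    have "T k p b x = T b k p x" "T l a q x = T a q l x" using T_swap[OF x] by metis+
    then show "T l a q x * B q p x * T k p b x = T b k p x * B p q x * T a q l x"
      by (simp add: B_commute[OF x, of q p])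
  qed
  ultimately show ?thesis unfolding RF_def using Q_pair_swap[OF x, of k l a b] by simp
qed

text \<open>With the same vector in all four slots the two quadratic sums of \<open>RF\<close>
  coincide, hence the factor 2. In this form the curvature is recognized inside the second
  derivative of the density along the flow.\<close>

lemma RF_contract:
  fixes w :: "'n \<Rightarrow> real"
  assumes x: "x \<in> S"
  defines "\<tau> \<equiv> \<lambda>p. \<Sum>m\<in>UNIV. \<Sum>l\<in>UNIV. T p m l x * w m * w l"
  shows "(\<Sum>a\<in>UNIV. \<Sum>b\<in>UNIV. \<Sum>k\<in>UNIV. \<Sum>l\<in>UNIV. RF a b k l x * w a * w b * w k * w l)
    = 2 * (\<Sum>p\<in>UNIV. \<Sum>q\<in>UNIV. \<tau> p * B p q x * \<tau> q)
      - (\<Sum>k\<in>UNIV. \<Sum>l\<in>UNIV. \<Sum>a\<in>UNIV. \<Sum>b\<in>UNIV. Q k l a b x * w k * w l * w a * w b)"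
proof -
  have \<tau>1: "(\<Sum>k\<in>UNIV. \<Sum>a\<in>UNIV. T k a p x * w k * w a) = \<tau> p" for p
    unfolding \<tau>_def
  proof (intro sum.cong refl)
    fix k a
    show "T k a p x * w k * w a = T p k a x * w k * w a"
      using T_swap(2)[OF x, of k a p] T_swap(1)[OF x, of k p a] by simp
  qed
  have \<tau>2: "(\<Sum>l\<in>UNIV. \<Sum>b\<in>UNIV. T l q b x * w l * w b) = \<tau> q" for q
    unfolding \<tau>_def
  proof (intro sum.cong refl)
    fix l b
    show "T l q b x * w l * w b = T q l b x * w l * w b"
      using T_swap(1)[OF x, of l q b] by simp
  qed
  have 1: "(\<Sum>a\<in>UNIV. \<Sum>b\<in>UNIV. \<Sum>k\<in>UNIV. \<Sum>l\<in>UNIV. \<Sum>p\<in>UNIV. \<Sum>q\<in>UNIV. T k a p x * B p q x * T l q b x * w a * w b * w k * w l)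
      = (\<Sum>p\<in>UNIV. \<Sum>q\<in>UNIV. \<tau> p * B p q x * \<tau> q)"
  proof -
    have "\<tau> p * B p q x * \<tau> q = (\<Sum>k\<in>UNIV. \<Sum>a\<in>UNIV. \<Sum>l\<in>UNIV. \<Sum>b\<in>UNIV.
          (T k a p x * w k * w a) * B p q x * (T l q b x * w l * w b))" for p q
    proof -
      have "\<tau> p * B p q x * \<tau> q = (\<Sum>k\<in>UNIV. \<Sum>a\<in>UNIV. (T k a p x * w k * w a) * B p q x * \<tau> q)"
        by (simp only: \<tau>1[symmetric] sum_distrib_right)
      then show ?thesis by (simp only: \<tau>2[symmetric] sum_distrib_left)
    qed
    then have "(\<Sum>p\<in>UNIV. \<Sum>q\<in>UNIV. \<tau> p * B p q x * \<tau> q)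
      = (\<Sum>p\<in>UNIV. \<Sum>q\<in>UNIV. \<Sum>k\<in>UNIV. \<Sum>a\<in>UNIV. \<Sum>l\<in>UNIV. \<Sum>b\<in>UNIV.
          (T k a p x * w k * w a) * B p q x * (T l q b x * w l * w b))"
      by simp
    then show ?thesis
      unfolding sum.cartesian_product UNIV_Times_UNIV
      by (simp only:) (rule sum.reindex_bij_witness[of _ "\<lambda>(p,q,k,a,l,b). (a,b,k,l,p,q)" "\<lambda>(a,b,k,l,p,q). (p,q,k,a,l,b)"]; auto)
  qed
  have 2: "(\<Sum>a\<in>UNIV. \<Sum>b\<in>UNIV. \<Sum>k\<in>UNIV. \<Sum>l\<in>UNIV. \<Sum>p\<in>UNIV. \<Sum>q\<in>UNIV. T l a p x * B p q x * T k q b x * w a * w b * w k * w l)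
      = (\<Sum>p\<in>UNIV. \<Sum>q\<in>UNIV. \<tau> p * B p q x * \<tau> q)"
    unfolding 1[symmetric]
    by (rule sum.cong[OF refl], rule sum.cong[OF refl], subst sum.swap, intro sum.cong refl)
       (simp add: mult_ac)
  have 3: "(\<Sum>k\<in>UNIV. \<Sum>l\<in>UNIV. \<Sum>a\<in>UNIV. \<Sum>b\<in>UNIV. Q k l a b x * w k * w l * w a * w b)
      = (\<Sum>a\<in>UNIV. \<Sum>b\<in>UNIV. \<Sum>k\<in>UNIV. \<Sum>l\<in>UNIV. Q k l a b x * w a * w b * w k * w l)"
    unfolding sum.cartesian_product UNIV_Times_UNIV
    by (rule sum.reindex_bij_witness[of _ "\<lambda>(a,b,k,l). (k,l,a,b)" "\<lambda>(k,l,a,b). (a,b,k,l)"]; auto)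
  show ?thesis
    unfolding 3 using 1 2
    by (simp add: RF_def left_diff_distrib distrib_right sum_distrib_right sum.distrib sum_subtractf)
qed

text \<open>\<open>quadrilinear_form_bound\<close> controls the absolute value of the contraction;
  the lower bound is the half that makes ln \<phi> nearly convex along the flow.\<close>

lemma curvature_estimate:
  assumes x: "x \<in> S" and Rm: "Rm_sq u x \<le> 1"
    and w: "\<And>i. w i = (\<Sum>j\<in>UNIV. B i j x * N $ j)"
  shows "- (\<Sum>i\<in>UNIV. N $ i * w i)\<^sup>2
    \<le> (\<Sum>a\<in>UNIV. \<Sum>b\<in>UNIV. \<Sum>k\<in>UNIV. \<Sum>l\<in>UNIV. RF a b k l x * w a * w b * w k * w l)"
    (is "- ?p\<^sup>2 \<le> ?F")
proof -
  have pos: "(\<Sum>i\<in>UNIV. \<Sum>j\<in>UNIV. v i * B i j x * v j) > 0" if "\<exists>i. v i \<noteq> 0" for v :: "'n \<Rightarrow> real"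
  proof -
    have "0 < (\<chi> i. v i) \<bullet> (matrix_inv (hess u x) *v (\<chi> i. v i))"
      using that by (intro B_pos_def[OF x]) (auto simp: vec_eq_iff)
    then show ?thesis
      by (simp add: inner_vec_def matrix_vector_mult_def hess_inv_entry_def sum_distrib_left mult_ac)
  qed
  have "?F\<^sup>2 \<le> ?p ^ 4 * (\<Sum>i\<in>UNIV. \<Sum>j\<in>UNIV. \<Sum>k\<in>UNIV. \<Sum>l\<in>UNIV.
      iter_pd [k, l] (hess_inv_entry u i j) x * iter_pd [i, j] (hess_inv_entry u k l) x)"
    by (rule quadrilinear_form_bound[where B = "\<lambda>i j. B i j x"])
       (rule B_commute[OF x] pos RF_pair_swap[OF x] w iter_pd2_B[OF x] | assumption)+
  also have "\<dots> \<le> ?p ^ 4 * 1"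
    using Rm unfolding Rm_sq_def by (intro mult_left_mono) auto
  finally have "\<bar>?F\<bar>\<^sup>2 \<le> (?p\<^sup>2)\<^sup>2" by (simp add: power_mult[symmetric])
  then have "\<bar>?F\<bar> \<le> ?p\<^sup>2" by (rule power2_le_imp_le) simp
  then show ?thesis by linarith
qed

section \<open>Convexity, the gradient map and its flow lines\<close>

lemma gradient_has_derivative:
  "x \<in> S \<Longrightarrow> (gradient u has_derivative (*v) (hess u x)) (at x)"
  by (rule smooth_on_gradient_has_derivative[OF smooth])

lemma gradient_tangent_less:
  assumes "convex S" "x \<in> S" "z \<in> S" "x \<noteq> z"
  shows "u x + gradient u x \<bullet> (z - x) < u z"
proof -
  define h where "h = z - x"
  define c where "c t = x + t *\<^sub>R h" for t :: real
  have c: "(c has_vector_derivative h) (at t)" for t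
    unfolding c_def by (auto intro!: derivative_eq_intros)
  have cS: "c t \<in> S" if "0 \<le> t" "t \<le> 1" for t
  proof -
    have "c t = (1 - t) *\<^sub>R x + t *\<^sub>R z" by (simp add: c_def h_def algebra_simps)
    then show ?thesis using assms(1-3) that by (simp add: convexD)
  qed
  have d1: "((\<lambda>t. u (c t)) has_real_derivative gradient u (c t) \<bullet> h) (at t)" if "0 \<le> t" "t \<le> 1" for t
  proof -
    have "gradient u (c t) \<bullet> h = (\<Sum>m\<in>UNIV. h $ m * iter_pd (m # []) u (c t))"
      by (simp add: inner_vec_def iter_pd_def mult.commute)
    then show ?thesis using iter_pd_curve_derivative[OF c cS[OF that], of "[]"] by simp
  qed
  have d2: "((\<lambda>t. gradient u (c t) \<bullet> h) has_real_derivative h \<bullet> (hess u (c t) *v h)) (at t)"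
    if "0 \<le> t" "t \<le> 1" for t
  proof -
    have "((\<lambda>t. gradient u (c t) \<bullet> h) has_derivative (\<lambda>s. (hess u (c t) *v (s *\<^sub>R h)) \<bullet> h)) (at t)"
      using has_derivative_compose[OF c[unfolded has_vector_derivative_def] gradient_has_derivative[OF cS[OF that]]]
      by (rule has_derivative_inner_left)
    moreover have "(\<lambda>s. (hess u (c t) *v (s *\<^sub>R h)) \<bullet> h) = (*) (h \<bullet> (hess u (c t) *v h))"
      by (auto simp: matrix_vector_mult_scaleR inner_commute)
    ultimately show ?thesis by (simp add: has_field_derivative_def)
  qed
  obtain t where t: "0 < t" "t < 1" "u (c 1) - u (c 0) = (1 - 0) * (gradient u (c t) \<bullet> h)"
    using MVT2[of 0 1 "\<lambda>t. u (c t)" "\<lambda>t. gradient u (c t) \<bullet> h"] d1 by auto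
  obtain r where r: "0 < r" "r < t"
    "gradient u (c t) \<bullet> h - gradient u (c 0) \<bullet> h = (t - 0) * (h \<bullet> (hess u (c r) *v h))"
    using MVT2[OF t(1), of "\<lambda>t. gradient u (c t) \<bullet> h" "\<lambda>t. h \<bullet> (hess u (c t) *v h)"] d2 t(2) by auto
  have "h \<noteq> 0" using assms(4) by (simp add: h_def)
  then have "0 < h \<bullet> (hess u (c r) *v h)" using r t cS[of r] by (intro pos_def) auto
  then have "gradient u (c 0) \<bullet> h < gradient u (c t) \<bullet> h" using r(3) t(1)
    by (metis diff_gt_0_iff_gt diff_zero mult_pos_pos)
  moreover have "c 0 = x" "c 1 = z" by (auto simp: c_def h_def)
  ultimately show ?thesis using t(3) by (simp add: h_def)
qed

lemma gradient_tangent_le: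
  "convex S \<Longrightarrow> x \<in> S \<Longrightarrow> z \<in> S \<Longrightarrow> u x + gradient u x \<bullet> (z - x) \<le> u z"
  using gradient_tangent_less[of x z] by (cases "x = z") auto

lemma inj_on_gradient:
  assumes "convex S"
  shows "inj_on (gradient u) S"
proof (rule inj_onI)
  fix x z assume xz: "x \<in> S" "z \<in> S" "gradient u x = gradient u z"
  show "x = z"
  proof (rule ccontr)
    assume "x \<noteq> z"
    then show False
      using gradient_tangent_less[OF assms xz(1,2)] gradient_tangent_less[OF assms xz(2,1)] xz(3)
      by (simp add: inner_diff)
  qed
qed

lemma convex_on_S:
  assumes "convex S"
  shows "convex_on S u"
proof (rule convex_onI)
  fix t x z assume t: "0 < t" "t < (1::real)" and xz: "x \<in> S" "z \<in> S"
  define m where "m = (1 - t) *\<^sub>R x + t *\<^sub>R z"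
  have m: "m \<in> S" using t xz assms by (simp add: m_def convexD)
  have "(1 - t) * (u m + gradient u m \<bullet> (x - m)) + t * (u m + gradient u m \<bullet> (z - m)) \<le> (1 - t) * u x + t * u z"
    using t gradient_tangent_le[OF assms m] xz by (intro add_mono mult_left_mono) auto
  moreover have "(1 - t) * (u m + gradient u m \<bullet> (x - m)) + t * (u m + gradient u m \<bullet> (z - m))
      = u m + gradient u m \<bullet> ((1 - t) *\<^sub>R (x - m) + t *\<^sub>R (z - m))"
    by (simp add: inner_add_right algebra_simps)
  moreover have "(1 - t) *\<^sub>R (x - m) + t *\<^sub>R (z - m) = 0"
    by (simp add: m_def algebra_simps)
  ultimately show "u ((1 - t) *\<^sub>R x + t *\<^sub>R z) \<le> (1 - t) * u x + t * u z"
    by (simp add: m_def)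
qed (use assms in auto)

text \<open>The gradient map is injective, so \<open>\<gamma>\<close> is a straight line followed by
  the inverse of the gradient map, and the inverse function theorem differentiates that
  inverse.\<close>

lemma gradient_flow_derivative:
  assumes "convex S" and \<gamma>: "\<And>s::real. \<gamma> s \<in> S" "\<And>s. gradient u (\<gamma> s) = \<xi> - s *\<^sub>R N"
  shows "(\<gamma> has_vector_derivative - (matrix_inv (hess u (\<gamma> s)) *v N)) (at s)"
proof -
  define G where "G = inv_into S (gradient u)"
  have G: "G (gradient u x) = x" if "x \<in> S" for x
    unfolding G_def using inj_on_gradient[OF assms(1)] that by (rule inv_into_f_f)
  have "(G has_derivative (*v) (matrix_inv (hess u (\<gamma> s)))) (at (gradient u (\<gamma> s)))"
  proof (rule has_derivative_inverse_strong[where f = "gradient u" and x = "\<gamma> s" and S = S and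
        f' = "(*v) (hess u (\<gamma> s))"])
    show "continuous_on S (gradient u)"
      by (rule has_derivative_continuous_on[OF has_derivative_at_withinI[OF gradient_has_derivative]])
    show "(*v) (hess u (\<gamma> s)) \<circ> (*v) (matrix_inv (hess u (\<gamma> s))) = id"
      by (simp add: fun_eq_iff matrix_vector_mul_assoc hess_invertible[OF \<gamma>(1)])
  qed (rule open_S \<gamma>(1) G gradient_has_derivative | assumption)+
  then have "((\<lambda>s. G (\<xi> - s *\<^sub>R N)) has_derivative (\<lambda>t. matrix_inv (hess u (\<gamma> s)) *v (- (t *\<^sub>R N)))) (at s)"
    unfolding \<gamma>(2)
    by (intro has_derivative_compose[where f = "\<lambda>s. \<xi> - s *\<^sub>R N" and g = G])
       (auto intro!: derivative_eq_intros)
  moreover have "(\<lambda>s. G (\<xi> - s *\<^sub>R N)) = \<gamma>"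
    using G[OF \<gamma>(1)] unfolding \<gamma>(2) by auto
  moreover have "(\<lambda>t. matrix_inv (hess u (\<gamma> s)) *v (- (t *\<^sub>R N))) = (\<lambda>t. t *\<^sub>R - (matrix_inv (hess u (\<gamma> s)) *v N))"
  proof
    fix t :: real
    have "- (t *\<^sub>R N) = (- t) *\<^sub>R N" by simp
    then show "matrix_inv (hess u (\<gamma> s)) *v (- (t *\<^sub>R N)) = t *\<^sub>R - (matrix_inv (hess u (\<gamma> s)) *v N)"
      by (simp only: matrix_vector_mult_scaleR) simp
  qed
  ultimately show ?thesis by (simp add: has_vector_derivative_def)
qed

text \<open>In logarithmic coordinates \<open>s \<mapsto> \<xi> - s N\<close> is a real slice of a holomorphic curve,
  on which the metric has area density \<open>\<phi>\<close>; the curvature of a complex submanifold is at most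
  the ambient one.\<close>

lemma gradient_flow_density:
  assumes "convex S" and \<gamma>: "\<And>s::real. \<gamma> s \<in> S" "\<And>s. gradient u (\<gamma> s) = \<xi> - s *\<^sub>R N"
    and Rm: "\<And>x. x \<in> S \<Longrightarrow> Rm_sq u x \<le> 1" and N: "N \<noteq> 0"
  obtains \<phi> \<phi>' \<phi>'' :: "real \<Rightarrow> real"
  where "\<And>s. \<phi> s = N \<bullet> (matrix_inv (hess u (\<gamma> s)) *v N)"
    and "\<And>s. \<phi> s > 0"
    and "\<And>s. (\<phi> has_real_derivative \<phi>' s) (at s)"
    and "\<And>s. (\<phi>' has_real_derivative \<phi>'' s) (at s)"
    and "\<And>s. (\<phi>' s)\<^sup>2 - \<phi> s ^ 3 \<le> \<phi>'' s * \<phi> s"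
proof -
  \<comment> \<open>\<open>w\<close> is \<open>N\<close> with its index raised and equals minus the
    velocity of \<open>\<gamma>\<close>; \<open>\<tau>\<close> is the third derivative of
    \<open>u\<close> contracted twice with \<open>w\<close>. The computation gives w' = B \<tau> and
    \<phi>' = <w, \<tau>>.\<close>
  define w where "w i s = (\<Sum>j\<in>UNIV. B i j (\<gamma> s) * N $ j)" for i s
  define \<tau> where "\<tau> p s = (\<Sum>m\<in>UNIV. \<Sum>l\<in>UNIV. T p m l (\<gamma> s) * w m s * w l s)" for p s
  define w' where "w' i s = (\<Sum>k\<in>UNIV. B i k (\<gamma> s) * \<tau> k s)" for i s
  define \<tau>' where "\<tau>' p s = (\<Sum>m\<in>UNIV. \<Sum>l\<in>UNIV. (- (\<Sum>k\<in>UNIV. w k s * Q k p m l (\<gamma> s)) * w m s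
      + w' m s * T p m l (\<gamma> s)) * w l s + w' l s * (T p m l (\<gamma> s) * w m s))" for p s
  have wvec: "(matrix_inv (hess u (\<gamma> s)) *v N) $ i = w i s" for i s
    by (simp add: matrix_vector_mult_def w_def hess_inv_entry_def)
  have \<gamma>': "(\<gamma> has_vector_derivative - (\<chi> i. w i s)) (at s)" for s
  proof -
    have "matrix_inv (hess u (\<gamma> s)) *v N = (\<chi> i. w i s)" by (simp add: vec_eq_iff wvec)
    then show ?thesis using gradient_flow_derivative[OF assms(1) \<gamma>, of s] by simp
  qed
  have iter': "((\<lambda>s. iter_pd js u (\<gamma> s)) has_real_derivative - (\<Sum>k\<in>UNIV. w k s * iter_pd (k # js) u (\<gamma> s))) (at s)" for js s
    using iter_pd_curve_derivative[OF \<gamma>' \<gamma>(1), of js s] by (simp add: sum_negf)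
  have w': "((\<lambda>s. w i s) has_real_derivative w' i s) (at s)" for i s
  proof -
    have wl: "(\<Sum>j\<in>UNIV. B l j (\<gamma> s) * N $ j) = w l s" for l by (simp add: w_def)
    have "((\<lambda>s. w i s) has_real_derivative (\<Sum>j\<in>UNIV. (\<Sum>m\<in>UNIV. - w m s * DB m i j (\<gamma> s)) * N $ j)) (at s)"
      unfolding w_def[of i]
      using B_curve_derivative[OF \<gamma>' \<gamma>(1), of i _ s] by (intro DERIV_sum DERIV_cmult_right) simp
    also have "(\<Sum>j\<in>UNIV. (\<Sum>m\<in>UNIV. - w m s * DB m i j (\<gamma> s)) * N $ j)
       = (\<Sum>j\<in>UNIV. \<Sum>m\<in>UNIV. \<Sum>k\<in>UNIV. \<Sum>l\<in>UNIV. w m s * (B i k (\<gamma> s) * T m k l (\<gamma> s) * (B l j (\<gamma> s) * N $ j)))"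
      by (simp add: DB_def sum_distrib_left sum_distrib_right sum_negf mult_ac)
    also have "\<dots> = (\<Sum>k\<in>UNIV. \<Sum>m\<in>UNIV. \<Sum>l\<in>UNIV. \<Sum>j\<in>UNIV. w m s * (B i k (\<gamma> s) * T m k l (\<gamma> s) * (B l j (\<gamma> s) * N $ j)))"
      unfolding sum.cartesian_product UNIV_Times_UNIV
      by (rule sum.reindex_bij_witness[of _ "\<lambda>(k,m,l,j). (j,m,k,l)" "\<lambda>(j,m,k,l). (k,m,l,j)"]; auto)
    also have "\<dots> = (\<Sum>k\<in>UNIV. \<Sum>m\<in>UNIV. \<Sum>l\<in>UNIV. w m s * (B i k (\<gamma> s) * T m k l (\<gamma> s) * w l s))"
      by (simp only: sum_distrib_left[symmetric] wl)
    also have "\<dots> = w' i s"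
      unfolding w'_def \<tau>_def sum_distrib_left
    proof (intro sum.cong refl)
      fix k m l
      show "w m s * (B i k (\<gamma> s) * T m k l (\<gamma> s) * w l s) = B i k (\<gamma> s) * (T k m l (\<gamma> s) * w m s * w l s)"
        using T_swap(1)[OF \<gamma>(1), of m k l s] by simp
    qed
    finally show ?thesis .
  qed
  have \<tau>': "((\<lambda>s. \<tau> p s) has_real_derivative \<tau>' p s) (at s)" for p s
    unfolding \<tau>_def \<tau>'_def by (intro DERIV_sum DERIV_mult iter' w')
  have Bsym: "(\<Sum>i\<in>UNIV. \<Sum>k\<in>UNIV. a i * (B i k (\<gamma> s) * b k)) = (\<Sum>k\<in>UNIV. (\<Sum>i\<in>UNIV. B k i (\<gamma> s) * a i) * b k)" for a b s
    by (subst sum.swap) (simp add: sum_distrib_right sum_distrib_left B_commute[OF \<gamma>(1)] mult_ac)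
  define \<phi> where "\<phi> s = (\<Sum>i\<in>UNIV. N $ i * w i s)" for s
  define \<phi>' where "\<phi>' s = (\<Sum>k\<in>UNIV. w k s * \<tau> k s)" for s
  define \<phi>'' where "\<phi>'' s = (\<Sum>k\<in>UNIV. w' k s * \<tau> k s + \<tau>' k s * w k s)" for s
  have \<phi>_eq: "\<phi> s = N \<bullet> (matrix_inv (hess u (\<gamma> s)) *v N)" for s
    by (simp add: \<phi>_def inner_vec_def wvec)
  have pos: "\<phi> s > 0" for s unfolding \<phi>_eq by (rule B_pos_def[OF \<gamma>(1) N])
  have d1: "(\<phi> has_real_derivative \<phi>' s) (at s)" for s
  proof -
    have "(\<phi> has_real_derivative (\<Sum>i\<in>UNIV. N $ i * w' i s)) (at s)"
      unfolding \<phi>_def by (intro DERIV_sum DERIV_cmult w')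
    moreover have "(\<Sum>i\<in>UNIV. N $ i * w' i s) = \<phi>' s"
      unfolding w'_def sum_distrib_left Bsym \<phi>'_def w_def ..
    ultimately show ?thesis by simp
  qed
  have d2: "(\<phi>' has_real_derivative \<phi>'' s) (at s)" for s
    unfolding \<phi>'_def \<phi>''_def by (intro DERIV_sum DERIV_mult w' \<tau>')
  define P where "P s = (\<Sum>p\<in>UNIV. \<Sum>q\<in>UNIV. \<tau> p s * B p q (\<gamma> s) * \<tau> q s)" for s
  define Qw where "Qw s = (\<Sum>k\<in>UNIV. \<Sum>l\<in>UNIV. \<Sum>a\<in>UNIV. \<Sum>b\<in>UNIV. Q k l a b (\<gamma> s) * w k s * w l s * w a s * w b s)" for s
  have P: "(\<Sum>k\<in>UNIV. w' k s * \<tau> k s) = P s" for s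
    unfolding P_def w'_def by (simp add: sum_distrib_right sum_distrib_left B_commute[OF \<gamma>(1)] mult_ac)
  \<comment> \<open>Differentiating either copy of \<open>w\<close> inside \<open>\<tau>\<close>
    contributes \<open>P\<close>; differentiating the third derivatives along -w contributes
    \<open>- Qw\<close>.\<close>
  have "(\<Sum>p\<in>UNIV. \<tau>' p s * w p s) = 2 * P s - Qw s" for s
  proof -
    have 1: "(\<Sum>p\<in>UNIV. \<Sum>m\<in>UNIV. \<Sum>l\<in>UNIV. w' m s * T p m l (\<gamma> s) * w l s * w p s) = P s"
      unfolding P[symmetric]
    proof (rule trans[OF sum.swap], intro sum.cong refl)
      fix m
      show "(\<Sum>p\<in>UNIV. \<Sum>l\<in>UNIV. w' m s * T p m l (\<gamma> s) * w l s * w p s) = w' m s * \<tau> m s"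
        unfolding \<tau>_def sum_distrib_left
      proof (intro sum.cong refl)
        fix p l
        show "w' m s * T p m l (\<gamma> s) * w l s * w p s = w' m s * (T m p l (\<gamma> s) * w p s * w l s)"
          using T_swap(1)[OF \<gamma>(1), of p m l s] by simp
      qed
    qed
    have "(\<Sum>p\<in>UNIV. \<Sum>m\<in>UNIV. \<Sum>l\<in>UNIV. w' l s * (T p m l (\<gamma> s) * w m s) * w p s)
       = (\<Sum>p\<in>UNIV. \<Sum>m\<in>UNIV. \<Sum>l\<in>UNIV. w' m s * T p m l (\<gamma> s) * w l s * w p s)"
    proof (rule sum.cong[OF refl], subst sum.swap, intro sum.cong refl)
      fix p l m
      show "w' l s * (T p m l (\<gamma> s) * w m s) * w p s = w' l s * T p l m (\<gamma> s) * w m s * w p s"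
        using T_swap(2)[OF \<gamma>(1), of p m l s] by simp
    qed
    with 1 have 2: "(\<Sum>p\<in>UNIV. \<Sum>m\<in>UNIV. \<Sum>l\<in>UNIV. w' l s * (T p m l (\<gamma> s) * w m s) * w p s) = P s" by simp
    have "(\<Sum>p\<in>UNIV. \<Sum>m\<in>UNIV. \<Sum>l\<in>UNIV. \<Sum>k\<in>UNIV. w k s * Q k p m l (\<gamma> s) * w m s * w l s * w p s)
      = Qw s"
      unfolding Qw_def sum.cartesian_product UNIV_Times_UNIV
      by (rule sum.reindex_bij_witness[of _ "\<lambda>(k,p,m,l). (p,m,l,k)" "\<lambda>(p,m,l,k). (k,p,m,l)"]; auto)
    then have 3: "(\<Sum>p\<in>UNIV. \<Sum>m\<in>UNIV. \<Sum>l\<in>UNIV. (\<Sum>k\<in>UNIV. w k s * Q k p m l (\<gamma> s)) * w m s * w l s * w p s) = Qw s"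
      by (simp only: sum_distrib_right)
    define X where "X p m l = (\<Sum>k\<in>UNIV. w k s * Q k p m l (\<gamma> s))" for p m l
    have "(\<Sum>p\<in>UNIV. \<tau>' p s * w p s) =
        (\<Sum>p\<in>UNIV. \<Sum>m\<in>UNIV. \<Sum>l\<in>UNIV. w' m s * T p m l (\<gamma> s) * w l s * w p s)
      + (\<Sum>p\<in>UNIV. \<Sum>m\<in>UNIV. \<Sum>l\<in>UNIV. w' l s * (T p m l (\<gamma> s) * w m s) * w p s)
      - (\<Sum>p\<in>UNIV. \<Sum>m\<in>UNIV. \<Sum>l\<in>UNIV. X p m l * w m s * w l s * w p s)"
      unfolding \<tau>'_def X_def[symmetric] sum_distrib_right sum.distrib[symmetric] sum_subtractf[symmetric]
      by (intro sum.cong refl) (simp add: algebra_simps)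
    then show ?thesis using 1 2 3 by (simp add: X_def)
  qed
  then have \<phi>'': "\<phi>'' s = P s + (2 * P s - Qw s)" for s
    unfolding \<phi>''_def sum.distrib P by simp
  \<comment> \<open>\<open>2 * P s - Qw s\<close> is the contracted curvature, and
    \<open>\<phi>''\<close> exceeds it by \<open>P\<close>. That excess pays for the term
    \<open>(\<phi>')\<^sup>2\<close> through Cauchy-Schwarz; the defect in Cauchy-Schwarz is
    geometrically the second fundamental form of the curve.\<close>
  have curv: "- (\<phi> s)\<^sup>2 \<le> 2 * P s - Qw s" for s
    using curvature_estimate[OF \<gamma>(1) Rm[OF \<gamma>(1)], of "\<lambda>i. w i s" s N] w_def
      RF_contract[OF \<gamma>(1), of s "\<lambda>i. w i s"]
    unfolding \<phi>_def P_def Qw_def \<tau>_def by simp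
  have cs: "(\<phi>' s)\<^sup>2 \<le> P s * \<phi> s" for s
  proof -
    let ?B = "matrix_inv (hess u (\<gamma> s))"
    have sym: "x \<bullet> (?B *v y) = y \<bullet> (?B *v x)" for x y
      by (metis dot_lmul_matrix inner_commute transpose_hess_inv[OF \<gamma>(1)] transpose_matrix_vector)
    have "0 \<le> x \<bullet> (?B *v x)" for x
      using B_pos_def[OF \<gamma>(1), of x s] by (cases "x = 0") auto
    then have "((\<chi> i. \<tau> i s) \<bullet> (?B *v N))\<^sup>2 \<le> ((\<chi> i. \<tau> i s) \<bullet> (?B *v (\<chi> i. \<tau> i s))) * (N \<bullet> (?B *v N))"
      using pos[of s] unfolding \<phi>_eq by (intro posdef_cauchy_schwarz sym)
    moreover have "(\<chi> i. \<tau> i s) \<bullet> (?B *v N) = \<phi>' s"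
      by (simp add: inner_vec_def wvec \<phi>'_def mult.commute)
    moreover have "(\<chi> i. \<tau> i s) \<bullet> (?B *v (\<chi> i. \<tau> i s)) = P s"
      by (simp add: inner_vec_def matrix_vector_mult_def P_def hess_inv_entry_def sum_distrib_left mult_ac)
    ultimately show ?thesis by (simp add: \<phi>_eq)
  qed
  have "(\<phi>' s)\<^sup>2 - \<phi> s ^ 3 \<le> \<phi>'' s * \<phi> s" for s
  proof -
    have "- (\<phi> s)\<^sup>2 * \<phi> s \<le> (2 * P s - Qw s) * \<phi> s"
      using curv[of s] pos[of s] by (intro mult_right_mono) auto
    then show ?thesis using cs[of s]
      by (simp add: \<phi>'' power2_eq_square power3_eq_cube algebra_simps)
  qed
  with \<phi>_eq pos d1 d2 show ?thesis using that by blast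
qed

text \<open>The height at \<open>v\<close> of the tangent plane at \<open>\<gamma> s\<close> is
  insensitive to first order to the motion of the base point, so it changes only through the slope,
  at rate \<open>y = N \<bullet> (\<gamma> s - v)\<close>. Since
  \<open>y \<le> \<phi> = - y'\<close> by \<open>moment_le_density\<close>, the height plus
  \<open>y\<close> is nonincreasing.\<close>

lemma gradient_flow_estimate:
  assumes "convex S" and \<gamma>: "\<And>s::real. \<gamma> s \<in> S" "\<And>s. gradient u (\<gamma> s) = \<xi> - s *\<^sub>R N"
    and Rm: "\<And>x. x \<in> S \<Longrightarrow> Rm_sq u x \<le> 1" and N: "N \<noteq> 0"
    and nonneg: "\<And>s. s \<ge> 0 \<Longrightarrow> 0 \<le> N \<bullet> (\<gamma> s - v)"
    and decay: "\<And>s. s \<ge> s0 \<Longrightarrow> N \<bullet> (\<gamma> s - v) \<le> C * exp (- 2 * s)"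
    and small: "N \<bullet> (\<gamma> 0 - v) \<le> 1 / 2" and s: "s \<ge> 0"
  shows "u (\<gamma> s) + (\<xi> - s *\<^sub>R N) \<bullet> (v - \<gamma> s) + N \<bullet> (\<gamma> s - v)
    \<le> u (\<gamma> 0) + \<xi> \<bullet> (v - \<gamma> 0) + N \<bullet> (\<gamma> 0 - v)"
proof -
  obtain \<phi> \<phi>' \<phi>'' where \<phi>: "\<And>s. \<phi> s = N \<bullet> (matrix_inv (hess u (\<gamma> s)) *v N)"
    "\<And>s. \<phi> s > 0"
    "\<And>s. (\<phi> has_real_derivative \<phi>' s) (at s)"
    "\<And>s. (\<phi>' has_real_derivative \<phi>'' s) (at s)"
    "\<And>s. (\<phi>' s)\<^sup>2 - \<phi> s ^ 3 \<le> \<phi>'' s * \<phi> s"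
    by (rule gradient_flow_density[OF assms(1) \<gamma> _ N]) (erule Rm, rule that, assumption+)
  let ?w = "\<lambda>s. matrix_inv (hess u (\<gamma> s)) *v N"
  have \<gamma>': "(\<gamma> has_derivative (\<lambda>t. t *\<^sub>R - ?w s)) (at s)" for s
    using gradient_flow_derivative[OF assms(1) \<gamma>, of s] by (simp add: has_vector_derivative_def)
  define y where "y s = N \<bullet> (\<gamma> s - v)" for s
  have y': "(y has_real_derivative - \<phi> s) (at s)" for s
    unfolding has_field_derivative_def y_def
    by (rule derivative_eq_intros \<gamma>' refl)+ (auto simp: \<phi>(1))
  have y\<phi>: "y s \<le> \<phi> s" if "s \<ge> 0" for s
  proof (rule moment_le_density[where y = y and \<phi> = \<phi> and s = s and \<phi>' = \<phi>' and \<phi>'' = \<phi>'' and C = C and ?s0.0 = s0])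
    show "y s \<le> C * exp (- 2 * s)" if "s \<ge> s0" for s
      unfolding y_def by (rule decay[OF that])
    show "y s \<ge> 0" if "s \<ge> 0" for s unfolding y_def by (rule nonneg[OF that])
    show "y 0 \<le> 1 / 2" unfolding y_def by (rule small)
  qed (rule y' \<phi>(2-) that)+
  define E where "E s = u (\<gamma> s) + (\<xi> - s *\<^sub>R N) \<bullet> (v - \<gamma> s)" for s
  have E': "(E has_real_derivative y s) (at s)" for s
  proof -
    have du: "((\<lambda>s. u (\<gamma> s)) has_derivative (\<lambda>t. (\<xi> - s *\<^sub>R N) \<bullet> (t *\<^sub>R - ?w s))) (at s)"
      using has_derivative_compose[OF \<gamma>' smooth_on_has_derivative_gradient[OF smooth \<gamma>(1)], of s]
      by (simp add: \<gamma>(2))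
    show ?thesis
      unfolding has_field_derivative_def E_def
      by (rule derivative_eq_intros du \<gamma>' refl)+ (auto simp: y_def inner_diff algebra_simps)
  qed
  have "((\<lambda>s. E s + y s) has_real_derivative y s + - \<phi> s) (at s)" for s
    by (rule DERIV_add[OF E' y'])
  then have "E s + y s \<le> E 0 + y 0"
    by (rule nonincreasing_on_ray[where a = 0]) (use y\<phi> s in auto)
  then show ?thesis by (simp add: E_def y_def)
qed

end

section \<open>Symplectic potentials\<close>

lemma polytope_of_eq: "polytope_of nv c d = (\<Inter>i\<in>{..<d}. {x. nv i \<bullet> x \<ge> - c i})"
proof -
  have "- c i \<le> nv i \<bullet> x \<longleftrightarrow> 0 \<le> nv i \<bullet> x + c i" for i x by linarith
  then show ?thesis by (auto simp: polytope_of_def aff_fun_def)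
qed

lemma closed_polytope_of: "closed (polytope_of nv c d)"
  unfolding polytope_of_eq by (intro closed_INT ballI closed_halfspace_ge)

lemma polyhedron_polytope_of: "polyhedron (polytope_of nv c d)"
  unfolding polytope_of_eq by (intro polyhedron_Inter) (auto intro: polyhedron_halfspace_ge)

lemma convex_polytope_of: "convex (polytope_of nv c d)"
  by (rule polyhedron_imp_convex[OF polyhedron_polytope_of])

lemma aff_fun_affine: "aff_fun nv c i (x + t *\<^sub>R v) = aff_fun nv c i x + t * (nv i \<bullet> v)"
  by (simp add: aff_fun_def algebra_simps)

lemma aff_fun_convex_comb:
  "aff_fun nv c i ((1 - t) *\<^sub>R x + t *\<^sub>R y) = (1 - t) * aff_fun nv c i x + t * aff_fun nv c i y"
  by (simp add: aff_fun_def inner_add_right algebra_simps)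

lemma isCont_aff_fun: "isCont (aff_fun nv c i) x"
  unfolding aff_fun_def[abs_def] by (intro continuous_intros)

lemma continuous_on_aff_fun: "continuous_on A (aff_fun nv c i)"
  by (simp add: continuous_at_imp_continuous_on isCont_aff_fun)

lemma aff_fun_has_derivative: "(aff_fun nv c i has_derivative (\<lambda>h. nv i \<bullet> h)) (at x)"
  unfolding aff_fun_def[abs_def] by (auto intro!: derivative_eq_intros)

text \<open>The zero vector is twice itself, which primitivity forbids.\<close>

lemma primitive_int_vec_nonzero: "primitive_int_vec z \<Longrightarrow> z \<noteq> 0"
  unfolding primitive_int_vec_def
  by (metis abs_numeral numeral_eq_one_iff scaleR_zero_right semiring_norm(83))

lemma interior_polytope_of:
  assumes "\<And>i. i < d \<Longrightarrow> nv i \<noteq> 0"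
  shows "interior (polytope_of nv c d) = {x. \<forall>i<d. 0 < aff_fun nv c i x}"
proof (intro equalityI subsetI)
  fix x assume x: "x \<in> interior (polytope_of nv c d)"
  then obtain e where e: "e > 0" "cball x e \<subseteq> polytope_of nv c d"
    using mem_interior_cball by blast
  have "0 < aff_fun nv c i x" if "i < d" for i
  proof -
    define v where "v = nv i /\<^sub>R norm (nv i)"
    have "x + (- e) *\<^sub>R v \<in> cball x e" using e assms[OF that] by (simp add: v_def dist_norm)
    then have "0 \<le> aff_fun nv c i (x + (- e) *\<^sub>R v)"
      using e(2) that unfolding polytope_of_def by blast
    then have "0 \<le> aff_fun nv c i x - e * (nv i \<bullet> v)" unfolding aff_fun_affine by simp
    moreover have "nv i \<bullet> v > 0" using assms[OF that] by (simp add: v_def)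
    ultimately show ?thesis using e(1) by (smt (verit) mult_pos_pos)
  qed
  then show "x \<in> {x. \<forall>i<d. 0 < aff_fun nv c i x}" by simp
next
  fix x assume x: "x \<in> {x. \<forall>i<d. 0 < aff_fun nv c i x}"
  have "open (\<Inter>i\<in>{..<d}. {x. 0 < aff_fun nv c i x})"
    by (intro open_INT ballI open_Collect_less continuous_on_const continuous_on_aff_fun) auto
  then show "x \<in> interior (polytope_of nv c d)"
    using x by (intro interiorI[of "\<Inter>i\<in>{..<d}. {x. 0 < aff_fun nv c i x}"])
      (auto simp: polytope_of_def less_imp_le)
qed

lemma continuous_on_x_ln_x: "continuous_on {0..} (\<lambda>x::real. x * ln x)"
proof (rule continuous_on_eq_continuous_within[THEN iffD2], intro ballI)
  fix x :: real assume x: "x \<in> {0..}"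
  show "continuous (at x within {0..}) (\<lambda>x. x * ln x)"
  proof (cases "x = 0")
    case True
    have "((\<lambda>x::real. x * ln x) \<longlongrightarrow> 0) (at_right 0)" by real_asymp
    then have "((\<lambda>x::real. x * ln x) \<longlongrightarrow> 0) (at 0 within {0..})"
      by (simp add: at_within_Ici_at_right)
    then show ?thesis using True by (simp add: continuous_within)
  next
    case False
    then show ?thesis using x by (intro continuous_intros continuous_within_ln) auto
  qed
qed

locale toric_potential =
  fixes nv :: "nat \<Rightarrow> real^'n" and c :: "nat \<Rightarrow> real" and d :: nat and u :: "real^'n \<Rightarrow> real"
  assumes delz: "delzant nv c d" and pot: "symplectic_potential nv c d u"
begin

abbreviation P :: "(real^'n) set" where "P \<equiv> polytope_of nv c d"

abbreviation l :: "nat \<Rightarrow> real^'n \<Rightarrow> real" where "l \<equiv> aff_fun nv c"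

lemma int_ne: "interior P \<noteq> {}"
  using delz unfolding delzant_def by blast

lemma compact_P: "compact P"
  using delz closed_polytope_of unfolding delzant_def compact_eq_bounded_closed by blast

lemma nv_nonzero: "i < d \<Longrightarrow> nv i \<noteq> 0"
  using delz primitive_int_vec_nonzero unfolding delzant_def by blast

lemma interior_P: "interior P = {x. \<forall>i<d. 0 < l i x}"
  by (rule interior_polytope_of[OF nv_nonzero])

lemma l_nonneg: "x \<in> P \<Longrightarrow> i < d \<Longrightarrow> 0 \<le> l i x"
  by (simp add: polytope_of_def)

lemma l_pos: "x \<in> interior P \<Longrightarrow> i < d \<Longrightarrow> 0 < l i x"
  by (simp add: interior_P)

lemma in_P: "x \<in> interior P \<Longrightarrow> x \<in> P"
  using interior_subset by blast

lemma smooth_u: "smooth_on (interior P) u"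
  using pot unfolding symplectic_potential_def by blast

lemma ex_smooth_part:
  obtains W g where "P \<subseteq> W" "smooth_on W g"
    "\<And>x. x \<in> P \<Longrightarrow> u x = (1/2) * (\<Sum>i<d. l i x * ln (l i x)) + g x"
proof -
  obtain f where f: "smooth_on_closed P f"
    "\<forall>x\<in>P. u x = (1/2) * (\<Sum>i<d. l i x * ln (l i x)) + f x"
    using pot unfolding symplectic_potential_def by blast
  obtain W g where "P \<subseteq> W" "smooth_on W g" "\<forall>x\<in>P. g x = f x"
    using f(1) unfolding smooth_on_closed_def by blast
  then show ?thesis using that[of W g] f(2) by simp
qed

section \<open>Boundary behaviour and convexity of the potential\<close>

lemma continuous_on_u: "continuous_on P u"
proof -
  obtain W g where W: "P \<subseteq> W" "smooth_on W g"
    "\<And>x. x \<in> P \<Longrightarrow> u x = (1/2) * (\<Sum>i<d. l i x * ln (l i x)) + g x"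
    by (rule ex_smooth_part) (rule that, assumption+)
  have "continuous_on P (\<lambda>x. l i x * ln (l i x))" if "i < d" for i
    using continuous_on_compose2[OF continuous_on_x_ln_x continuous_on_aff_fun[of P nv c i]]
      l_nonneg that by fastforce
  then have "continuous_on P (\<lambda>x. \<Sum>i<d. l i x * ln (l i x))"
    by (intro continuous_on_sum) auto
  then have "continuous_on P (\<lambda>x. (1/2) * (\<Sum>i<d. l i x * ln (l i x)) + g x)"
    by (intro continuous_on_add continuous_on_mult_left
        continuous_on_subset[OF smooth_on_imp_continuous_on[OF W(2)] W(1)])
  then show ?thesis by (rule continuous_on_eq) (simp add: W(3))
qed

text \<open>Only the logarithms of the facets through \<open>b\<close> are singular there; the
  others and the smooth part are differentiable at \<open>b\<close> and cost a linear error.\<close>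

lemma local_expansion:
  assumes b: "b \<in> P"
  obtains C \<delta> where "C \<ge> 0" "\<delta> > 0"
    "\<And>x. x \<in> P \<Longrightarrow> norm (x - b) < \<delta> \<Longrightarrow>
      \<bar>u x - u b - (1/2) * (\<Sum>i | i < d \<and> l i b = 0. l i x * ln (l i x))\<bar> \<le> C * norm (x - b)"
proof -
  obtain W g where W: "P \<subseteq> W" "smooth_on W g"
    "\<And>x. x \<in> P \<Longrightarrow> u x = (1/2) * (\<Sum>i<d. l i x * ln (l i x)) + g x"
    by (rule ex_smooth_part) (rule that, assumption+)
  define I where "I = {i. i < d \<and> l i b = 0}"
  have I: "I \<subseteq> {..<d}" by (auto simp: I_def)
  define k where "k x = (1/2) * (\<Sum>i\<in>{..<d} - I. l i x * ln (l i x)) + g x" for x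
  have u: "u x = (1/2) * (\<Sum>i\<in>I. l i x * ln (l i x)) + k x" if "x \<in> P" for x
    unfolding W(3)[OF that] k_def using sum.subset_diff[OF I, of "\<lambda>i. l i x * ln (l i x)"]
    by (simp add: algebra_simps)
  \<comment> \<open>The singular terms drop out at \<open>b\<close> because the factor
    \<open>l i b\<close> in front of the logarithm is 0.\<close>
  have ub: "u b = k b" unfolding u[OF b] by (simp add: I_def)
  have "(\<lambda>x. l i x * ln (l i x)) differentiable (at b)" if "i \<in> {..<d} - I" for i
  proof -
    have "l i b > 0" using l_nonneg[OF b, of i] that by (auto simp: I_def)
    then have "((\<lambda>x. l i x * ln (l i x)) has_derivative
        (\<lambda>h. l i b * ((nv i \<bullet> h) * inverse (l i b)) + (nv i \<bullet> h) * ln (l i b))) (at b)"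
      by (intro has_derivative_mult has_derivative_ln aff_fun_has_derivative) 
    then show ?thesis by (rule differentiableI)
  qed
  then have "(\<lambda>x. \<Sum>i\<in>{..<d} - I. l i x * ln (l i x)) differentiable (at b)"
    by (intro differentiable_sum) auto
  then have "(\<lambda>x. (1/2) * (\<Sum>i\<in>{..<d} - I. l i x * ln (l i x))) differentiable (at b)"
    by (rule differentiable_mult[OF differentiable_const])
  moreover have "g differentiable (at b)"
    using smooth_on_has_derivative[OF W(2), of b] b W(1) by (blast intro: differentiableI)
  ultimately have "k differentiable (at b)"
    unfolding k_def by (rule differentiable_add)
  then obtain k' where k': "(k has_derivative k') (at b)" unfolding differentiable_def by blast
  then obtain K where K: "K > 0" "\<And>h. norm (k' h) \<le> norm h * K"
    using bounded_linear.pos_bounded[OF has_derivative_bounded_linear[OF k']] by blast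
  obtain \<delta> where \<delta>: "\<delta> > 0" "\<And>x. norm (x - b) < \<delta> \<Longrightarrow> norm (k x - k b - k' (x - b)) \<le> 1 * norm (x - b)"
    using k' unfolding has_derivative_at_alt by (meson zero_less_one)
  show ?thesis
  proof
    show "1 + K \<ge> 0" "\<delta> > 0" using K \<delta> by auto
    fix x assume x: "x \<in> P" "norm (x - b) < \<delta>"
    have "u x - u b - (1/2) * (\<Sum>i\<in>I. l i x * ln (l i x)) = k x - k b"
      by (simp add: u[OF x(1)] ub)
    moreover have "\<bar>k x - k b\<bar> \<le> (1 + K) * norm (x - b)"
      using \<delta>(2)[OF x(2)] K(2)[of "x - b"] by (simp add: algebra_simps abs_le_iff)
    ultimately show "\<bar>u x - u b - (1/2) * (\<Sum>i | i < d \<and> l i b = 0. l i x * ln (l i x))\<bar> \<le> (1 + K) * norm (x - b)"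
      by (simp add: I_def)
  qed
qed

text \<open>The polytope is a face of itself, and at an interior point every direction is tangent to
  it. What remains is to identify the iterated \<open>deriv\<close> along a line with the Hessian
  form.\<close>

lemma hess_pos_def:
  assumes x: "x \<in> interior P" and v: "v \<noteq> 0"
  shows "0 < v \<bullet> (hess u x *v v)"
proof -
  obtain e where e: "e > 0" "ball x e \<subseteq> interior P"
    using x open_contains_ball open_interior by blast
  have near: "x + t *\<^sub>R v \<in> interior P" if "\<bar>t\<bar> < e / norm v" for t
    using that v e by (intro subsetD[OF e(2)]) (simp add: dist_norm field_simps)
  have "v \<in> span ((\<lambda>y. y - x) ` P)"
  proof -
    define r where "r = e / norm v / 2"
    have r: "r > 0" "\<bar>r\<bar> < e / norm v" using e v by (auto simp: r_def field_simps)
    have "r *\<^sub>R v \<in> (\<lambda>y. y - x) ` P"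
      using in_P[OF near[OF r(2)]] by (intro image_eqI[of _ _ "x + r *\<^sub>R v"]) auto
    then have "(1 / r) *\<^sub>R (r *\<^sub>R v) \<in> span ((\<lambda>y. y - x) ` P)"
      by (intro span_mul span_base)
    then show ?thesis using r by simp
  qed
  moreover have "P face_of P" by (simp add: face_of_refl convex_polytope_of)
  moreover have "x \<in> rel_interior P" using x int_ne by (simp add: rel_interior_nonempty_interior)
  ultimately have pos: "deriv (deriv (\<lambda>t. u (x + t *\<^sub>R v))) 0 > 0"
    using pot v unfolding symplectic_potential_def by blast
  have line: "((\<lambda>t. x + t *\<^sub>R v) has_derivative (\<lambda>s. s *\<^sub>R v)) (at t)" for t
    by (auto intro!: derivative_eq_intros)
  have d1: "deriv (\<lambda>t. u (x + t *\<^sub>R v)) t = gradient u (x + t *\<^sub>R v) \<bullet> v" if "\<bar>t\<bar> < e / norm v" for t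
  proof -
    have "((\<lambda>t. u (x + t *\<^sub>R v)) has_derivative (\<lambda>s. gradient u (x + t *\<^sub>R v) \<bullet> (s *\<^sub>R v))) (at t)"
      by (rule has_derivative_compose[OF line smooth_on_has_derivative_gradient[OF smooth_u near[OF that]]])
    then have "((\<lambda>t. u (x + t *\<^sub>R v)) has_real_derivative gradient u (x + t *\<^sub>R v) \<bullet> v) (at t)"
      by (simp add: has_field_derivative_def mult_commute_abs)
    then show ?thesis by (rule DERIV_imp_deriv)
  qed
  have "((\<lambda>t. gradient u (x + t *\<^sub>R v) \<bullet> v) has_derivative (\<lambda>s. (hess u (x + 0 *\<^sub>R v) *v (s *\<^sub>R v)) \<bullet> v)) (at 0)"
    using x by (intro has_derivative_inner_left has_derivative_compose[OF line smooth_on_gradient_has_derivative[OF smooth_u]]) simp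
  then have "((\<lambda>t. gradient u (x + t *\<^sub>R v) \<bullet> v) has_real_derivative v \<bullet> (hess u x *v v)) (at 0)"
    by (simp add: has_field_derivative_def mult_commute_abs matrix_vector_mult_scaleR inner_commute)
  then have "deriv (\<lambda>t. gradient u (x + t *\<^sub>R v) \<bullet> v) 0 = v \<bullet> (hess u x *v v)"
    by (rule DERIV_imp_deriv)
  moreover have "deriv (deriv (\<lambda>t. u (x + t *\<^sub>R v))) 0 = deriv (\<lambda>t. gradient u (x + t *\<^sub>R v) \<bullet> v) 0"
  proof (rule deriv_cong_ev)
    have "\<forall>\<^sub>F t in nhds 0. t \<in> {- (e / norm v) <..< e / norm v}"
      using e v by (intro eventually_nhds_in_open) auto
    then show "\<forall>\<^sub>F t in nhds 0. deriv (\<lambda>t. u (x + t *\<^sub>R v)) t = gradient u (x + t *\<^sub>R v) \<bullet> v"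
      by eventually_elim (rule d1, auto)
  qed simp
  ultimately show ?thesis using pos by simp
qed

sublocale pos_def_hessian "interior P" u
  by unfold_locales (rule smooth_u, rule hess_pos_def)

lemma convex_int: "convex (interior P)"
  by (rule convex_interior[OF convex_polytope_of])

lemma toward_interior:
  assumes "x \<in> P" "z \<in> interior P" "0 < t" "t \<le> 1"
  shows "(1 - t) *\<^sub>R x + t *\<^sub>R z \<in> interior P"
  using assms l_nonneg[OF assms(1)] l_pos[OF assms(2)]
  by (simp add: interior_P aff_fun_convex_comb add_nonneg_pos)

lemma tendsto_u_along:
  assumes "x \<in> P" "z \<in> interior P"
  shows "((\<lambda>t. u ((1 - t) *\<^sub>R x + t *\<^sub>R z)) \<longlongrightarrow> u x) (at_right 0)"
proof (rule continuous_on_tendsto_compose[OF continuous_on_u _ assms(1)])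
  have "((\<lambda>t. (1 - t) *\<^sub>R x + t *\<^sub>R z) \<longlongrightarrow> (1 - 0) *\<^sub>R x + 0 *\<^sub>R z) (at_right (0::real))"
    by (intro tendsto_intros)
  then show "((\<lambda>t. (1 - t) *\<^sub>R x + t *\<^sub>R z) \<longlongrightarrow> x) (at_right (0::real))" by simp
  have "\<forall>\<^sub>F t in at_right (0::real). t \<in> {0<..<1}"
    by (rule eventually_at_right_real) simp
  then show "\<forall>\<^sub>F t in at_right (0::real). (1 - t) *\<^sub>R x + t *\<^sub>R z \<in> P"
    by eventually_elim (intro in_P toward_interior assms, auto)
qed

text \<open>Shrinking towards a fixed interior point \<open>z\<close> commutes with convex
  combinations and moves all points into the interior, where convexity is known; continuity then
  removes the shrinking.\<close>

lemma convex_on_u: "convex_on P u"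
proof (rule convex_onI)
  fix t x y assume t: "0 < t" "t < (1::real)" and xy: "x \<in> P" "y \<in> P"
  obtain z where z: "z \<in> interior P" using int_ne by blast
  let ?m = "(1 - t) *\<^sub>R x + t *\<^sub>R y"
  have m: "?m \<in> P" using convexD[OF convex_polytope_of xy] t by simp
  let ?p = "\<lambda>w s. (1 - s) *\<^sub>R w + s *\<^sub>R z"
  have ev: "\<forall>\<^sub>F s in at_right (0::real). s \<in> {0<..<1}"
    by (rule eventually_at_right_real) simp
  have "\<forall>\<^sub>F s in at_right 0. u (?p ?m s) \<le> (1 - t) * u (?p x s) + t * u (?p y s)"
    using ev
  proof eventually_elim
    case (elim s)
    have "?p ?m s = (1 - t) *\<^sub>R ?p x s + t *\<^sub>R ?p y s" by (simp add: algebra_simps)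
    then show ?case
      using convex_onD[OF convex_on_S[OF convex_int], of t "?p x s" "?p y s"] t elim
        toward_interior[OF xy(1) z, of s] toward_interior[OF xy(2) z, of s] by auto
  qed
  moreover have "((\<lambda>s. (1 - t) * u (?p x s) + t * u (?p y s)) \<longlongrightarrow> (1 - t) * u x + t * u y) (at_right 0)"
    by (intro tendsto_intros tendsto_u_along xy z)
  ultimately show "u ?m \<le> (1 - t) * u x + t * u y"
    using tendsto_le[OF _ _ tendsto_u_along[OF m z]] trivial_limit_at_right_real by blast
qed (rule convex_polytope_of)

lemma nonneg_of_normalized:
  assumes "x0 \<in> interior P" "normalized_at x0 u" "x \<in> P"
  shows "0 \<le> u x"
proof -
  have "gradient u x0 = 0" "u x0 = 0"
    using assms(2) by (auto simp: normalized_at_def vec_eq_iff)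
  then have int: "0 \<le> u z" if "z \<in> interior P" for z
    using gradient_tangent_le[OF convex_int assms(1) that] by simp
  have "\<forall>\<^sub>F t in at_right (0::real). t \<in> {0<..<1}"
    by (rule eventually_at_right_real) simp
  then have "\<forall>\<^sub>F t in at_right 0. 0 \<le> u ((1 - t) *\<^sub>R x + t *\<^sub>R x0)"
    by eventually_elim (intro int toward_interior assms, auto)
  then show ?thesis
    using tendsto_lowerbound[OF tendsto_u_along[OF assms(3,1)]] trivial_limit_at_right_real by blast
qed

text \<open>The logarithmic terms have slope \<open>-\<infinity>\<close> at the boundary in inward directions.\<close>

lemma minimizer_interior:
  assumes b: "b \<in> P" and min: "\<And>x. x \<in> P \<Longrightarrow> u b - \<eta> \<bullet> b \<le> u x - \<eta> \<bullet> x"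
  shows "b \<in> interior P"
proof (rule ccontr)
  assume nb: "b \<notin> interior P"
  define I where "I = {i. i < d \<and> l i b = 0}"
  have "I \<noteq> {}" using nb l_nonneg[OF b] by (auto simp: interior_P I_def less_le)
  have "finite I" by (simp add: I_def)
  obtain z where z: "z \<in> interior P" using int_ne by blast
  obtain C \<delta> where C: "C \<ge> 0" "\<delta> > 0"
    "\<And>x. x \<in> P \<Longrightarrow> norm (x - b) < \<delta> \<Longrightarrow>
      \<bar>u x - u b - (1/2) * (\<Sum>i\<in>I. l i x * ln (l i x))\<bar> \<le> C * norm (x - b)"
    by (rule local_expansion[OF b, folded I_def]) (rule that, assumption+)
  define A where "A = (\<Sum>i\<in>I. l i z)"
  have "A > 0" unfolding A_def using \<open>finite I\<close> \<open>I \<noteq> {}\<close> l_pos[OF z] by (intro sum_pos) (auto simp: I_def)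
  \<comment> \<open>At the point \<open>x\<close> a fraction \<open>t\<close> of the way from
    \<open>b\<close> to \<open>z\<close>, minimality becomes
    \<open>0 \<le> t * ((1/2) * ln t * A + (M - 1))\<close>. The choice of \<open>t\<close> makes
    \<open>ln t * A\<close> at most -2 M, and the summand 1 in \<open>M\<close> makes the
    contradiction strict.\<close>
  define M where "M = C * norm (z - b) + norm \<eta> * norm (z - b) + (1/2) * (\<Sum>i\<in>I. l i z * ln (l i z)) + 1"
  define t where "t = Min {1, \<delta> / (2 * (norm (z - b) + 1)), exp (- 2 * M / A)}"
  have t: "0 < t" "t \<le> 1" "t \<le> \<delta> / (2 * (norm (z - b) + 1))" "t \<le> exp (- 2 * M / A)"
    using C(2) by (auto simp: t_def add_nonneg_pos)
  define x where "x = (1 - t) *\<^sub>R b + t *\<^sub>R z"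
  have x: "x \<in> P" unfolding x_def by (intro in_P toward_interior b z t)
  have xb: "x - b = t *\<^sub>R (z - b)" by (simp add: x_def algebra_simps)
  have "t * norm (z - b) \<le> \<delta> / (2 * (norm (z - b) + 1)) * norm (z - b)"
    using t by (intro mult_right_mono) auto
  also have "\<dots> < \<delta>" 
  proof -
    have n: "norm (z - b) < 2 * (norm (z - b) + 1)" "0 < 2 * (norm (z - b) + 1)"
      by (auto simp: add_nonneg_pos)
    have "\<delta> * norm (z - b) < \<delta> * (2 * (norm (z - b) + 1))"
      by (rule mult_strict_left_mono[OF n(1) C(2)])
    then show ?thesis using n(2) by (simp only: times_divide_eq_left pos_divide_less_eq)
  qed
  finally have "norm (x - b) < \<delta>" using t(1) by (simp add: xb)
  then have "u x - u b \<le> (1/2) * (\<Sum>i\<in>I. l i x * ln (l i x)) + C * norm (x - b)"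
    using C(3)[OF x] by linarith
  moreover have "u b - u x \<le> norm \<eta> * norm (x - b)"
  proof -
    have "u b - u x \<le> - (\<eta> \<bullet> (x - b))" using min[OF x] by (simp add: inner_diff_right)
    also have "\<dots> \<le> norm \<eta> * norm (x - b)" using Cauchy_Schwarz_ineq2[of \<eta> "x - b"] by linarith
    finally show ?thesis .
  qed
  moreover have "(\<Sum>i\<in>I. l i x * ln (l i x)) = t * ln t * A + t * (\<Sum>i\<in>I. l i z * ln (l i z))"
  proof -
    have "l i x * ln (l i x) = t * ln t * l i z + t * (l i z * ln (l i z))" if "i \<in> I" for i
    proof -
      have "l i x = t * l i z" using that unfolding x_def aff_fun_convex_comb by (simp add: I_def)
      moreover have "l i z > 0" using l_pos[OF z] that by (simp add: I_def)
      ultimately show ?thesis using t(1) by (simp add: ln_mult algebra_simps)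
    qed
    then show ?thesis by (simp add: A_def sum.distrib sum_distrib_left)
  qed
  moreover have "norm (x - b) = t * norm (z - b)" using t(1) by (simp add: xb)
  ultimately have "0 \<le> t * ((1/2) * ln t * A + (M - 1))"
    by (simp add: M_def algebra_simps)
  then have "0 \<le> (1/2) * ln t * A + (M - 1)" using t(1) by (simp add: zero_le_mult_iff)
  moreover have "ln t \<le> - 2 * M / A" using t(1,4) by (metis exp_gt_zero ln_exp ln_le_cancel_iff)
  then have "ln t * A \<le> - 2 * M" using \<open>A > 0\<close> by (simp add: field_simps)
  ultimately show False by simp
qed

text \<open>A minimizer of \<open>u x - \<eta> \<bullet> x\<close> exists by compactness and is
  interior by the infinite slope at the boundary, so its gradient is \<open>\<eta>\<close>.
  Surjectivity of the gradient map makes the curve of \<open>vertex_estimate\<close> exist for all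
  times; the minimum property, valid up to the boundary, is what compares \<open>\<gamma> s\<close>
  with the vertex.\<close>

lemma ex_gradient:
  obtains x where "x \<in> interior P" "gradient u x = \<eta>" "\<And>z. z \<in> P \<Longrightarrow> u x - \<eta> \<bullet> x \<le> u z - \<eta> \<bullet> z"
proof -
  have "P \<noteq> {}" using int_ne interior_subset by blast
  moreover have "continuous_on P (\<lambda>x. u x - \<eta> \<bullet> x)"
    by (intro continuous_intros continuous_on_u)
  ultimately have "\<exists>x\<in>P. \<forall>z\<in>P. u x - \<eta> \<bullet> x \<le> u z - \<eta> \<bullet> z"
    by (rule continuous_attains_inf[OF compact_P])
  then obtain x where x: "x \<in> P" "\<And>z. z \<in> P \<Longrightarrow> u x - \<eta> \<bullet> x \<le> u z - \<eta> \<bullet> z"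
    by blast
  have xi: "x \<in> interior P" by (rule minimizer_interior[OF x])
  have "((\<lambda>x. u x - \<eta> \<bullet> x) has_derivative (\<lambda>h. gradient u x \<bullet> h - \<eta> \<bullet> h)) (at x)"
    by (intro has_derivative_diff smooth_on_has_derivative_gradient[OF smooth_u xi]) (auto intro!: derivative_eq_intros)
  then have "(\<lambda>h. gradient u x \<bullet> h - \<eta> \<bullet> h) = (\<lambda>v. 0)"
    by (rule differential_zero_maxmin[OF xi open_interior]) (use x in_P in auto)
  from fun_cong[OF this, of "gradient u x - \<eta>"]
  have "(gradient u x - \<eta>) \<bullet> (gradient u x - \<eta>) = 0"
    by (simp add: inner_diff_left)
  then have "gradient u x = \<eta>" by simp
  then show ?thesis using that xi x(2) by blast
qed

text \<open>The Delzant condition writes the unit vectors as combinations of the normals at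
  \<open>v\<close>, so the facet functions vanishing at \<open>v\<close> serve as linear coordinates
  there. They are nonnegative on the polytope, so each is at most their sum.\<close>

lemma vertex_coordinates:
  assumes v: "v extreme_point_of P"
  obtains K where "K > 0" "\<And>x. x \<in> P \<Longrightarrow> norm (x - v) \<le> K * (\<Sum>i | i < d \<and> l i v = 0. l i x)"
proof -
  define I where "I = {i. i < d \<and> l i v = 0}"
  have fin: "finite I" by (simp add: I_def)
  have "\<forall>z. int_vec z \<longrightarrow> (\<exists>k :: nat \<Rightarrow> int. z = (\<Sum>i\<in>I. of_int (k i) *\<^sub>R nv i))"
    using delz v unfolding delzant_def I_def Let_def by blast
  moreover have "int_vec (axis m 1 :: real^'n)" for m by (simp add: int_vec_def axis_def)
  ultimately have "\<forall>m. \<exists>k :: nat \<Rightarrow> int. (axis m 1 :: real^'n) = (\<Sum>i\<in>I. of_int (k i) *\<^sub>R nv i)"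
    by blast
  then obtain k :: "'n \<Rightarrow> nat \<Rightarrow> int"
    where k: "\<And>m. (axis m 1 :: real^'n) = (\<Sum>i\<in>I. of_int (k m i) *\<^sub>R nv i)" by metis
  define K where "K = 1 + (\<Sum>m\<in>UNIV. \<Sum>i\<in>I. \<bar>real_of_int (k m i)\<bar>)"
  have K: "K > 0" unfolding K_def by (intro add_pos_nonneg sum_nonneg) auto
  have "norm (x - v) \<le> K * (\<Sum>i\<in>I. l i x)" if x: "x \<in> P" for x
  proof -
    define L where "L = (\<Sum>i\<in>I. l i x)"
    have l0: "l i x \<ge> 0" if "i \<in> I" for i using l_nonneg[OF x] that by (simp add: I_def)
    have lL: "l i x \<le> L" if "i \<in> I" for i
      unfolding L_def using member_le_sum[OF that _ fin, of "\<lambda>i. l i x"] l0 by auto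
    have "L \<ge> 0" unfolding L_def by (rule sum_nonneg) (rule l0)
    have "\<bar>(x - v) $ m\<bar> \<le> (\<Sum>i\<in>I. \<bar>real_of_int (k m i)\<bar>) * L" for m
    proof -
      have "(x - v) $ m = axis m 1 \<bullet> (x - v)" by (simp add: inner_axis')
      also have "\<dots> = (\<Sum>i\<in>I. real_of_int (k m i) * l i x)"
        unfolding k inner_sum_left
      proof (rule sum.cong[OF refl])
        fix i assume "i \<in> I"
        then have "nv i \<bullet> (x - v) = l i x" by (auto simp: I_def aff_fun_def inner_diff_right)
        then show "(real_of_int (k m i) *\<^sub>R nv i) \<bullet> (x - v) = real_of_int (k m i) * l i x" by simp
      qed
      also have "\<bar>\<dots>\<bar> \<le> (\<Sum>i\<in>I. \<bar>real_of_int (k m i) * l i x\<bar>)" by (rule sum_abs)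
      also have "\<dots> \<le> (\<Sum>i\<in>I. \<bar>real_of_int (k m i)\<bar> * L)"
        by (rule sum_mono) (auto simp: abs_mult l0 lL intro!: mult_left_mono)
      finally show ?thesis by (simp add: sum_distrib_right)
    qed
    then have "(\<Sum>m\<in>UNIV. \<bar>(x - v) $ m\<bar>) \<le> (\<Sum>m\<in>UNIV. (\<Sum>i\<in>I. \<bar>real_of_int (k m i)\<bar>) * L)"
      by (intro sum_mono)
    also have "\<dots> \<le> K * L"
      unfolding K_def using \<open>L \<ge> 0\<close> by (simp add: sum_distrib_right distrib_right)
    finally show ?thesis using norm_le_l1_cart[of "x - v"] by (simp add: L_def)
  qed
  then show ?thesis using that K by (simp add: I_def)
qed

lemma vertex_estimate:
  assumes v: "v extreme_point_of P"
    and Rm: "\<And>x. x \<in> interior P \<Longrightarrow> Rm_sq u x \<le> 1"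
    and q: "q \<in> interior P" "(\<Sum>i | i < d \<and> l i v = 0. l i q) \<le> 1 / 2"
  shows "u v \<le> u q + gradient u q \<bullet> (v - q) + 1 / 2"
proof -
  have vP: "v \<in> P" using v by (simp add: extreme_point_of_def)
  define I where "I = {i. i < d \<and> l i v = 0}"
  have fin: "finite I" by (simp add: I_def)
  define N where "N = (\<Sum>i\<in>I. nv i)"
  have N: "N \<bullet> (x - v) = (\<Sum>i\<in>I. l i x)" for x
    unfolding N_def inner_sum_left by (rule sum.cong) (auto simp: I_def aff_fun_def inner_diff_right)
  obtain K where K: "K > 0" "\<And>x. x \<in> P \<Longrightarrow> norm (x - v) \<le> K * (\<Sum>i\<in>I. l i x)"
    by (rule vertex_coordinates[OF v, folded I_def]) (rule that, assumption+)
  have "card I = CARD('n)"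
    using delz v unfolding delzant_def I_def Let_def by blast
  then have "I \<noteq> {}" by auto
  have Lpos: "N \<bullet> (x - v) > 0" if "x \<in> interior P" for x
    unfolding N using l_pos[OF that] \<open>I \<noteq> {}\<close> fin by (intro sum_pos) (auto simp: I_def)
  have "N \<noteq> 0" using Lpos[OF q(1)] by force
  define \<xi> where "\<xi> = gradient u q"
  have "\<forall>s. \<exists>x. x \<in> interior P \<and> gradient u x = \<xi> - s *\<^sub>R N \<and>
      (\<forall>z\<in>P. u x - (\<xi> - s *\<^sub>R N) \<bullet> x \<le> u z - (\<xi> - s *\<^sub>R N) \<bullet> z)"
    using ex_gradient by metis
  then obtain \<gamma> where \<gamma>: "\<And>s. \<gamma> s \<in> interior P" "\<And>s. gradient u (\<gamma> s) = \<xi> - s *\<^sub>R N"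
    "\<And>s z. z \<in> P \<Longrightarrow> u (\<gamma> s) - (\<xi> - s *\<^sub>R N) \<bullet> \<gamma> s \<le> u z - (\<xi> - s *\<^sub>R N) \<bullet> z"
    by metis
  have \<gamma>0: "\<gamma> 0 = q"
    using inj_onD[OF inj_on_gradient[OF convex_int], of "\<gamma> 0" q] \<gamma>(1,2)[of 0] q(1) by (simp add: \<xi>_def)
  define L where "L s = N \<bullet> (\<gamma> s - v)" for s
  have Lp: "L s > 0" for s unfolding L_def by (rule Lpos[OF \<gamma>(1)])
  have dist_L: "norm (\<gamma> s - v) \<le> K * L s" for s
    using K(2)[OF in_P[OF \<gamma>(1)]] by (simp add: L_def N)
  \<comment> \<open>Minimality of \<open>\<gamma> s\<close> tested at \<open>v\<close>. Boundedness
    of the right side first gives \<open>L s \<le> M / s\<close>, hence convergence to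
    \<open>v\<close>; once \<open>\<gamma> s\<close> is near \<open>v\<close>, the local expansion
    of \<open>u\<close> improves this to exponential decay.\<close>
  have sL: "s * L s \<le> u v - u (\<gamma> s) + \<xi> \<bullet> (\<gamma> s - v)" for s
    using \<gamma>(3)[OF vP, of s] by (simp add: L_def inner_diff_left inner_diff_right algebra_simps)
  obtain M where M: "\<And>x. x \<in> P \<Longrightarrow> u v - u x + \<xi> \<bullet> (x - v) \<le> M"
  proof -
    have "continuous_on P (\<lambda>x. u v - u x + \<xi> \<bullet> (x - v))"
      by (intro continuous_intros continuous_on_u)
    then have "bounded ((\<lambda>x. u v - u x + \<xi> \<bullet> (x - v)) ` P)"
      by (intro compact_imp_bounded compact_continuous_image compact_P)
    then obtain M where "\<And>y. y \<in> (\<lambda>x. u v - u x + \<xi> \<bullet> (x - v)) ` P \<Longrightarrow> norm y \<le> M"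
      unfolding bounded_iff by blast
    then have "\<bar>u v - u x + \<xi> \<bullet> (x - v)\<bar> \<le> M" if "x \<in> P" for x
      using that by force
    then show ?thesis using that[of M] abs_le_D1 by blast
  qed
  have sM: "s * L s \<le> M" for s using sL[of s] M[OF in_P[OF \<gamma>(1)], of s] by linarith
  from this[of 1] Lp[of 1] have "M > 0" by simp
  have L_le: "L s \<le> M / s" if "s > 0" for s
    using sM[of s] that by (simp add: pos_le_divide_eq mult.commute)
  obtain C \<delta> where C: "C \<ge> 0" "\<delta> > 0"
    "\<And>x. x \<in> P \<Longrightarrow> norm (x - v) < \<delta> \<Longrightarrow>
      \<bar>u x - u v - (1/2) * (\<Sum>i\<in>I. l i x * ln (l i x))\<bar> \<le> C * norm (x - v)"
    by (rule local_expansion[OF vP, folded I_def]) (rule that, assumption+)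
  define C' where "C' = (C + norm \<xi>) * K + card I / 2"
  define s0 where "s0 = 2 * K * M / \<delta>"
  have "s0 > 0" using K(1) \<open>M > 0\<close> C(2) by (simp add: s0_def)
  \<comment> \<open>Near \<open>v\<close> the right side of \<open>sL\<close> is at most - (1/2) L
    ln L plus a multiple of L. Dividing by L gives \<open>s \<le> C' - ln (L s) / 2\<close>; the
    factor 1/2 of the logarithmic terms is the source of the rate 2.\<close>
  have decay: "L s \<le> exp (2 * C') * exp (- 2 * s)" if s: "s \<ge> s0" for s
  proof -
    have spos: "s > 0" using s \<open>s0 > 0\<close> by simp
    have "norm (\<gamma> s - v) \<le> K * (M / s)"
      using dist_L[of s] L_le[OF spos] K(1) by (meson less_imp_le mult_left_mono order_trans)
    also have "\<dots> \<le> K * (M / s0)"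
      using s \<open>s0 > 0\<close> \<open>M > 0\<close> K(1) by (intro mult_left_mono divide_left_mono) auto
    also have "\<dots> = \<delta> / 2" using K(1) \<open>M > 0\<close> C(2) by (simp add: s0_def)
    finally have "norm (\<gamma> s - v) < \<delta>" using C(2) by simp
    then have b1: "u v - u (\<gamma> s) \<le> C * norm (\<gamma> s - v) - (1/2) * (\<Sum>i\<in>I. l i (\<gamma> s) * ln (l i (\<gamma> s)))"
      using C(3)[OF in_P[OF \<gamma>(1)], of s] by linarith
    have b2: "\<xi> \<bullet> (\<gamma> s - v) \<le> norm \<xi> * norm (\<gamma> s - v)"
      by (rule norm_cauchy_schwarz)
    have b3: "(C + norm \<xi>) * norm (\<gamma> s - v) \<le> (C + norm \<xi>) * (K * L s)"
      using C(1) by (intro mult_left_mono dist_L) auto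
    \<comment> \<open>Replacing each \<open>l i\<close> inside its logarithm by the sum
      \<open>L s\<close> costs at most a multiple of \<open>L s\<close>, since
      \<open>p * ln (L / p) \<le> L - p\<close>.\<close>
    have b4: "L s * ln (L s) - card I * L s \<le> (\<Sum>i\<in>I. l i (\<gamma> s) * ln (l i (\<gamma> s)))"
    proof -
      have "l i (\<gamma> s) * ln (l i (\<gamma> s)) \<ge> l i (\<gamma> s) * ln (L s) - L s" if i: "i \<in> I" for i
      proof -
        define p where "p = l i (\<gamma> s)"
        have p: "p > 0" using l_pos[OF \<gamma>(1)] i by (simp add: p_def I_def)
        have "ln (L s / p) \<le> L s / p - 1" using p Lp[of s] by (intro ln_le_minus_one) simp
        then have "ln (L s) - ln p \<le> L s / p - 1" using p Lp[of s] by (simp add: ln_div)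
        then have "p * (ln (L s) - ln p) \<le> p * (L s / p - 1)" using p by (intro mult_left_mono) auto
        then have "p * ln (L s) - p * ln p \<le> L s - p" using p by (simp add: algebra_simps)
        then show ?thesis using p unfolding p_def[symmetric] by simp
      qed
      then have "(\<Sum>i\<in>I. l i (\<gamma> s) * ln (L s) - L s) \<le> (\<Sum>i\<in>I. l i (\<gamma> s) * ln (l i (\<gamma> s)))"
        by (rule sum_mono)
      moreover have "(\<Sum>i\<in>I. l i (\<gamma> s) * ln (L s) - L s) = L s * ln (L s) - card I * L s"
        by (simp add: sum_subtractf sum_distrib_right[symmetric] L_def N)
      ultimately show ?thesis by simp
    qed
    have aux: "x \<le> k - (1/2) * m" if "x \<le> d + e" "d \<le> C * n - (1/2) * g" "e \<le> h * n" "(C + h) * n \<le> k" "m \<le> g"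
      for x k m d e n g h :: real
      using that unfolding distrib_right by linarith
    have "s * L s \<le> (C + norm \<xi>) * (K * L s) - (1/2) * (L s * ln (L s) - card I * L s)"
      by (rule aux[OF sL b1 b2 b3 b4])
    then have "L s * s \<le> L s * (C' - ln (L s) / 2)"
      by (simp add: C'_def algebra_simps)
    then have "s \<le> C' - ln (L s) / 2" using Lp[of s] by simp
    then have "ln (L s) \<le> 2 * C' + - 2 * s" by simp
    then have "exp (ln (L s)) \<le> exp (2 * C' + - 2 * s)" by simp
    then show ?thesis using Lp[of s] by (simp only: exp_ln exp_add)
  qed
  \<comment> \<open>The discarded terms \<open>s * L s\<close> and
    \<open>N \<bullet> (\<gamma> s - v)\<close> are nonnegative, and the initial value of the latter
    accounts for the 1/2. The limit of large \<open>s\<close> then gives the claim.\<close>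
  have est: "u (\<gamma> s) + \<xi> \<bullet> (v - \<gamma> s) \<le> u q + \<xi> \<bullet> (v - q) + 1 / 2" if "s \<ge> 0" for s
  proof -
    have "u (\<gamma> s) + (\<xi> - s *\<^sub>R N) \<bullet> (v - \<gamma> s) + N \<bullet> (\<gamma> s - v)
      \<le> u (\<gamma> 0) + \<xi> \<bullet> (v - \<gamma> 0) + N \<bullet> (\<gamma> 0 - v)"
      by (rule gradient_flow_estimate[where C = "exp (2 * C')" and ?s0.0 = s0, OF convex_int \<gamma>(1,2)])
         (use Rm \<open>N \<noteq> 0\<close> Lp less_imp_le decay q(2) that in \<open>auto simp: L_def \<gamma>0 N I_def\<close>)
    moreover have "(\<xi> - s *\<^sub>R N) \<bullet> (v - \<gamma> s) = \<xi> \<bullet> (v - \<gamma> s) + s * L s"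
      by (simp add: L_def inner_diff_left inner_diff_right algebra_simps)
    moreover have "s * L s \<ge> 0" using that Lp[of s] by simp
    moreover have "N \<bullet> (\<gamma> s - v) > 0" using Lp[of s] by (simp add: L_def)
    moreover have "N \<bullet> (\<gamma> 0 - v) \<le> 1 / 2" using q(2) by (simp add: \<gamma>0 N I_def)
    ultimately show ?thesis by (simp add: \<gamma>0)
  qed
  have "((\<lambda>s. \<gamma> s - v) \<longlongrightarrow> 0) at_top"
  proof (rule Lim_null_comparison)
    show "\<forall>\<^sub>F s in at_top. norm (\<gamma> s - v) \<le> K * (M / s)"
      using eventually_gt_at_top[of 0]
    proof eventually_elim
      case (elim s)
      have "K * L s \<le> K * (M / s)" using L_le[OF elim] K(1) by (intro mult_left_mono) auto
      then show ?case using dist_L[of s] by linarith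
    qed
    show "((\<lambda>s. K * (M / s)) \<longlongrightarrow> 0) at_top" by real_asymp
  qed
  then have "(\<gamma> \<longlongrightarrow> v) at_top" by (rule Lim_null[THEN iffD2])
  then have "((\<lambda>s. u (\<gamma> s) + \<xi> \<bullet> (v - \<gamma> s)) \<longlongrightarrow> u v + \<xi> \<bullet> (v - v)) at_top"
    by (intro tendsto_intros continuous_on_tendsto_compose[OF continuous_on_u _ vP])
       (simp_all add: in_P \<gamma>(1))
  then have "((\<lambda>s. u (\<gamma> s) + \<xi> \<bullet> (v - \<gamma> s)) \<longlongrightarrow> u v) at_top" by simp
  moreover have "\<forall>\<^sub>F s in at_top. u (\<gamma> s) + \<xi> \<bullet> (v - \<gamma> s) \<le> u q + \<xi> \<bullet> (v - q) + 1 / 2"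
    using eventually_ge_at_top[of 0] by eventually_elim (rule est)
  ultimately show ?thesis
    unfolding \<xi>_def using tendsto_upperbound trivial_limit_at_top_linorder by blast
qed

end

section \<open>Bounds from the boundary integral\<close>

text \<open>The midpoint inequality is integrated over \<open>h\<close> in a symmetric box;
  reflection shows that both terms on its right have the same integral.\<close>

lemma midpoint_le_integral_cbox:
  fixes g :: "'a::euclidean_space \<Rightarrow> real"
  assumes g: "g integrable_on cbox (a - r) (a + r)"
    and mid: "\<And>h. h \<in> cbox (- r) r \<Longrightarrow> 2 * g a \<le> g (a + h) + g (a - h)"
  shows "g a * measure lborel (cbox (a - r) (a + r)) \<le> integral (cbox (a - r) (a + r)) g"
proof -
  define J where "J = integral (cbox (a - r) (a + r)) g"
  have "(g has_integral J) (cbox (a - r) (a + r))"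
    unfolding J_def using g by (rule integrable_integral)
  from has_integral_shift_cbox[OF this, of a]
  have p: "((\<lambda>h. g (a + h)) has_integral J) (cbox (- r) r)"
    by (simp add: add.commute)
  then have m: "((\<lambda>h. g (a - h)) has_integral J) (cbox (- r) r)"
    using has_integral_reflect[of "\<lambda>h. g (a + h)" J r "- r"] by simp
  have "measure lborel (cbox (- r) r) *\<^sub>R (2 * g a) \<le> J + J"
    by (rule has_integral_le[OF has_integral_const has_integral_add[OF p m] mid])
  moreover have "measure lborel (cbox (a - r) (a + r)) = measure lborel (cbox (- r) r)"
  proof -
    have "cbox (a - r) (a + r) = {} \<longleftrightarrow> cbox (- r) r = {}"
      by (simp add: box_eq_empty inner_add_left inner_diff_left)
    then show ?thesis by (simp add: content_cbox_if inner_add_left inner_diff_left)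
  qed
  ultimately show ?thesis by (simp add: J_def mult.commute)
qed

lemma facet_integral_nonneg:
  assumes "\<And>x. x \<in> polytope_of nv c d \<Longrightarrow> 0 \<le> w x"
  shows "0 \<le> facet_integral nv c d i w"
proof -
  \<comment> \<open>Without integrability \<open>integral\<close> has the default value 0, which is
    nonnegative as well.\<close>
  have nn: "0 \<le> integral A h" if "\<And>y. y \<in> A \<Longrightarrow> 0 \<le> h y" for A :: "(real^'n) set" and h :: "real^'n \<Rightarrow> real"
    using that by (cases "h integrable_on A") (auto simp: integral_nonneg not_integrable_integral)
  show ?thesis
    unfolding facet_integral_def Let_def
    by (intro mult_nonneg_nonneg nn) (auto simp: facet_of_index_def intro: assms)
qed

lemma closed_facet: "closed (facet_of_index nv c d i)"
proof -
  have "facet_of_index nv c d i = polytope_of nv c d \<inter> {x. aff_fun nv c i x = 0}"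
    by (auto simp: facet_of_index_def)
  moreover have "closed {x. aff_fun nv c i x = 0}"
    by (intro closed_Collect_eq continuous_on_const continuous_on_aff_fun)
  ultimately show ?thesis by (simp add: closed_Int closed_polytope_of)
qed

lemma convex_facet:
  fixes nv :: "nat \<Rightarrow> real^'n"
  shows "convex (facet_of_index nv c d i)"
proof (rule convexI)
  fix x y :: "real^'n" and s t :: real
  assume xy: "x \<in> facet_of_index nv c d i" "y \<in> facet_of_index nv c d i" and st: "0 \<le> s" "0 \<le> t" "s + t = 1"
  have "s *\<^sub>R x + t *\<^sub>R y \<in> polytope_of nv c d"
    using convexD[OF convex_polytope_of, of x nv c d y s t] xy st by (simp add: facet_of_index_def)
  moreover have "aff_fun nv c i (s *\<^sub>R x + t *\<^sub>R y) = 0"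
    using aff_fun_convex_comb[of nv c i t x y] xy st by (simp add: facet_of_index_def eq_diff_eq[symmetric])
  ultimately show "s *\<^sub>R x + t *\<^sub>R y \<in> facet_of_index nv c d i"
    by (simp add: facet_of_index_def)
qed

lemma interior_subset_hull_rel_interior_facets:
  assumes bounded: "bounded (polytope_of nv c d)" and nz: "\<And>i. i < d \<Longrightarrow> nv i \<noteq> 0"
  shows "interior (polytope_of nv c d) \<subseteq> convex hull (\<Union>i<d. rel_interior (facet_of_index nv c d i))"
proof -
  let ?P = "polytope_of nv c d" and ?S = "\<Union>i<d. rel_interior (facet_of_index nv c d i)"
  have comp: "compact ?P" using bounded closed_polytope_of by (simp add: compact_eq_bounded_closed)
  have "facet_of_index nv c d i \<subseteq> closure (convex hull ?S)" if "i < d" for i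
  proof -
    have "facet_of_index nv c d i = closure (rel_interior (facet_of_index nv c d i))"
      using convex_closure_rel_interior[OF convex_facet[of nv c d i]] closed_facet[of nv c d i]
      by (simp add: closure_closed)
    also have "\<dots> \<subseteq> closure (convex hull ?S)"
      using that hull_subset[of ?S convex] by (intro closure_mono) blast
    finally show ?thesis .
  qed
  moreover have int: "interior ?P = {x. \<forall>i<d. 0 < aff_fun nv c i x}"
    by (rule interior_polytope_of) (rule nz)
  have "frontier ?P \<subseteq> (\<Union>i<d. facet_of_index nv c d i)"
  proof
    fix x assume "x \<in> frontier ?P"
    then have x: "x \<in> ?P" "x \<notin> interior ?P"
      by (auto simp: frontier_def closure_closed[OF closed_polytope_of])
    then obtain i where i: "i < d" "\<not> 0 < aff_fun nv c i x" unfolding int by blast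
    moreover have "0 \<le> aff_fun nv c i x" using x(1) i(1) by (simp add: polytope_of_def)
    ultimately have "i < d" "aff_fun nv c i x = 0" by auto
    then show "x \<in> (\<Union>i<d. facet_of_index nv c d i)" using x by (auto simp: facet_of_index_def)
  qed
  ultimately have "frontier ?P \<subseteq> closure (convex hull ?S)" by blast
  then have "convex hull (frontier ?P) \<subseteq> closure (convex hull ?S)"
    by (intro hull_minimal convex_closure convex_convex_hull)
  then have "interior ?P \<subseteq> interior (closure (convex hull ?S))"
    using Krein_Milman_frontier[OF convex_polytope_of comp] by (intro interior_mono) simp
  also have "\<dots> = interior (convex hull ?S)" by (simp add: convex_interior_closure)
  finally show ?thesis using interior_subset by blast
qed

text \<open>Pulled back by the affine projection \<open>p\<close>, a convex \<open>w\<close>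
  satisfies the midpoint inequality, so its value at \<open>s\<close> is at most its average over a
  box \<open>Q\<close> in the slab. Nonnegativity of \<open>w\<close> lets the integral over
  \<open>Q\<close> be enlarged to the facet and then to the whole boundary. The box is chosen before
  \<open>w\<close>, so the bound is uniform.\<close>

lemma facet_point_bound:
  fixes nv :: "nat \<Rightarrow> real^'n"
  assumes bounded: "bounded (polytope_of nv c d)" and i: "i < d" and nz: "nv i \<noteq> 0"
    and dim: "aff_dim (facet_of_index nv c d i) = int CARD('n) - 1"
    and s: "s \<in> rel_interior (facet_of_index nv c d i)"
  shows "\<exists>C. \<forall>w. continuous_on (polytope_of nv c d) w \<and> convex_on (polytope_of nv c d) w \<and>
    (\<forall>x\<in>polytope_of nv c d. 0 \<le> w x) \<and> boundary_integral nv c d w < C1 \<longrightarrow> w s \<le> C"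
proof -
  let ?P = "polytope_of nv c d" and ?F = "facet_of_index nv c d i"
  define j where "j = (SOME j. nv i $ j \<noteq> 0)"
  have "\<exists>j. nv i $ j \<noteq> 0" using nz by (auto simp: vec_eq_iff)
  then have j: "nv i $ j \<noteq> 0" unfolding j_def by (rule someI_ex)
  define a where "a = nv i $ j"
  have a: "a \<noteq> 0" using j by (simp add: a_def)
  define e where "e = (axis j 1 :: real^'n)"
  have nve: "nv i \<bullet> e = a" by (simp add: e_def inner_axis a_def)
  define p where "p y = y - ((nv i \<bullet> y + c i) / a) *\<^sub>R e" for y
  define W where "W = {y. 0 \<le> y $ j \<and> y $ j \<le> 1 \<and> p y \<in> ?F}"
  have fi: "facet_integral nv c d i w = (1 / \<bar>a\<bar>) * integral W (\<lambda>y. w (p y))" for w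
    unfolding facet_integral_def Let_def j_def[symmetric] W_def p_def a_def e_def ..
  have lp: "aff_fun nv c i (p y) = 0" for y
    using a by (simp add: p_def aff_fun_def inner_diff_right nve)
  have pe: "p (y + t *\<^sub>R e) = p y" for y t
    using a by (simp add: p_def inner_add_right nve add_divide_distrib algebra_simps)
  have contp: "continuous_on A p" for A
    unfolding p_def by (intro continuous_intros) (simp_all add: a)
  have s0: "s \<in> ?F" using s rel_interior_subset by blast
  have ps: "p s = s" using s0 by (simp add: p_def facet_of_index_def aff_fun_def)
  have compW: "compact W"
  proof -
    have "closed W"
      unfolding W_def
      by (intro closed_Collect_conj closed_Collect_le continuous_intros)
         (rule closed_vimage[OF closed_facet contp, unfolded vimage_def])
    moreover have "bounded W"
    proof -
      obtain R where R: "\<And>x. x \<in> ?P \<Longrightarrow> norm x \<le> R" using bounded unfolding bounded_iff by blast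
      have "norm y \<le> R + R + 1" if y: "y \<in> W" for y
      proof -
        have pP: "norm (p y) \<le> R" using y R by (simp add: W_def facet_of_index_def)
        have "y = p y + (y $ j - p y $ j) *\<^sub>R e"
          by (simp add: p_def e_def vec_eq_iff axis_def)
        then have "norm y \<le> norm (p y) + \<bar>y $ j - p y $ j\<bar>"
          by (metis e_def mult.right_neutral norm_axis_1 norm_scaleR norm_triangle_ineq)
        also have "\<bar>y $ j - p y $ j\<bar> \<le> 1 + norm (p y)"
          using y component_le_norm_cart[of "p y" j] by (simp add: W_def abs_le_iff)
        finally show ?thesis using pP by simp
      qed
      then show ?thesis unfolding bounded_iff by blast
    qed
    ultimately show ?thesis by (simp add: compact_eq_bounded_closed)
  qed
  obtain r0 where r0: "r0 > 0" "ball s r0 \<inter> affine hull ?F \<subseteq> ?F"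
    using s unfolding mem_rel_interior_ball by blast
  \<comment> \<open>The facet has dimension n - 1, so its affine hull is the full hyperplane;
    therefore a point \<open>p y\<close> close to \<open>s\<close> lies in the facet and not merely
    in the hyperplane.\<close>
  have hyp: "affine hull ?F = {x. nv i \<bullet> x = - c i}"
  proof (rule affine_dim_equal)
    show "affine hull ?F \<noteq> {}" using s0 by auto
    show "affine hull ?F \<subseteq> {x. nv i \<bullet> x = - c i}"
      by (intro hull_minimal affine_hyperplane) (auto simp: facet_of_index_def aff_fun_def)
    show "aff_dim (affine hull ?F) = aff_dim {x. nv i \<bullet> x = - c i}"
      using nz by (simp add: aff_dim_affine_hull dim)
  qed (auto simp: affine_hyperplane)
  have nearF: "p y \<in> ?F" if "dist (p y) s < r0" for y
    using that lp[of y] r0(2) unfolding hyp by (auto simp: dist_commute aff_fun_def)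
  \<comment> \<open>\<open>p\<close> forgets the \<open>j\<close>-th coordinate, so \<open>s\<close>
    can be moved to the middle of the slab, where a box around it fits.\<close>
  define y0 where "y0 = s + (1/2 - s $ j) *\<^sub>R e"
  have py0: "p y0 = s" by (simp add: y0_def pe ps)
  have y0j: "y0 $ j = 1/2" by (simp add: y0_def e_def)
  obtain \<delta> where \<delta>: "\<delta> > 0" "\<And>y. dist y y0 < \<delta> \<Longrightarrow> dist (p y) s < r0"
    using contp[of UNIV] r0(1) py0 unfolding continuous_on_iff by (metis UNIV_I)
  \<comment> \<open>1/2 keeps the box inside the slab; dividing by the dimension bounds the norm of
    a displacement through its coordinate sum.\<close>
  define \<rho> where "\<rho> = min (1/2) (\<delta> / (2 * CARD('n)))"
  have \<rho>: "\<rho> > 0" "\<rho> \<le> 1/2" "\<rho> * CARD('n) < \<delta>"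
  proof -
    show "\<rho> > 0" "\<rho> \<le> 1/2" using \<delta>(1) by (auto simp: \<rho>_def)
    have "\<rho> * CARD('n) \<le> \<delta> / (2 * CARD('n)) * CARD('n)" by (intro mult_right_mono) (auto simp: \<rho>_def)
    then show "\<rho> * CARD('n) < \<delta>" using \<delta>(1) by simp
  qed
  define v where "v = (\<chi> k. \<rho> :: real^'n)"
  define Q where "Q = cbox (y0 - v) (y0 + v)"
  have QW: "y0 + h \<in> W" if h: "h \<in> cbox (- v) v" for h
  proof -
    have hk: "\<bar>h $ k\<bar> \<le> \<rho>" for k using h by (simp add: mem_box_cart v_def abs_le_iff minus_le_iff)
    have "norm h \<le> (\<Sum>k\<in>UNIV. \<bar>h $ k\<bar>)" by (rule norm_le_l1_cart)
    also have "\<dots> \<le> (\<Sum>k\<in>(UNIV::'n set). \<rho>)" by (rule sum_mono) (rule hk)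
    also have "\<dots> < \<delta>" using \<rho>(3) by (simp add: mult.commute)
    finally have "dist (p (y0 + h)) s < r0" by (intro \<delta>(2)) (simp add: dist_norm)
    then show ?thesis using nearF hk[of j] \<rho>(2) y0j by (simp add: W_def abs_le_iff)
  qed
  have QsubW: "Q \<subseteq> W"
  proof
    fix y assume "y \<in> Q"
    then have "y - y0 \<in> cbox (- v) v" by (auto simp: Q_def mem_box_cart algebra_simps)
    from QW[OF this] show "y \<in> W" by simp
  qed
  have contQ: "measure lborel Q > 0"
    unfolding Q_def by (rule content_pos_lt) (use \<rho>(1) in \<open>auto simp: v_def inner_axis Basis_vec_def inner_diff_left inner_add_left\<close>)
  have "w s \<le> \<bar>a\<bar> * C1 / measure lborel Q"
    if w: "continuous_on ?P w" "convex_on ?P w" "\<forall>x\<in>?P. 0 \<le> w x" "boundary_integral nv c d w < C1" for w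
  proof -
    let ?g = "\<lambda>y. w (p y)"
    have pWP: "p ` W \<subseteq> ?P" by (auto simp: W_def facet_of_index_def)
    have cg: "continuous_on W ?g"
      by (rule continuous_on_compose2[OF w(1) contp pWP])
    have "set_integrable lborel W ?g"
      unfolding set_integrable_def by (rule borel_integrable_compact[OF compW cg])
    then have intW: "?g integrable_on W" by (rule set_borel_integral_eq_integral)
    have intQ: "?g integrable_on Q"
      using integrable_continuous[OF continuous_on_subset[OF cg QsubW[unfolded Q_def]]] by (simp add: Q_def)
    have "w s * measure lborel Q \<le> integral Q ?g"
    proof -
      have "2 * ?g y0 \<le> ?g (y0 + h) + ?g (y0 - h)" if h: "h \<in> cbox (- v) v" for h
      proof -
        have mh: "- h \<in> cbox (- v) v" using h by (auto simp: mem_box_cart minus_le_iff le_minus_iff)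
        have "p (y0 + h) \<in> ?P" "p (y0 - h) \<in> ?P"
          using QW[OF h] QW[OF mh] by (auto simp: W_def facet_of_index_def)
        moreover have "p y0 = (1 - 1/2) *\<^sub>R p (y0 + h) + (1/2) *\<^sub>R p (y0 - h)"
        proof -
          define D where "D = h - ((nv i \<bullet> h) / a) *\<^sub>R e"
          have "p (y0 + h) = p y0 + D" "p (y0 - h) = p y0 - D"
            by (simp_all add: p_def D_def inner_add_right inner_diff_right algebra_simps
                add_divide_distrib diff_divide_distrib)
          then show ?thesis by (simp add: vec_eq_iff field_simps)
        qed
        ultimately show ?thesis
          using convex_onD[OF w(2), of "1/2" "p (y0 + h)" "p (y0 - h)"] by (simp add: field_simps)
      qed
      from midpoint_le_integral_cbox[of ?g y0 v, OF intQ[unfolded Q_def] this]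
      show ?thesis by (simp add: Q_def py0)
    qed
    also have "\<dots> \<le> integral W ?g"
      by (rule integral_subset_le[OF QsubW intQ intW]) (use w(3) pWP in auto)
    also have "\<dots> = \<bar>a\<bar> * facet_integral nv c d i w" using a by (simp add: fi)
    also have "\<dots> \<le> \<bar>a\<bar> * boundary_integral nv c d w"
      unfolding boundary_integral_def using i w(3)
      by (intro mult_left_mono member_le_sum facet_integral_nonneg) auto
    also have "\<dots> \<le> \<bar>a\<bar> * C1" using w(4) by (intro mult_left_mono) auto
    finally show ?thesis using contQ by (simp add: pos_le_divide_eq)
  qed
  then show ?thesis by blast
qed

text \<open>The set \<open>B\<close> of points at which all admissible functions share a bound is
  convex, because the functions are. It contains the relative interiors of the facets, hence their
  convex hull.\<close>

lemma interior_point_bound: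
  fixes nv :: "nat \<Rightarrow> real^'n"
  assumes delz: "delzant nv c d" and x: "x \<in> interior (polytope_of nv c d)"
  shows "\<exists>C. \<forall>w. continuous_on (polytope_of nv c d) w \<and> convex_on (polytope_of nv c d) w \<and>
    (\<forall>x\<in>polytope_of nv c d. 0 \<le> w x) \<and> boundary_integral nv c d w < C1 \<longrightarrow> w x \<le> C"
proof -
  let ?P = "polytope_of nv c d"
  define adm where "adm w \<longleftrightarrow> continuous_on ?P w \<and> convex_on ?P w \<and>
    (\<forall>x\<in>?P. 0 \<le> w x) \<and> boundary_integral nv c d w < C1" for w
  define B where "B = {x \<in> ?P. \<exists>C. \<forall>w. adm w \<longrightarrow> w x \<le> C}"
  have bounded: "bounded ?P" and dim: "\<And>i. i < d \<Longrightarrow> aff_dim (facet_of_index nv c d i) = int CARD('n) - 1"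
    and nz: "\<And>i. i < d \<Longrightarrow> nv i \<noteq> 0"
    using delz primitive_int_vec_nonzero unfolding delzant_def by blast+
  have "convex B"
  proof (rule convexI)
    fix x y :: "real^'n" and s t :: real
    assume xy: "x \<in> B" "y \<in> B" and st: "0 \<le> s" "0 \<le> t" "s + t = 1"
    obtain X Y where XY: "\<And>w. adm w \<Longrightarrow> w x \<le> X" "\<And>w. adm w \<Longrightarrow> w y \<le> Y"
      using xy unfolding B_def by blast
    have P: "x \<in> ?P" "y \<in> ?P" using xy by (auto simp: B_def)
    have "w (s *\<^sub>R x + t *\<^sub>R y) \<le> s * X + t * Y" if w: "adm w" for w
    proof -
      have s: "s = 1 - t" using st by simp
      have "w (s *\<^sub>R x + t *\<^sub>R y) \<le> s * w x + t * w y"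
        using w st P convex_onD[of ?P w t x y] unfolding adm_def s by auto
      also have "\<dots> \<le> s * X + t * Y"
        using st XY[OF w] by (intro add_mono mult_left_mono)
      finally show ?thesis .
    qed
    moreover have "s *\<^sub>R x + t *\<^sub>R y \<in> ?P"
      using convexD[OF convex_polytope_of P st] .
    ultimately show "s *\<^sub>R x + t *\<^sub>R y \<in> B" unfolding B_def by blast
  qed
  moreover have "rel_interior (facet_of_index nv c d i) \<subseteq> B" if i: "i < d" for i
  proof
    fix s assume s: "s \<in> rel_interior (facet_of_index nv c d i)"
    then have "s \<in> ?P" using rel_interior_subset by (fastforce simp: facet_of_index_def)
    then show "s \<in> B"
      using facet_point_bound[OF bounded i nz[OF i] dim[OF i] s, of C1]
      unfolding B_def adm_def by blast
  qed
  ultimately have "convex hull (\<Union>i<d. rel_interior (facet_of_index nv c d i)) \<subseteq> B"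
    by (intro hull_minimal) auto
  then have "x \<in> B" using interior_subset_hull_rel_interior_facets[OF bounded nz] x by blast
  then show ?thesis unfolding B_def adm_def by blast
qed

section \<open>From an interior point to a vertex, and from the vertices to the polytope\<close>

theorem theorem3p1:
  fixes nv :: "nat \<Rightarrow> real^'n" and c :: "nat \<Rightarrow> real" and d :: nat
    and x0 :: "real^'n" and C1 :: real
  assumes "delzant nv c d"
    and "x0 \<in> interior (polytope_of nv c d)"
  shows "\<exists>C. \<forall>u. symplectic_potential nv c d u \<and> normalized_at x0 u \<and>
            (\<forall>x\<in>interior (polytope_of nv c d). Rm_sq u x \<le> 1) \<and>
            boundary_integral nv c d u < C1
          \<longrightarrow> (\<forall>x\<in>polytope_of nv c d. u x < C)"
proof -
  let ?P = "polytope_of nv c d"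
  define V where "V = {v. v extreme_point_of ?P}"
  define adm where "adm u \<longleftrightarrow> symplectic_potential nv c d u \<and> normalized_at x0 u \<and>
            (\<forall>x\<in>interior ?P. Rm_sq u x \<le> 1) \<and> boundary_integral nv c d u < C1" for u
  have "\<exists>C. \<forall>u. adm u \<longrightarrow> u v \<le> C" if v: "v \<in> V" for v
  proof -
    have v: "v extreme_point_of ?P" using v by (simp add: V_def)
    then have vP: "v \<in> ?P" by (simp add: extreme_point_of_def)
    define I where "I = {i. i < d \<and> aff_fun nv c i v = 0}"
    \<comment> \<open>The facet functions through \<open>v\<close> scale by \<open>t\<close> on the
      segment from \<open>v\<close> to \<open>x0\<close>; this \<open>t\<close> brings their sum at
      \<open>q\<close> down to 1/2, independently of the potential.\<close>
    define t where "t = min 1 (1 / (2 * (\<bar>\<Sum>i\<in>I. aff_fun nv c i x0\<bar> + 1)))"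
    have t: "0 < t" "t \<le> 1" by (auto simp: t_def)
    \<comment> \<open>\<open>z\<close> is the midpoint of \<open>v\<close> and \<open>q\<close>.
      Extending the tangent plane at \<open>q\<close> through \<open>z\<close> to \<open>v\<close>
      doubles the step, so its height at \<open>v\<close> is at most 2 u(z) - u(q) \<le> 2 C; this
      is the origin of the bound \<open>2 * C + 1 / 2\<close>.\<close>
    define z where "z = (1 - t / 2) *\<^sub>R v + (t / 2) *\<^sub>R x0"
    define q where "q = (1 - t) *\<^sub>R v + t *\<^sub>R x0"
    have "(\<Sum>i\<in>I. aff_fun nv c i q) = t * (\<Sum>i\<in>I. aff_fun nv c i x0)"
      unfolding q_def aff_fun_convex_comb sum_distrib_left
      by (rule sum.cong) (auto simp: I_def)
    also have "\<dots> \<le> t * (\<bar>\<Sum>i\<in>I. aff_fun nv c i x0\<bar> + 1)"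
      using t by (intro mult_left_mono) auto
    also have "\<dots> \<le> 1 / (2 * (\<bar>\<Sum>i\<in>I. aff_fun nv c i x0\<bar> + 1)) * (\<bar>\<Sum>i\<in>I. aff_fun nv c i x0\<bar> + 1)"
      by (intro mult_right_mono) (auto simp: t_def)
    also have "\<dots> = 1 / 2" by (simp add: divide_simps)
    finally have small: "(\<Sum>i | i < d \<and> aff_fun nv c i v = 0. aff_fun nv c i q) \<le> 1 / 2"
      by (simp add: I_def)
    have nz: "\<And>i. i < d \<Longrightarrow> nv i \<noteq> 0"
      using assms(1) primitive_int_vec_nonzero unfolding delzant_def by blast
    have int: "(1 - s) *\<^sub>R v + s *\<^sub>R x0 \<in> interior ?P" if "0 < s" "s \<le> 1" for s
      using that vP assms(2) interior_polytope_of[of d nv c, OF nz]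
      by (auto simp: polytope_of_def aff_fun_convex_comb add_nonneg_pos)
    have q: "q \<in> interior ?P" and z: "z \<in> interior ?P"
      unfolding q_def z_def using t by (intro int; simp)+
    obtain C where C: "\<And>w. continuous_on ?P w \<Longrightarrow> convex_on ?P w \<Longrightarrow> (\<forall>x\<in>?P. 0 \<le> w x) \<Longrightarrow>
        boundary_integral nv c d w < C1 \<Longrightarrow> w z \<le> C"
      using interior_point_bound[OF assms(1) z, of C1] by blast
    have "u v \<le> 2 * C + 1 / 2" if u: "adm u" for u
    proof -
      interpret toric_potential nv c d u
        by unfold_locales (use assms(1) u in \<open>auto simp: adm_def\<close>)
      have nonneg: "\<forall>x\<in>?P. 0 \<le> u x"
        using nonneg_of_normalized[OF assms(2)] u by (auto simp: adm_def)
      have "u z \<le> C"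
        by (rule C[OF continuous_on_u convex_on_u nonneg]) (use u in \<open>simp add: adm_def\<close>)
      moreover have "u v \<le> u q + gradient u q \<bullet> (v - q) + 1 / 2"
        by (rule vertex_estimate[OF v _ q small]) (use u in \<open>simp add: adm_def\<close>)
      moreover have "v - q = 2 *\<^sub>R (z - q)"
        by (simp add: q_def z_def vec_eq_iff algebra_simps)
      then have "gradient u q \<bullet> (v - q) = 2 * (gradient u q \<bullet> (z - q))" by simp
      moreover have "u q + gradient u q \<bullet> (z - q) \<le> u z"
        by (rule gradient_tangent_le[OF convex_int q z])
      moreover have "0 \<le> u q" using nonneg in_P[OF q] by blast
      ultimately show ?thesis by linarith
    qed
    then show ?thesis by blast
  qed
  then obtain Cv where Cv: "\<And>v u. v \<in> V \<Longrightarrow> adm u \<Longrightarrow> u v \<le> Cv v" by metis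
  have fin: "finite V" unfolding V_def by (rule finite_polyhedron_extreme_points[OF polyhedron_polytope_of])
  define C where "C = (\<Sum>v\<in>V. \<bar>Cv v\<bar>)"
  have "u x < C + 1" if u: "adm u" and x: "x \<in> ?P" for u x
  proof -
    interpret toric_potential nv c d u
      by unfold_locales (use assms(1) u in \<open>auto simp: adm_def\<close>)
    have hull: "?P = convex hull V"
      unfolding V_def by (rule Krein_Milman_Minkowski[OF compact_P convex_polytope_of])
    have "u v \<le> C" if v: "v \<in> V" for v
    proof -
      have "u v \<le> \<bar>Cv v\<bar>" using Cv[OF v u] by linarith
      also have "\<dots> \<le> C" unfolding C_def by (rule member_le_sum[OF v _ fin]) simp
      finally show ?thesis .
    qed
    then have "\<forall>x\<in>convex hull V. u x \<le> C"
      using convex_on_u unfolding hull by (intro convex_on_convex_hull_bound) auto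
    then show ?thesis using x hull by fastforce
  qed
  then show ?thesis unfolding adm_def by blast
qed

end
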